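(* Let $n,m\ge1$ be integers, $x=(x_1,\dots,x_n)$, $y=(y_1,\dots,y_m)$, $u\in\frac12\mathbb{Z}_{\ge0}$ and $\epsilon\in\{+1,-1\}$. Then $$\mathrm{so}^{(2n+2m)}_{u^{n+m}_\epsilon}(x,y)=\sum_{\lambda_\delta\subseteq u^m}\mathrm{so}^{(2n)}_{(u^{n-m},\lambda_\delta)}(x)\cdot\mathrm{so}^{(2m)}_{\lambda_{\delta\epsilon}}(y)\qquad\text{if } n\ge m,$$ $$\mathrm{so}^{(2n+2m+1)}_{u^{n+m}}(x,y)=\sum_{\lambda_\delta\subseteq u^m}\mathrm{so}^{(2n+2)}_{(u^{n+1-m},\lambda_\delta)}(x,1)\cdot\mathrm{so}^{(2m)}_{\lambda_\delta}(y)\qquad\text{if } n+1\ge m.$$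
   Context: Partitions: a half-integer is an element of $\frac12+\mathbb{Z}$. A $k$-partition (resp. $k$-half-partition) is a $k$-tuple $\lambda_1\ge\dots\ge\lambda_k\ge0$ of integers (resp. half-integers). A signed $k$-partition (resp. signed $k$-half-partition) is a tuple $\lambda_\delta=(\lambda_1,\dots,\lambda_{k-1},\delta\lambda_k)$ with $\lambda$ a $k$-partition (resp. $k$-half-partition) and $\delta\in\{+1,-1\}$. $u^k=(u,\dots,u)$ ($k$ times), $u^k_\epsilon=(u,\dots,u,\epsilon u)$; $(a,b)$ denotes concatenation. A sum over $\lambda_\delta\subseteq u^m$ is over all signed $m$-partitions (if $u$ is an integer) or signed $m$-half-partitions (if $u$ is a half-integer) with $\lambda_i\le u$ for all $i$; if $\lambda_m=0$, so that $\lambda_+=\lambda_-$, this tuple is counted only once. Orthogonal Schur polynomials: an orthogonal pattern of height $M$ is an array $z=(z_{i,j})_{1\le i\le M,\,1\le j\le\lceil i/2\rceil}$ whose entries are either all integers or all half-integers, where the odd ends $z_{2i-1,i}$ ($1\le i\le\lceil M/2\rceil$) may be negative and all other entries are non-negative, and $|z_{i+1,j+1}|\le|z_{i,j}|\le|z_{i+1,j}|$ (each inequality whenever both entries exist). Its shape is its last row, and $\mathrm{type}(z)_i=\sum_{j=1}^{\lceil i/2\rceil}|z_{i,j}|-\sum_{j=1}^{\lceil(i-1)/2\rceil}|z_{i-1,j}|$. Set $\mathrm{sgn}(a)=+1$ for $a\ge0$, $-1$ for $a<0$, and $$w_n(z;x)=x_1^{z_{1,1}}\prod_{i=2}^n x_i^{\mathrm{sgn}(z_{2i-3,i-1})\,\mathrm{sgn}(z_{2i-1,i})\,[\mathrm{type}(z)_{2i-1}-\mathrm{type}(z)_{2i-2}]}.$$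 For a signed $n$-partition or signed $n$-half-partition $\nu$, $\mathrm{so}^{(2n)}_\nu(x_1,\dots,x_n)=\sum_z w_n(z;x)$ over orthogonal patterns of height $2n-1$ and shape $\nu$. For an $n$-partition or $n$-half-partition $\lambda$, $\mathrm{so}^{(2n+1)}_\lambda(x_1,\dots,x_n)=\sum_z w_n(z;x)$ over orthogonal patterns of height $2n$ and shape $\lambda$. These are the irreducible characters of $\mathrm{SO}_{2n}(\mathbb{C})$ and $\mathrm{SO}_{2n+1}(\mathbb{C})$; in particular they are symmetric in their variables. *)

theory Defs
  imports Complex_Main
begin

section \<open>Partitions\<close>

definition half_integers :: "rat set" where
  "half_integers = {a. a - 1/2 \<in> \<int>}"

definition partition_tuple :: "nat \<Rightarrow> rat list \<Rightarrow> bool" where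
  "partition_tuple k \<mu> \<longleftrightarrow>
     length \<mu> = k \<and> sorted_wrt (\<ge>) \<mu> \<and> (\<forall>a\<in>set \<mu>. 0 \<le> a \<and> a \<in> \<int>)"

definition half_partition_tuple :: "nat \<Rightarrow> rat list \<Rightarrow> bool" where
  "half_partition_tuple k \<mu> \<longleftrightarrow>
     length \<mu> = k \<and> sorted_wrt (\<ge>) \<mu> \<and> (\<forall>a\<in>set \<mu>. 0 \<le> a \<and> a \<in> half_integers)"

text \<open>The tuple $\lambda_\delta$, for nonempty $\lambda$ (written \<open>\<mu>\<close> in formulas). In particular $u^k_\epsilon$ is
  \<open>signed \<epsilon> (replicate k u)\<close>.\<close>

definition signed :: "rat \<Rightarrow> rat list \<Rightarrow> rat list" where
  "signed \<delta> \<mu> = butlast \<mu> @ [\<delta> * last \<mu>]"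

text \<open>The range of summation $\lambda_\delta \subseteq u^m$ (for $m \ge 1$), with the signed tuple
  $\lambda_\delta$ represented by the pair $(\lambda,\delta)$. If $\lambda_m = 0$, then
  $\lambda_+ = \lambda_-$, and only the sign $\delta = 1$ is admitted, so that each signed tuple is
  represented exactly once.\<close>

definition signed_tuples_in :: "nat \<Rightarrow> rat \<Rightarrow> (rat list \<times> rat) set" where
  "signed_tuples_in m u = {(\<mu>, \<delta>).
     (u \<in> \<int> \<and> partition_tuple m \<mu> \<or> u \<in> half_integers \<and> half_partition_tuple m \<mu>) \<and>
     (\<forall>a\<in>set \<mu>. a \<le> u) \<and> \<delta> \<in> {1, -1} \<and> (last \<mu> = 0 \<longrightarrow> \<delta> = 1)}"


section \<open>Orthogonal patterns\<close>

text \<open>Rows and columns are numbered from 1, and row $i$ has $\lceil i/2\rceil$ entries. A pattern is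
  a function on all of \<open>nat \<times> nat\<close> which is required to vanish outside the index set, so that
  each array corresponds to exactly one function. The odd ends are the positions $(i,j)$ with
  $i = 2j-1$.\<close>

definition row_length :: "nat \<Rightarrow> nat" where
  "row_length i = (i + 1) div 2"

definition pattern_index :: "nat \<Rightarrow> (nat \<times> nat) set" where
  "pattern_index M = {(i, j). 1 \<le> i \<and> i \<le> M \<and> 1 \<le> j \<and> j \<le> row_length i}"

definition orthogonal_pattern :: "nat \<Rightarrow> (nat \<Rightarrow> nat \<Rightarrow> rat) \<Rightarrow> bool" where
  "orthogonal_pattern M z \<longleftrightarrow>
     (\<forall>i j. (i, j) \<notin> pattern_index M \<longrightarrow> z i j = 0) \<and>
     ((\<forall>(i, j)\<in>pattern_index M. z i j \<in> \<int>) \<or>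
      (\<forall>(i, j)\<in>pattern_index M. z i j \<in> half_integers)) \<and>
     (\<forall>(i, j)\<in>pattern_index M. i \<noteq> 2 * j - 1 \<longrightarrow> 0 \<le> z i j) \<and>
     (\<forall>(i, j)\<in>pattern_index M.
        ((i + 1, j + 1) \<in> pattern_index M \<longrightarrow> \<bar>z (i + 1) (j + 1)\<bar> \<le> \<bar>z i j\<bar>) \<and>
        ((i + 1, j) \<in> pattern_index M \<longrightarrow> \<bar>z i j\<bar> \<le> \<bar>z (i + 1) j\<bar>))"

definition pattern_shape :: "nat \<Rightarrow> (nat \<Rightarrow> nat \<Rightarrow> rat) \<Rightarrow> rat list" where
  "pattern_shape M z = map (\<lambda>j. z M j) [1..<row_length M + 1]"

definition pattern_type :: "(nat \<Rightarrow> nat \<Rightarrow> rat) \<Rightarrow> nat \<Rightarrow> rat" where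
  "pattern_type z i =
     (\<Sum>j = 1..row_length i. \<bar>z i j\<bar>) - (\<Sum>j = 1..row_length (i - 1). \<bar>z (i - 1) j\<bar>)"

lemma pattern_entry_le_shape:
  assumes "orthogonal_pattern M z" "(i, j) \<in> pattern_index M"
  shows "\<bar>z i j\<bar> \<le> \<bar>z M j\<bar>"
proof -
  have "i \<le> M" using assms(2) by (auto simp: pattern_index_def)
  then show ?thesis
    using assms(2)
  proof (induction i rule: inc_induct)
    case base
    then show ?case by simp
  next
    case (step k)
    have k1: "(k + 1, j) \<in> pattern_index M"
      using step.hyps step.prems by (auto simp: pattern_index_def row_length_def)
    have "\<bar>z k j\<bar> \<le> \<bar>z (k + 1) j\<bar>"
      using assms(1) step.prems k1 unfolding orthogonal_pattern_def by blast
    with step.IH k1 show ?case by simp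
  qed
qed

lemma finite_pattern_index: "finite (pattern_index M)"
  by (rule finite_subset[of _ "{..M} \<times> {..M}"]) (auto simp: pattern_index_def row_length_def)

lemma finite_bounded_rat_half_int: "finite {a :: rat. 2 * a \<in> \<int> \<and> \<bar>a\<bar> \<le> b}"
proof (rule finite_subset)
  show "{a :: rat. 2 * a \<in> \<int> \<and> \<bar>a\<bar> \<le> b} \<subseteq> (\<lambda>k. of_int k / 2) ` {- \<lceil>2 * b\<rceil>..\<lceil>2 * b\<rceil>}"
  proof
    fix a :: rat assume "a \<in> {a. 2 * a \<in> \<int> \<and> \<bar>a\<bar> \<le> b}"
    then obtain k where k: "2 * a = of_int k" and "\<bar>a\<bar> \<le> b" by (auto elim: Ints_cases)
    then have "of_int k \<le> 2 * b" "of_int (- k) \<le> 2 * b" by (auto simp: abs_le_iff)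
    then have "k \<in> {- \<lceil>2 * b\<rceil>..\<lceil>2 * b\<rceil>}" by (auto simp: le_ceiling_iff minus_le_iff)
    moreover have "a = of_int k / 2" using k by simp
    ultimately show "a \<in> (\<lambda>k. of_int k / 2) ` {- \<lceil>2 * b\<rceil>..\<lceil>2 * b\<rceil>}" by blast
  qed
qed simp

lemma finite_patterns: "finite {z. orthogonal_pattern M z \<and> pattern_shape M z = \<nu>}"
proof -
  define b where "b = (\<Sum>a\<leftarrow>\<nu>. \<bar>a\<bar>)"
  define A where "A = {a :: rat. 2 * a \<in> \<int> \<and> \<bar>a\<bar> \<le> b}"
  define F where "F = {f. \<forall>p. (p \<in> pattern_index M \<longrightarrow> f p \<in> A) \<and> (p \<notin> pattern_index M \<longrightarrow> f p = (0::rat))}"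
  have "finite F"
    unfolding F_def A_def
    by (rule finite_set_of_finite_funs[OF finite_pattern_index finite_bounded_rat_half_int])
  moreover have "{z. orthogonal_pattern M z \<and> pattern_shape M z = \<nu>} \<subseteq> curry ` F"
  proof
    fix z assume "z \<in> {z. orthogonal_pattern M z \<and> pattern_shape M z = \<nu>}"
    then have z: "orthogonal_pattern M z" and sh: "pattern_shape M z = \<nu>" by auto
    have "z i j \<in> A" if ij: "(i, j) \<in> pattern_index M" for i j
    proof -
      have "z i j \<in> \<int> \<or> z i j \<in> half_integers"
        using z ij unfolding orthogonal_pattern_def by blast
      then have "2 * z i j \<in> \<int>"
      proof
        assume "z i j \<in> half_integers"
        then have "2 * (z i j - 1/2) + 1 \<in> \<int>"
          unfolding half_integers_def by (intro Ints_add Ints_mult) auto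
        then show ?thesis by (simp add: algebra_simps)
      qed auto
      moreover have "z M j \<in> set \<nu>"
        using ij by (auto simp: sh[symmetric] pattern_shape_def pattern_index_def row_length_def)
      then have "\<bar>z M j\<bar> \<le> b"
        unfolding b_def by (intro member_le_sum_list) auto
      ultimately show ?thesis
        using pattern_entry_le_shape[OF z ij] by (auto simp: A_def)
    qed
    moreover have "z i j = 0" if "(i, j) \<notin> pattern_index M" for i j
      using z that unfolding orthogonal_pattern_def by blast
    ultimately have "case_prod z \<in> F" by (auto simp: F_def)
    moreover have "z = curry (case_prod z)" by simp
    ultimately show "z \<in> curry ` F" by blast
  qed
  ultimately show ?thesis by (meson finite_imageI finite_subset)
qed


section \<open>Orthogonal Schur polynomials\<close>

text \<open>For half-integral weights these are Laurent polynomials in the square roots of the variables.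
  So the variables are given through the list \<open>r\<close> of chosen square roots, $x_i = r_i^2$, with
  $r_i \ne 0$ in a field, and $x_i^a$ for $2a \in \mathbb{Z}$ means $r_i^{2a}$. All exponents
  below satisfy $2a \in \mathbb{Z}$, so that the floor function does not round.\<close>

definition half_power :: "'a::field \<Rightarrow> rat \<Rightarrow> 'a" where
  "half_power r a = r powi \<lfloor>2 * a\<rfloor>"

text \<open>The library function \<open>sgn\<close> has \<open>sgn 0 = 0\<close>.\<close>

definition sign :: "rat \<Rightarrow> rat" where
  "sign a = (if 0 \<le> a then 1 else -1)"

definition weight :: "nat \<Rightarrow> (nat \<Rightarrow> nat \<Rightarrow> rat) \<Rightarrow> 'a::field list \<Rightarrow> 'a" where
  "weight n z r =
     half_power (r ! 0) (z 1 1) *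
     (\<Prod>i = 2..n. half_power (r ! (i - 1))
        (sign (z (2*i - 3) (i - 1)) * sign (z (2*i - 1) i) *
           (pattern_type z (2*i - 1) - pattern_type z (2*i - 2))))"

text \<open>\<open>so_char N \<nu> r\<close> is $\mathrm{so}^{(N)}_\nu(x_1,\dots,x_n)$ with \<open>n = N div 2\<close> variables: the
  patterns have height $2n-1$ for $N = 2n$, and $2n$ for $N = 2n+1$.\<close>

definition so_char :: "nat \<Rightarrow> rat list \<Rightarrow> 'a::field list \<Rightarrow> 'a" where
  "so_char N \<nu> r =
     (\<Sum>z | orthogonal_pattern (N - 1) z \<and> pattern_shape (N - 1) z = \<nu>. weight (N div 2) z r)"

end

theory Submission
  imports Defs "Jordan_Normal_Form.Determinant"
begin

text \<open>
  Two consecutive pairs of rows of a pattern define a branching kernel \<open>transfer a b q\<close>, and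
  $\mathrm{so}^{(2k)}$ is obtained by iterating it (\<open>so_rec\<close>). In a pattern of rectangular shape
  the interlacing inequalities force all entries above row $2n-1$ to equal $u$, except for a triangle
  at the odd ends that is itself an orthogonal pattern read upside down, with the same weights; the
  common row $2n-1$ is $(u^{n-m},\lambda_\delta)$. This gives the first identity with the variables
  $y$ in reverse order. The sign $\epsilon$ amounts to inverting the last variable. Since
  $\mathrm{so}^{(2k+1)}_{u^k}(x) = \mathrm{so}^{(2k+2)}_{u^{k+1}}(x,1)$, the second identity is an
  instance of the first one, up to the order of the variables.

  It remains to see that $\mathrm{so}^{(2k)}$ is symmetric. This follows from Weyl's formula
  $\mathrm{so}^{(2k)}_a \cdot \Delta = \frac12 \sum_{s = \pm 1} \det (x_i^{\alpha_j} + s x_i^{-\alpha_j})$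
  with $\alpha_j = a_j + k - j$, which is proved by induction on $k$: in the branching rule the sums
  over the entries of the two rows are telescoping sums in the rows of the determinant. The denominator
  $\Delta$ vanishes when variables coincide, so the formula is used for generic variables only, and
  symmetry extends to all nonzero ones since both sides are rational functions.
\<close>

section \<open>Determinants\<close>

text \<open>Two obstacles shape the determinant induction. First, interlacing ties the entries of
  neighbouring rows together. With the middle row \<open>c\<close> as outer and the lower row
  \<open>b\<close> as inner summation variable, every entry ranges over an interval of its own, so
  multilinearity applies; but the telescoped row j then contains both \<open>c ! j\<close> and
  \<open>c ! (j + 1)\<close>. Enlarging the determinant by one row and one column separates them,
  and the new column turns out to be the one of the new variable. Second, the signs at the odd ends
  multiply the whole exponent. Reflecting the middle row negates the exponent up to a boundary term,
  which makes it a sum over the entries again.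

  Both signs s occur because the Weyl group of type D contains only the even sign changes. The
  antisymmetry of \<Delta> is not computed: it is read off from Weyl's formula for the zero weight,
  whose character is 1. Coinciding variables are reached along a line on which all but finitely many
  points are generic.\<close>

lemma det_mat_expand:
  "det (mat k k f) = (\<Sum>p | p permutes {0..<k}. signof p * (\<Prod>i = 0..<k. f (i, p i)))"
proof -
  have "det (mat k k f) =
    (\<Sum>p | p permutes {0..<k}. signof p * (\<Prod>i = 0..<k. mat k k f $$ (i, p i)))"
    by (subst det_def') auto
  also have "\<dots> = (\<Sum>p | p permutes {0..<k}. signof p * (\<Prod>i = 0..<k. f (i, p i)))"
    by (intro sum.cong refl arg_cong2[where f = "(*)"] prod.cong)
       (auto dest: permutes_in_image)
  finally show ?thesis .
qed

lemma det_mat_scale: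
  fixes f :: "nat \<Rightarrow> nat \<Rightarrow> 'a::comm_ring_1"
  shows "det (mat k k (\<lambda>(i, j). c i * d j * f i j)) =
    (\<Prod>i<k. c i) * (\<Prod>j<k. d j) * det (mat k k (\<lambda>(i, j). f i j))"
proof -
  have "(\<Prod>i = 0..<k. c i * d (p i) * f i (p i)) =
      (\<Prod>i<k. c i) * (\<Prod>j<k. d j) * (\<Prod>i = 0..<k. f i (p i))" if "p permutes {0..<k}" for p
  proof -
    have "(\<Prod>i = 0..<k. d (p i)) = (\<Prod>j = 0..<k. d j)"
      using prod.permute[OF that, of d] by (simp add: o_def)
    then show ?thesis by (simp add: prod.distrib lessThan_atLeast0)
  qed
  then show ?thesis
    by (auto simp: det_mat_expand sum_distrib_left intro!: sum.cong)
qed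

text \<open>Subtracting multiples of the next row is left multiplication by a bidiagonal matrix with
  unit diagonal. Row sums over adjacent intervals have this form: row i ends at the point where row
  i + 1 starts.\<close>

lemma det_mat_telescope:
  fixes f :: "nat \<Rightarrow> nat \<Rightarrow> 'a::idom"
  shows "det (mat n n (\<lambda>(i, j). if Suc i < n then f i j - d i * f (Suc i) j else f i j)) =
    det (mat n n (\<lambda>(i, j). f i j))"
proof -
  define B where "B = mat n n (\<lambda>(i, j). if i = j then 1 else if j = Suc i then - d i else 0)"
  define M where "M = mat n n (\<lambda>(i, j). f i j)"
  have "mat n n (\<lambda>(i, j). if Suc i < n then f i j - d i * f (Suc i) j else f i j) = B * M"
  proof (rule eq_matI)
    fix i j assume "i < dim_row (B * M)" "j < dim_col (B * M)"
    then have ij: "i < n" "j < n" by (auto simp: B_def M_def)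
    have "(B * M) $$ (i, j) = (\<Sum>l = 0..<n. B $$ (i, l) * M $$ (l, j))"
      using ij by (simp add: B_def M_def scalar_prod_def)
    also have "\<dots> = (\<Sum>l\<in>{i, Suc i} \<inter> {0..<n}. B $$ (i, l) * M $$ (l, j))"
      using ij by (intro sum.mono_neutral_right) (auto simp: B_def)
    also have "\<dots> = (if Suc i < n then f i j - d i * f (Suc i) j else f i j)"
      using ij by (cases "Suc i < n") (auto simp: B_def M_def Int_insert_left)
    finally show "mat n n (\<lambda>(i, j). if Suc i < n then f i j - d i * f (Suc i) j else f i j) $$ (i, j)
        = (B * M) $$ (i, j)"
      using ij by simp
  qed (auto simp: B_def M_def)
  moreover have "det B = 1"
  proof -
    have "det B = prod_list (diag_mat B)"
      by (rule det_upper_triangular[of _ n]) (auto simp: B_def)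
    also have "diag_mat B = replicate n 1"
      by (intro nth_equalityI) (auto simp: diag_mat_def B_def)
    also have "prod_list \<dots> = (1::'a)"
      by simp
    finally show ?thesis .
  qed
  moreover have "det (B * M) = det B * det M"
    by (rule det_mult) (auto simp: B_def M_def)
  ultimately show ?thesis
    by (simp add: M_def)
qed

text \<open>Row operations clear column 0 except for one entry 1, and the remaining minor is the
  right-hand side. The point is the converse reading: a determinant whose rows mix
  \<open>f i\<close> with \<open>f (Suc i)\<close> is replaced by a larger one in which each row
  contains a single \<open>f i\<close>.\<close>

lemma det_mat_bordered:
  fixes f :: "nat \<Rightarrow> nat \<Rightarrow> 'a::idom"
  assumes "0 < k"
  shows "det (mat (Suc k) (Suc k)
      (\<lambda>(i, j). if j = 0 then (if i = k then w else 1) else f i (j - 1))) =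
    (- 1) ^ k * det (mat k k
      (\<lambda>(i, j). if Suc i < k then f i j - f (Suc i) j else w * f i j - f (Suc i) j))"
    (is "det (mat _ _ ?g) = _ * det ?R")
proof -
  define M where "M = mat (Suc k) (Suc k) ?g"
  define M1 where "M1 = addrow (- w) k (k - 1) M"
  have M1: "M1 \<in> carrier_mat (Suc k) (Suc k)" by (simp add: M1_def M_def)
  \<comment> \<open>No difference is taken in row \<open>k - 1\<close>: its entry 1 is the only one
    that survives in column 0.\<close>
  define d where "d i = (if i = k - 1 then 0 else 1 :: 'a)" for i
  define M2 where "M2 = mat (Suc k) (Suc k) (\<lambda>(i, j). if Suc i < Suc k
     then M1 $$ (i, j) - d i * M1 $$ (Suc i, j) else M1 $$ (i, j))"
  have M1e: "mat (Suc k) (Suc k) (\<lambda>(i, j). M1 $$ (i, j)) = M1"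
    using M1 by (intro eq_matI) auto
  have "det M = det M1"
    unfolding M1_def using assms by (subst det_addrow[of _ "Suc k"]) (auto simp: M_def)
  also have "\<dots> = det M2"
    unfolding M2_def using det_mat_telescope[of "Suc k" "\<lambda>i j. M1 $$ (i, j)" d] M1e by simp
  also have "\<dots> = (\<Sum>i<Suc k. M2 $$ (i, 0) * cofactor M2 i 0)"
    by (rule laplace_expansion_column) (auto simp: M2_def)
  also have "\<dots> = (\<Sum>i\<in>{k - 1}. M2 $$ (i, 0) * cofactor M2 i 0)"
  proof (rule sum.mono_neutral_right)
    show "\<forall>i\<in>{..<Suc k} - {k - 1}. M2 $$ (i, 0) * cofactor M2 i 0 = 0"
      using assms by (auto simp: M2_def M1_def M_def d_def less_Suc_eq)
  qed (use assms in auto)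
  also have "\<dots> = cofactor M2 (k - 1) 0"
    using assms by (simp add: M2_def M1_def M_def d_def)
  also have "\<dots> = (- 1) ^ (k - 1) * det (mat_delete M2 (k - 1) 0)"
    by (simp add: cofactor_def)
  \<comment> \<open>Deleting row \<open>k - 1\<close> moves row k, which is
    \<open>f k - w * f (k - 1)\<close>, into its place. This is the negative of the last row wanted,
    whence the factor - 1.\<close>
  also have "mat_delete M2 (k - 1) 0 =
      mat k k (\<lambda>(i, j). (if i = k - 1 then - 1 else 1) * 1 *
        (if Suc i < k then f i j - f (Suc i) j else w * f i j - f (Suc i) j))"
    using assms
    by (intro eq_matI) (auto simp: mat_delete_def M2_def M1_def M_def d_def)
  also have "det \<dots> = (\<Prod>i<k. if i = k - 1 then - 1 else 1) * (\<Prod>j<k. 1) * det ?R"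
    by (rule det_mat_scale)
  also have "(\<Prod>i<k. if i = k - 1 then - 1 else 1 :: 'a) = - 1"
    using assms by (subst prod.delta) auto
  also have "(- 1) ^ (k - 1) * (- 1 * (\<Prod>j<k. 1) * det ?R) = (- 1) ^ k * det ?R"
    using assms by (cases k) auto
  finally show ?thesis by (simp add: M_def)
qed

section \<open>Sums over boxes of lists\<close>

definition box :: "nat \<Rightarrow> (nat \<Rightarrow> 'b set) \<Rightarrow> 'b list set" where
  "box k A = {b. length b = k \<and> (\<forall>j<k. b ! j \<in> A j)}"

lemma bij_betw_box: "bij_betw (\<lambda>f. map f [0..<k]) (PiE {..<k} A) (box k A)"
proof (rule bij_betw_byWitness[where f' = "\<lambda>b. restrict (nth b) {..<k}"])
  show "\<forall>f\<in>PiE {..<k} A. restrict ((!) (map f [0..<k])) {..<k} = f"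
    by (auto simp: fun_eq_iff PiE_def extensional_def)
  show "\<forall>b\<in>box k A. map (restrict ((!) b) {..<k}) [0..<k] = b"
    by (auto simp: box_def intro!: nth_equalityI)
  show "(\<lambda>f. map f [0..<k]) ` PiE {..<k} A \<subseteq> box k A"
  proof
    fix b assume "b \<in> (\<lambda>f. map f [0..<k]) ` PiE {..<k} A"
    then obtain f where "f \<in> PiE {..<k} A" "b = map f [0..<k]" by blast
    then show "b \<in> box k A" unfolding box_def PiE_def Pi_def by simp
  qed
  show "(\<lambda>b. restrict (nth b) {..<k}) ` box k A \<subseteq> PiE {..<k} A"
    unfolding box_def PiE_def Pi_def by auto
qed

lemma finite_box: "(\<And>j. j < k \<Longrightarrow> finite (A j)) \<Longrightarrow> finite (box k A)"
  using bij_betw_finite[OF bij_betw_box[of k A]] by (auto intro: finite_PiE)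

lemma sum_prod_box:
  fixes g :: "nat \<Rightarrow> 'b \<Rightarrow> 'a::comm_semiring_1"
  assumes "\<And>j. j < k \<Longrightarrow> finite (A j)"
  shows "(\<Sum>b\<in>box k A. \<Prod>j<k. g j (b ! j)) = (\<Prod>j<k. \<Sum>x\<in>A j. g j x)"
proof -
  have "(\<Sum>b\<in>box k A. \<Prod>j<k. g j (b ! j)) = (\<Sum>f\<in>PiE {..<k} A. \<Prod>j<k. g j (map f [0..<k] ! j))"
    by (rule sum.reindex_bij_betw[OF bij_betw_box, symmetric])
  also have "\<dots> = (\<Sum>f\<in>PiE {..<k} A. \<Prod>j<k. g j (f j))"
    by simp
  also have "\<dots> = (\<Prod>j<k. \<Sum>x\<in>A j. g j x)"
    using assms by (subst prod_sum_PiE) auto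
  finally show ?thesis .
qed

text \<open>Multilinearity in the rows: the entry \<open>b ! i\<close> occurs in row i only, so each
  row can be summed separately.\<close>

lemma sum_det_box:
  fixes f :: "nat \<Rightarrow> nat \<Rightarrow> 'b \<Rightarrow> 'a::comm_ring_1"
  assumes "\<And>i. i < k \<Longrightarrow> finite (A i)"
  shows "(\<Sum>b\<in>box k A. det (mat k k (\<lambda>(i, j). f i j (b ! i)))) =
    det (mat k k (\<lambda>(i, j). \<Sum>x\<in>A i. f i j x))"
proof -
  have "(\<Sum>b\<in>box k A. det (mat k k (\<lambda>(i, j). f i j (b ! i)))) =
    (\<Sum>b\<in>box k A. \<Sum>p | p permutes {0..<k}. signof p * (\<Prod>i<k. f i (p i) (b ! i)))"
    by (simp add: det_mat_expand atLeast0LessThan)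
  also have "\<dots> = (\<Sum>p | p permutes {0..<k}. \<Sum>b\<in>box k A. signof p * (\<Prod>i<k. f i (p i) (b ! i)))"
    by (rule sum.swap)
  also have "\<dots> = (\<Sum>p | p permutes {0..<k}. signof p * (\<Prod>i<k. \<Sum>x\<in>A i. f i (p i) x))"
  proof (intro sum.cong refl)
    fix p
    show "(\<Sum>b\<in>box k A. signof p * (\<Prod>i<k. f i (p i) (b ! i))) =
        signof p * (\<Prod>i<k. \<Sum>x\<in>A i. f i (p i) x)"
      using assms sum_prod_box[of k A "\<lambda>i. f i (p i)"] by (simp flip: sum_distrib_left)
  qed
  finally show ?thesis by (simp add: det_mat_expand atLeast0LessThan)
qed

section \<open>Half-integral powers and intervals\<close>

lemma half_power_add:
  assumes "r \<noteq> 0" "2 * a \<in> \<int>" "2 * b \<in> \<int>"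
  shows "half_power r (a + b) = half_power r a * half_power r b"
proof -
  obtain m n where "2 * a = of_int m" "2 * b = of_int n"
    using assms by (auto elim!: Ints_cases)
  then have "\<lfloor>2 * (a + b)\<rfloor> = m + n" "\<lfloor>2 * a\<rfloor> = m" "\<lfloor>2 * b\<rfloor> = n"
    by (simp_all add: distrib_left)
  then show ?thesis using assms(1) by (simp add: half_power_def power_int_add)
qed

lemma half_power_minus:
  assumes "2 * a \<in> \<int>"
  shows "half_power r (- a) = inverse (half_power r a)"
proof -
  obtain m where "2 * a = of_int m" using assms by (auto elim!: Ints_cases)
  then have "\<lfloor>2 * a\<rfloor> = m" "\<lfloor>2 * - a\<rfloor> = - m" by simp_all
  then show ?thesis by (simp add: half_power_def power_int_minus)
qed

lemma half_power_inverse: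
  "2 * a \<in> \<int> \<Longrightarrow> half_power (inverse r) a = half_power r (- a)"
  by (simp add: half_power_minus) (simp add: half_power_def power_int_inverse)

lemma half_power_0 [simp]: "half_power r 0 = 1"
  by (simp add: half_power_def)

lemma half_power_1: "half_power r 1 = r\<^sup>2"
  by (simp add: half_power_def)

lemma half_power_one_left [simp]: "half_power 1 a = 1"
  by (simp add: half_power_def)

lemma half_power_nonzero: "r \<noteq> 0 \<Longrightarrow> half_power r a \<noteq> 0"
  by (simp add: half_power_def)

lemma half_power_sum:
  assumes "r \<noteq> 0" "finite A" "\<And>i. i \<in> A \<Longrightarrow> 2 * f i \<in> \<int>"
  shows "half_power r (\<Sum>i\<in>A. f i) = (\<Prod>i\<in>A. half_power r (f i))"
  using assms(2,3)
proof (induction A rule: finite_induct)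
  case (insert x A)
  have "2 * (\<Sum>i\<in>A. f i) \<in> \<int>"
    using insert unfolding sum_distrib_left by (intro Ints_sum) auto
  then show ?case using insert assms(1) by (simp add: half_power_add)
qed simp

lemma Ints_minus_cong: "a - h \<in> \<int> \<Longrightarrow> b - h \<in> \<int> \<Longrightarrow> a - b \<in> (\<int> :: rat set)"
  using Ints_diff[of "a - h" "b - h"] by simp

lemma Ints_double_cong:
  assumes "2 * h \<in> \<int>" "a - h \<in> \<int>"
  shows "2 * a \<in> (\<int> :: rat set)"
proof -
  have "2 * h + of_int 2 * (a - h) \<in> \<int>" by (intro Ints_add Ints_mult Ints_of_int assms)
  then show ?thesis by (simp add: algebra_simps)
qed

lemma Ints_uminus_cong:
  assumes "2 * h \<in> \<int>" "a - h \<in> \<int>"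
  shows "- a - h \<in> (\<int> :: rat set)"
proof -
  have "- (a - h) - 2 * h \<in> \<int>"
    by (rule Ints_diff[OF Ints_minus[OF assms(2)] assms(1)])
  then show ?thesis by (simp add: algebra_simps)
qed

lemma Ints_abs_cong:
  "2 * h \<in> \<int> \<Longrightarrow> a - h \<in> \<int> \<Longrightarrow> \<bar>a\<bar> - h \<in> (\<int> :: rat set)"
  using Ints_uminus_cong[of h a] by (cases "0 \<le> a") auto

text \<open>The parameter \<open>h\<close> only fixes a class modulo 1, so that integral and
  half-integral entries are treated alike.\<close>

definition zrange :: "rat \<Rightarrow> rat \<Rightarrow> rat \<Rightarrow> rat set" where
  "zrange h l u = {c. c - h \<in> \<int> \<and> l \<le> c \<and> c \<le> u}"

lemma zrange_cong: "h - h' \<in> \<int> \<Longrightarrow> zrange h l u = zrange h' l u"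
proof -
  assume h: "h - h' \<in> \<int>"
  have "c - h \<in> \<int> \<longleftrightarrow> c - h' \<in> \<int>" for c
    using Ints_add[of "c - h" "h - h'"] Ints_diff[of "c - h'" "h - h'"] h by auto
  then show ?thesis by (simp add: zrange_def)
qed

lemma zrange_eq_image:
  assumes "l - h \<in> \<int>" "u - h \<in> \<int>" "l \<le> u + 1"
  obtains n where "u + 1 = l + of_nat n" "zrange h l u = (\<lambda>i. l + of_nat i) ` {..<n}"
proof -
  have "u + 1 - l \<in> \<int>" using Ints_add[OF Ints_minus_cong[OF assms(2,1)] Ints_1]
    by (simp add: algebra_simps)
  then obtain i where i: "u + 1 - l = of_int i" by (auto elim: Ints_cases)
  with assms(3) have "of_int i \<ge> (0::rat)" by linarith
  then have "0 \<le> i" by simp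
  then obtain n where n: "i = int n" by (metis nonneg_int_cases)
  have un: "u + 1 = l + of_nat n" using i n by (simp add: algebra_simps)
  have "zrange h l u = (\<lambda>i. l + of_nat i) ` {..<n}"
  proof (intro equalityI subsetI)
    fix c assume "c \<in> zrange h l u"
    then have c: "c - h \<in> \<int>" "l \<le> c" "c \<le> u" by (auto simp: zrange_def)
    obtain j where j: "c - l = of_int j"
      using Ints_minus_cong[OF c(1) assms(1)] by (auto elim: Ints_cases)
    with c have "of_int j \<ge> (0::rat)" by linarith
    then obtain p where p: "j = int p" by (metis nonneg_int_cases of_int_0_le_iff)
    have cp: "c = l + of_nat p" using j p by (simp add: algebra_simps)
    then have "of_nat p < (of_nat n :: rat)" using un c(3) by linarith
    then show "c \<in> (\<lambda>i. l + of_nat i) ` {..<n}" using cp by auto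
  next
    fix c assume "c \<in> (\<lambda>i. l + of_nat i) ` {..<n}"
    then obtain p where p: "p < n" "c = l + of_nat p" by auto
    then have "Suc p \<le> n" by simp
    then have "of_nat (Suc p) \<le> (of_nat n :: rat)" unfolding of_nat_le_iff .
    then have "c \<le> u" using un p by simp
    moreover have "c - h = (l - h) + of_nat p" using p by simp
    then have "c - h \<in> \<int>" using assms(1) by (metis Ints_add Ints_of_nat)
    ultimately show "c \<in> zrange h l u" using p by (auto simp: zrange_def)
  qed
  with un that show thesis by blast
qed

lemma finite_zrange [simp]: "finite (zrange h l u)"
proof -
  have "zrange h l u \<subseteq> (\<lambda>i. h + of_int i) ` {\<lfloor>l - h\<rfloor>..\<lceil>u - h\<rceil>}"
  proof
    fix c assume "c \<in> zrange h l u"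
    then obtain i where "c - h = of_int i" "l \<le> c" "c \<le> u"
      by (auto simp: zrange_def elim: Ints_cases)
    then have "c = h + of_int i" "i \<in> {\<lfloor>l - h\<rfloor>..\<lceil>u - h\<rceil>}"
      by (auto simp: floor_le_iff le_ceiling_iff algebra_simps)
    then show "c \<in> (\<lambda>i. h + of_int i) ` {\<lfloor>l - h\<rfloor>..\<lceil>u - h\<rceil>}" by blast
  qed
  then show ?thesis by (rule finite_subset) simp
qed

text \<open>The case \<open>l = u + 1\<close> of an empty interval is included; it occurs at the odd
  end when the extreme entries agree.\<close>

lemma sum_zrange_telescope:
  fixes F :: "rat \<Rightarrow> 'a::ab_group_add"
  assumes "l - h \<in> \<int>" "u - h \<in> \<int>" "l \<le> u + 1"
  shows "(\<Sum>c\<in>zrange h l u. F (c + 1) - F c) = F (u + 1) - F l"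
proof -
  obtain n where n: "u + 1 = l + of_nat n" "zrange h l u = (\<lambda>i. l + of_nat i) ` {..<n}"
    using zrange_eq_image[OF assms] .
  have "(\<Sum>c\<in>zrange h l u. F (c + 1) - F c) =
      (\<Sum>i<n. F (l + of_nat (Suc i)) - F (l + of_nat i))"
    unfolding n(2) by (subst sum.reindex) (auto simp: inj_on_def add_ac)
  also have "\<dots> = F (l + of_nat n) - F l"
    by (subst sum_lessThan_telescope) simp
  finally show ?thesis by (simp add: n(1))
qed

lemma sum_zrange_uminus:
  assumes "2 * h \<in> \<int>"
  shows "(\<Sum>c\<in>zrange h l u. f (- c)) = (\<Sum>c\<in>zrange h (- u) (- l). f c)"
  by (rule sum.reindex_bij_witness[of _ uminus uminus])
     (simp_all add: zrange_def Ints_uminus_cong[OF assms])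

section \<open>The branching kernel\<close>

text \<open>The dominant weights of type D. The absolute value on the left makes all entries but the
  last non-negative and leaves the sign of the last one free.\<close>

definition so_tuple :: "nat \<Rightarrow> rat list \<Rightarrow> bool" where
  "so_tuple k a \<longleftrightarrow> length a = k \<and> (\<forall>j<k. 2 * a ! j \<in> \<int> \<and> a ! j - a ! 0 \<in> \<int>) \<and>
     (\<forall>j. Suc j < k \<longrightarrow> \<bar>a ! Suc j\<bar> \<le> a ! j)"

definition so_tuples_in :: "nat \<Rightarrow> rat \<Rightarrow> rat list set" where
  "so_tuples_in k u = {b. so_tuple k b \<and> (\<forall>j<k. b ! j - u \<in> \<int> \<and> \<bar>b ! j\<bar> \<le> u)}"

text \<open>The even rows that fit between the odd rows \<open>a\<close> (above, longer by one
  entry) and \<open>b\<close> (below). Non-negativity of \<open>c\<close> is contained in the lower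
  bounds.\<close>

definition mid_rows :: "rat list \<Rightarrow> rat list \<Rightarrow> rat list set" where
  "mid_rows a b = {c. length c = length b \<and> (\<forall>j<length b. c ! j - a ! 0 \<in> \<int> \<and>
     \<bar>a ! Suc j\<bar> \<le> c ! j \<and> c ! j \<le> \<bar>a ! j\<bar> \<and> \<bar>b ! j\<bar> \<le> c ! j \<and>
     (Suc j < length b \<longrightarrow> c ! Suc j \<le> \<bar>b ! j\<bar>))}"

text \<open>The value 1 for the empty row makes the first factor of the weight uniform with the
  others: for \<open>a = [x]\<close> and \<open>b = []\<close> the exponent is
  \<open>sign x * \<bar>x\<bar> = x\<close>.\<close>

definition end_sign :: "rat list \<Rightarrow> rat" where
  "end_sign a = (if a = [] then 1 else Defs.sign (last a))"

definition abs_sum :: "rat list \<Rightarrow> rat" where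
  "abs_sum a = (\<Sum>j<length a. \<bar>a ! j\<bar>)"

definition entry_sum :: "rat list \<Rightarrow> rat" where
  "entry_sum c = (\<Sum>j<length c. c ! j)"

text \<open>The exponent is the difference of two consecutive entries of the type,
  \<open>(\<bar>a\<bar> - \<bar>c\<bar>) - (\<bar>c\<bar> - \<bar>b\<bar>)\<close>, with
  \<open>\<bar>a\<bar>\<close> standing for the sum of absolute values, times the two end
  signs.\<close>

definition transfer :: "rat list \<Rightarrow> rat list \<Rightarrow> 'a::field \<Rightarrow> 'a" where
  "transfer a b q = (\<Sum>c\<in>mid_rows a b.
     half_power q (end_sign a * end_sign b * (abs_sum a - 2 * entry_sum c + abs_sum b)))"

text \<open>The recursion descends from the top row, to which the last variable of the character
  belongs. Hence the list of variables is the reverse of that in \<open>so_char\<close>.\<close>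

fun so_rec :: "rat list \<Rightarrow> 'a::field list \<Rightarrow> 'a" where
  "so_rec a [] = 1"
| "so_rec a (q # rs) =
     (\<Sum>b\<in>so_tuples_in (length a - 1) (a ! 0). transfer a b q * so_rec b rs)"

lemma mid_rows_Nil [simp]: "mid_rows a [] = {[]}"
  by (auto simp: mid_rows_def)

lemma so_tuples_in_0 [simp]: "so_tuples_in 0 u = {[]}"
  by (auto simp: so_tuples_in_def so_tuple_def)

lemma finite_so_tuples_in [simp]: "finite (so_tuples_in k u)"
proof (rule finite_subset)
  show "so_tuples_in k u \<subseteq> box k (\<lambda>_. zrange u (- u) u)"
    by (auto simp: so_tuples_in_def so_tuple_def box_def zrange_def abs_le_iff)
qed (auto intro: finite_box)

section \<open>Reflection of the middle row\<close>

definition mid_lo :: "rat list \<Rightarrow> rat list \<Rightarrow> nat \<Rightarrow> rat" where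
  "mid_lo a b j = max \<bar>a ! Suc j\<bar> \<bar>b ! j\<bar>"

definition mid_hi :: "rat list \<Rightarrow> rat list \<Rightarrow> nat \<Rightarrow> rat" where
  "mid_hi a b j = (if j = 0 then \<bar>a ! 0\<bar> else min \<bar>a ! j\<bar> \<bar>b ! (j - 1)\<bar>)"

lemma mid_rows_box:
  "mid_rows a b = box (length b) (\<lambda>j. zrange (a ! 0) (mid_lo a b j) (mid_hi a b j))"
proof (intro equalityI subsetI)
  fix c assume c: "c \<in> mid_rows a b"
  have "c ! j \<le> mid_hi a b j" if "j < length b" for j
    using c that by (cases j) (auto simp: mid_rows_def mid_hi_def)
  with c show "c \<in> box (length b) (\<lambda>j. zrange (a ! 0) (mid_lo a b j) (mid_hi a b j))"
    by (auto simp: mid_rows_def box_def zrange_def mid_lo_def)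
next
  fix c assume "c \<in> box (length b) (\<lambda>j. zrange (a ! 0) (mid_lo a b j) (mid_hi a b j))"
  then have c: "length c = length b" and c2: "\<And>j. j < length b \<Longrightarrow>
      c ! j - a ! 0 \<in> \<int> \<and> mid_lo a b j \<le> c ! j \<and> c ! j \<le> mid_hi a b j"
    by (auto simp: box_def zrange_def)
  have "c ! Suc j \<le> \<bar>b ! j\<bar>" if "Suc j < length b" for j
    using c2[of "Suc j"] that by (auto simp: mid_hi_def)
  moreover have "c ! j \<le> \<bar>a ! j\<bar>" if "j < length b" for j
    using c2[of j] that by (auto simp: mid_hi_def split: if_splits)
  ultimately show "c \<in> mid_rows a b"
    using c c2 by (auto simp: mid_rows_def mid_lo_def)
qed

lemma finite_mid_rows [simp]: "finite (mid_rows a b)"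
  by (simp add: mid_rows_box finite_box)

definition end_min :: "rat list \<Rightarrow> rat list \<Rightarrow> rat" where
  "end_min a b = (if b = [] then \<bar>last a\<bar> else min \<bar>last a\<bar> \<bar>last b\<bar>)"

text \<open>The entries \<open>a ! Suc j\<close> and \<open>b ! j\<close> meet once in a
  \<open>max\<close> and once in a \<open>min\<close>, which add up to their sum. Only the two last
  entries occur in a \<open>max\<close> alone; their missing \<open>min\<close> is
  \<open>end_min\<close>.\<close>

lemma sum_mid_lo_hi:
  assumes "length a = Suc (length b)"
  shows "(\<Sum>j<length b. mid_lo a b j + mid_hi a b j) = abs_sum a + abs_sum b - end_min a b"
proof (cases "length b")
  case 0
  then obtain x where "a = [x]" "b = []" using assms by (auto simp: length_Suc_conv)
  then show ?thesis by (simp add: abs_sum_def end_min_def)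
next
  case (Suc k)
  have last: "last a = a ! Suc k" "last b = b ! k"
    using Suc assms by (metis last_conv_nth length_0_conv Zero_not_Suc diff_Suc_1)+
  have "b \<noteq> []" using Suc by auto
  have *: "max x y + min x y = x + y" for x y :: rat by (simp add: max_def min_def)
  have "(\<Sum>j<length b. mid_lo a b j + mid_hi a b j) =
      (\<Sum>j<Suc k. mid_lo a b j) + (\<Sum>j<Suc k. mid_hi a b j)"
    by (simp add: Suc sum.distrib)
  also have "(\<Sum>j<Suc k. mid_hi a b j) = \<bar>a ! 0\<bar> + (\<Sum>j<k. min \<bar>a ! Suc j\<bar> \<bar>b ! j\<bar>)"
    by (subst sum.lessThan_Suc_shift) (simp add: mid_hi_def)
  also have "(\<Sum>j<Suc k. mid_lo a b j) =
      (\<Sum>j<k. max \<bar>a ! Suc j\<bar> \<bar>b ! j\<bar>) + max \<bar>last a\<bar> \<bar>last b\<bar>"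
    by (simp add: mid_lo_def last)
  also have "(\<Sum>j<k. max \<bar>a ! Suc j\<bar> \<bar>b ! j\<bar>) + max \<bar>last a\<bar> \<bar>last b\<bar> +
      (\<bar>a ! 0\<bar> + (\<Sum>j<k. min \<bar>a ! Suc j\<bar> \<bar>b ! j\<bar>)) =
      \<bar>a ! 0\<bar> + (\<Sum>j<k. \<bar>a ! Suc j\<bar>) + (\<Sum>j<k. \<bar>b ! j\<bar>) + max \<bar>last a\<bar> \<bar>last b\<bar>"
    by (simp add: sum.distrib[symmetric] *)
  also have "\<bar>a ! 0\<bar> + (\<Sum>j<k. \<bar>a ! Suc j\<bar>) = abs_sum a - \<bar>last a\<bar>"
    unfolding abs_sum_def assms Suc
    using sum.lessThan_Suc_shift[of "\<lambda>j. \<bar>a ! j\<bar>" k] by (simp add: last)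
  also have "(\<Sum>j<k. \<bar>b ! j\<bar>) = abs_sum b - \<bar>last b\<bar>"
    unfolding abs_sum_def Suc by (simp add: last)
  finally show ?thesis
    using \<open>b \<noteq> []\<close> by (simp add: end_min_def max_def min_def)
qed

text \<open>Each entry of a middle row ranges over an interval on its own, so all of them can be reflected
  in the midpoints of their intervals.\<close>

lemma sum_mid_rows_reflect:
  assumes "length a = Suc (length b)" "2 * a ! 0 \<in> \<int>"
    and "\<And>j. j < length a \<Longrightarrow> a ! j - a ! 0 \<in> \<int>"
    and "\<And>j. j < length b \<Longrightarrow> b ! j - a ! 0 \<in> \<int>"
  shows "(\<Sum>c\<in>mid_rows a b. g (entry_sum c)) =
    (\<Sum>c\<in>mid_rows a b. g (abs_sum a + abs_sum b - end_min a b - entry_sum c))"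
proof -
  define R where "R c = map (\<lambda>j. mid_lo a b j + mid_hi a b j - c ! j) [0..<length b]" for c
  define k where "k = length b"
  define A where "A j = zrange (a ! 0) (mid_lo a b j) (mid_hi a b j)" for j
  have lo: "mid_lo a b j - a ! 0 \<in> \<int>" and hi: "mid_hi a b j - a ! 0 \<in> \<int>" if "j < k" for j
  proof -
    have "\<bar>a ! Suc j\<bar> - a ! 0 \<in> \<int>" "\<bar>b ! j\<bar> - a ! 0 \<in> \<int>" "\<bar>a ! j\<bar> - a ! 0 \<in> \<int>"
      "\<bar>b ! (j - 1)\<bar> - a ! 0 \<in> \<int>" "\<bar>a ! 0\<bar> - a ! 0 \<in> \<int>"
      using assms that by (auto simp: k_def intro!: Ints_abs_cong)
    then show "mid_lo a b j - a ! 0 \<in> \<int>" "mid_hi a b j - a ! 0 \<in> \<int>"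
      by (auto simp: mid_lo_def mid_hi_def max_def min_def)
  qed
  have R: "R c \<in> box k A" if c: "c \<in> box k A" for c
  proof -
    have "mid_lo a b j + mid_hi a b j - c ! j - a ! 0 \<in> \<int>" if "j < k" for j
    proof -
      have "(mid_lo a b j - a ! 0) + (mid_hi a b j - a ! 0) - (c ! j - a ! 0) \<in> \<int>"
        using c that
        by (intro Ints_diff[OF Ints_add[OF lo[OF that] hi[OF that]]])
           (auto simp: box_def A_def zrange_def)
      then show ?thesis by (simp add: algebra_simps)
    qed
    then show ?thesis using c by (auto simp: box_def A_def zrange_def R_def k_def)
  qed
  have RR: "R (R c) = c" if "c \<in> box k A" for c
    using that by (intro nth_equalityI) (auto simp: R_def box_def k_def)
  have ES: "entry_sum (R c) = abs_sum a + abs_sum b - end_min a b - entry_sum c"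
    if "c \<in> box k A" for c
    using that sum_mid_lo_hi[OF assms(1)]
    by (simp add: entry_sum_def R_def box_def k_def sum_subtractf)
  have "(\<Sum>c\<in>box k A. g (entry_sum c)) =
      (\<Sum>c\<in>box k A. g (abs_sum a + abs_sum b - end_min a b - entry_sum c))"
    by (rule sum.reindex_bij_witness[of _ R R]) (auto simp: R RR ES[OF R] ES)
  then show ?thesis unfolding mid_rows_box k_def A_def .
qed

definition compatible :: "rat list \<Rightarrow> rat list \<Rightarrow> bool" where
  "compatible a b \<longleftrightarrow> so_tuple (Suc (length b)) a \<and> so_tuple (length b) b \<and>
     (\<forall>j<length b. b ! j - a ! 0 \<in> \<int>)"

lemma compatible_so_tuples_in:
  "so_tuple (Suc k) a \<Longrightarrow> b \<in> so_tuples_in k (a ! 0) \<Longrightarrow> compatible a b"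
  by (auto simp: compatible_def so_tuples_in_def so_tuple_def)

lemma sum_mid_rows_reflect':
  assumes "compatible a b"
  shows "(\<Sum>c\<in>mid_rows a b. g (entry_sum c)) =
    (\<Sum>c\<in>mid_rows a b. g (abs_sum a + abs_sum b - end_min a b - entry_sum c))"
  using assms by (intro sum_mid_rows_reflect) (auto simp: compatible_def so_tuple_def)

lemma double_abs_sum: "(\<And>j. j < length a \<Longrightarrow> 2 * a ! j \<in> \<int>) \<Longrightarrow> 2 * abs_sum a \<in> \<int>"
  unfolding abs_sum_def sum_distrib_left
  by (intro Ints_sum) (auto simp: abs_if)

lemma double_entry_sum: "(\<And>j. j < length a \<Longrightarrow> 2 * a ! j \<in> \<int>) \<Longrightarrow> 2 * entry_sum a \<in> \<int>"
  unfolding entry_sum_def sum_distrib_left by (intro Ints_sum) auto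

lemma end_sign_cases: "end_sign a = 1 \<or> end_sign a = - 1"
  by (auto simp: end_sign_def Defs.sign_def)

lemma double_exponent:
  assumes "compatible a b" "c \<in> mid_rows a b"
  shows "2 * (end_sign a * end_sign b * (abs_sum a - 2 * entry_sum c + abs_sum b)) \<in> \<int>"
proof -
  have ab: "2 * abs_sum a \<in> \<int>" "2 * abs_sum b \<in> \<int>"
    using assms by (auto intro!: double_abs_sum simp: compatible_def so_tuple_def)
  have a0: "2 * a ! 0 \<in> \<int>" using assms(1) by (simp add: compatible_def so_tuple_def)
  have "2 * c ! j \<in> \<int>" if "j < length c" for j
    using assms(2) that by (intro Ints_double_cong[OF a0]) (simp add: mid_rows_def)
  then have c: "2 * entry_sum c \<in> \<int>" by (intro double_entry_sum)
  have s: "end_sign a * end_sign b \<in> \<int>"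
    using end_sign_cases[of a] end_sign_cases[of b] by auto
  have "end_sign a * end_sign b * (2 * abs_sum a - of_int 2 * (2 * entry_sum c) + 2 * abs_sum b) \<in> \<int>"
    by (rule Ints_mult[OF s Ints_add[OF Ints_diff[OF ab(1) Ints_mult[OF Ints_of_int c]] ab(2)]])
  then show ?thesis by (simp add: algebra_simps)
qed

section \<open>Change of sign at the odd end\<close>

lemma signed_one: "a \<noteq> [] \<Longrightarrow> signed 1 a = a"
  by (simp add: signed_def)

lemma length_signed: "a \<noteq> [] \<Longrightarrow> length (signed d a) = length a"
  by (simp add: signed_def)

lemma nth_signed:
  "j < length a \<Longrightarrow> signed d a ! j = (if Suc j = length a then d * a ! j else a ! j)"
  by (cases a rule: rev_cases) (auto simp: signed_def nth_append)

lemma last_signed [simp]: "last (signed d a) = d * last a"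
  by (simp add: signed_def)

lemma abs_nth_signed: "j < length a \<Longrightarrow> \<bar>signed (- 1) a ! j\<bar> = \<bar>a ! j\<bar>"
  by (simp add: nth_signed)

lemma abs_sum_signed: "a \<noteq> [] \<Longrightarrow> abs_sum (signed (- 1) a) = abs_sum a"
  unfolding abs_sum_def by (rule sum.cong) (simp_all add: length_signed abs_nth_signed)

lemma mid_rows_signed:
  assumes "length a = Suc (length b)"
  shows "mid_rows (signed (- 1) a) b = mid_rows a b"
proof -
  have "signed (- 1) a ! 0 = a ! 0" if "j < length b" for j
    using assms that by (auto simp: nth_signed)
  then show ?thesis
    unfolding mid_rows_def using assms
    by (intro Collect_cong conj_cong refl all_cong) (auto simp: abs_nth_signed)
qed

text \<open>Everything in the kernel except \<open>end_sign a\<close> depends on absolute values, so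
  a nonzero last entry just negates the exponent. If \<open>last a = 0\<close>, the left side is the
  kernel of \<open>a\<close> itself, and its invariance under inverting \<open>q\<close> is the
  reflection of the middle row, as \<open>end_min\<close> is then 0.\<close>

lemma transfer_signed:
  assumes "compatible a b"
  shows "transfer (signed (- 1) a) b q = transfer a b (inverse q)"
proof -
  have len: "length a = Suc (length b)" and a: "a \<noteq> []"
    using assms by (auto simp: compatible_def so_tuple_def)
  have E: "half_power (inverse q) (end_sign a * end_sign b * (abs_sum a - 2 * entry_sum c + abs_sum b))
      = half_power q (- (end_sign a * end_sign b * (abs_sum a - 2 * entry_sum c + abs_sum b)))"
    if "c \<in> mid_rows a b" for c
    using double_exponent[OF assms that] by (rule half_power_inverse)
  show ?thesis
  proof (cases "last a = 0")
    case False
    then have "end_sign (signed (- 1) a) = - end_sign a"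
      using a by (simp add: end_sign_def Defs.sign_def) (simp add: signed_def)
    then show ?thesis
      unfolding transfer_def mid_rows_signed[OF len] abs_sum_signed[OF a]
      using E by (intro sum.cong refl) simp
  next
    case True
    then have "signed (- 1) a = a" using a by (simp add: signed_def) (metis append_butlast_last_id)
    moreover have "end_min a b = 0" by (simp add: end_min_def True)
    then have "transfer a b q = (\<Sum>c\<in>mid_rows a b. half_power q
        (end_sign a * end_sign b * (abs_sum a - 2 * (abs_sum a + abs_sum b - entry_sum c) + abs_sum b)))"
      unfolding transfer_def
      using sum_mid_rows_reflect'[OF assms, of "\<lambda>S. half_power q
        (end_sign a * end_sign b * (abs_sum a - 2 * S + abs_sum b))"] by simp
    moreover have "\<dots> = transfer a b (inverse q)"
      unfolding transfer_def using E by (intro sum.cong refl) (simp add: algebra_simps)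
    ultimately show ?thesis by simp
  qed
qed

lemma so_tuple_signed:
  assumes "so_tuple k a" "a \<noteq> []"
  shows "so_tuple k (signed (- 1) a)"
proof -
  have k: "length a = k" using assms by (simp add: so_tuple_def)
  have "signed (- 1) a ! j - signed (- 1) a ! 0 \<in> \<int>" if "j < k" for j
  \<comment> \<open>For \<open>k = 1\<close> the entry at position 0 is itself negated, and the
    difference is 0.\<close>
  proof (cases "k = 1")
    case False
    have "- a ! j - a ! 0 \<in> \<int>"
      using assms that by (intro Ints_uminus_cong) (auto simp: so_tuple_def)
    with False show ?thesis using assms that k by (auto simp: nth_signed so_tuple_def)
  qed (use that in auto)
  then show ?thesis
    using assms k by (auto simp: so_tuple_def length_signed nth_signed)
qed

text \<open>Only the topmost kernel sees the sign of \<open>last a\<close>. For \<open>k = 0\<close>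
  also \<open>a ! 0\<close> changes, but the range of \<open>b\<close> is \<open>{[]}\<close> in
  either case.\<close>

lemma so_rec_signed:
  assumes "so_tuple (Suc k) a" "length rs = k"
  shows "so_rec (signed (- 1) a) (q # rs) = so_rec a (inverse q # rs)"
proof (cases k)
  case 0
  have "compatible a []" using assms 0 by (auto simp: compatible_def so_tuple_def)
  moreover have "a \<noteq> []" "length a = 1" using assms 0 by (auto simp: so_tuple_def)
  ultimately show ?thesis using assms 0 transfer_signed[of a "[]" q]
    by (simp add: length_signed)
next
  case (Suc k')
  have a: "length a = Suc k" "a \<noteq> []" using assms by (auto simp: so_tuple_def)
  then have "signed (- 1) a ! 0 = a ! 0" using Suc by (simp add: nth_signed)
  moreover have "transfer (signed (- 1) a) b q = transfer a b (inverse q)"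
    if "b \<in> so_tuples_in k (a ! 0)" for b
    by (rule transfer_signed[OF compatible_so_tuples_in[OF assms(1) that]])
  ultimately show ?thesis
    using a by (simp add: length_signed)
qed

text \<open>If the last entry of \<open>b\<close> is negative, reflecting the middle row removes the sign in front of
  the exponent; \<open>fold_end\<close> is what then remains of that entry.\<close>

definition fold_end :: "rat \<Rightarrow> rat \<Rightarrow> rat" where
  "fold_end x y = (if - x \<le> y then y else - y - 2 * x)"

lemma transfer_eq_fold_end:
  assumes "compatible a b" "b \<noteq> []" "0 \<le> last a"
  shows "transfer a b q = (\<Sum>c\<in>mid_rows a b. half_power q
    (abs_sum a - 2 * entry_sum c + (\<Sum>j<length b - 1. b ! j) + fold_end (last a) (last b)))"
proof -
  obtain k where k: "length b = Suc k" using assms(2) by (cases b) auto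
  have last: "last b = b ! k" using assms(2) k by (metis last_conv_nth diff_Suc_1)
  have "0 \<le> b ! j" if "j < k" for j
  proof -
    have "\<bar>b ! Suc j\<bar> \<le> b ! j" using assms(1) that k by (auto simp: compatible_def so_tuple_def)
    then show ?thesis by linarith
  qed
  then have "(\<Sum>j<k. \<bar>b ! j\<bar>) = (\<Sum>j<k. b ! j)" by (intro sum.cong) auto
  then have b: "abs_sum b = (\<Sum>j<k. b ! j) + \<bar>last b\<bar>"
    by (simp add: abs_sum_def k last)
  have ea: "end_sign a = 1" using assms by (auto simp: end_sign_def Defs.sign_def)
  show ?thesis
  proof (cases "0 \<le> last b")
    case True
    then have "end_sign b = 1" by (auto simp: end_sign_def Defs.sign_def)
    then show ?thesis
      unfolding transfer_def using True assms(3) by (simp add: ea b k fold_end_def algebra_simps)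
  next
    case False
    then have eb: "end_sign b = - 1" using assms(2) by (auto simp: end_sign_def Defs.sign_def)
    have "transfer a b q =
        (\<Sum>c\<in>mid_rows a b. half_power q (- (abs_sum a - 2 * entry_sum c + abs_sum b)))"
      by (simp add: transfer_def ea eb)
    also have "\<dots> = (\<Sum>c\<in>mid_rows a b. half_power q
        (- (abs_sum a - 2 * (abs_sum a + abs_sum b - end_min a b - entry_sum c) + abs_sum b)))"
      by (rule sum_mid_rows_reflect'[OF assms(1), of "\<lambda>S. half_power q (- (abs_sum a - 2 * S + abs_sum b))"])
    also have "\<dots> = (\<Sum>c\<in>mid_rows a b. half_power q
        (abs_sum a - 2 * entry_sum c + (\<Sum>j<length b - 1. b ! j) + fold_end (last a) (last b)))"
    proof (intro sum.cong refl arg_cong[of _ _ "half_power q"])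
      fix c
      have "- (abs_sum a - 2 * (abs_sum a + abs_sum b - end_min a b - entry_sum c) + abs_sum b) =
         abs_sum a + abs_sum b - 2 * end_min a b - 2 * entry_sum c" by (simp add: algebra_simps)
      \<comment> \<open>With \<open>x = last a\<close> and \<open>y = last b < 0\<close>, the number
        \<open>\<bar>y\<bar> - 2 * min x \<bar>y\<bar>\<close> is \<open>y\<close> if
        \<open>\<bar>y\<bar> \<le> x\<close> and \<open>- y - 2 * x\<close> otherwise.\<close>
      also have "abs_sum b - 2 * end_min a b = (\<Sum>j<k. b ! j) + fold_end (last a) (last b)"
        using False assms(2,3) by (auto simp: b fold_end_def end_min_def min_def)
      then have "abs_sum a + abs_sum b - 2 * end_min a b - 2 * entry_sum c =
        abs_sum a - 2 * entry_sum c + (\<Sum>j<length b - 1. b ! j) + fold_end (last a) (last b)"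
        by (simp add: k)
      finally show "- (abs_sum a - 2 * (abs_sum a + abs_sum b - end_min a b - entry_sum c) + abs_sum b) =
        abs_sum a - 2 * entry_sum c + (\<Sum>j<length b - 1. b ! j) + fold_end (last a) (last b)" .
    qed
    finally show ?thesis .
  qed
qed

section \<open>Weyl's determinants\<close>

text \<open>Multilinearity as in \<open>sum_det_box\<close>, for a bordered determinant: its last
  row takes no part in the summation.\<close>

lemma sum_det_box_Suc:
  fixes f :: "nat \<Rightarrow> nat \<Rightarrow> 'b \<Rightarrow> 'a::comm_ring_1"
  assumes "\<And>i. i < k \<Longrightarrow> finite (A i)"
  shows "(\<Sum>b\<in>box k A. det (mat (Suc k) (Suc k) (\<lambda>(i, j). if i < k then f i j (b ! i) else g j))) =
    det (mat (Suc k) (Suc k) (\<lambda>(i, j). if i < k then \<Sum>x\<in>A i. f i j x else g j))"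
proof -
  have E: "det (mat (Suc k) (Suc k) (\<lambda>(i, j). if i < k then F i j else g j)) =
      (\<Sum>p | p permutes {0..<Suc k}. signof p * g (p k) * (\<Prod>i<k. F i (p i)))"
    for F :: "nat \<Rightarrow> nat \<Rightarrow> 'a"
  proof -
    have "(\<Prod>i<Suc k. if i < k then F i (p i) else g (p i)) = g (p k) * (\<Prod>i<k. F i (p i))" for p
      by (simp add: mult.commute)
    then show ?thesis
      by (simp only: det_mat_expand atLeast0LessThan split mult.assoc)
  qed
  have "(\<Sum>b\<in>box k A. det (mat (Suc k) (Suc k) (\<lambda>(i, j). if i < k then f i j (b ! i) else g j))) =
    (\<Sum>b\<in>box k A. \<Sum>p | p permutes {0..<Suc k}. signof p * g (p k) * (\<Prod>i<k. f i (p i) (b ! i)))"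
    by (simp only: E)
  also have "\<dots> = (\<Sum>p | p permutes {0..<Suc k}. \<Sum>b\<in>box k A.
      signof p * g (p k) * (\<Prod>i<k. f i (p i) (b ! i)))"
    by (rule sum.swap)
  also have "\<dots> = (\<Sum>p | p permutes {0..<Suc k}. signof p * g (p k) * (\<Prod>i<k. \<Sum>x\<in>A i. f i (p i) x))"
  proof (intro sum.cong refl)
    fix p
    show "(\<Sum>b\<in>box k A. signof p * g (p k) * (\<Prod>i<k. f i (p i) (b ! i))) =
        signof p * g (p k) * (\<Prod>i<k. \<Sum>x\<in>A i. f i (p i) x)"
      using assms sum_prod_box[of k A "\<lambda>i. f i (p i)"] by (simp flip: sum_distrib_left)
  qed
  finally show ?thesis by (simp only: E)
qed

text \<open>The shifted weight \<open>a + \<rho>\<close>, where \<rho> = (k - 1, ..., 1, 0) is half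
  the sum of the positive roots of type D.\<close>

definition alpha :: "rat list \<Rightarrow> nat \<Rightarrow> rat" where
  "alpha a j = a ! j + of_nat (length a - 1 - j)"

definition weyl_det :: "'a::field \<Rightarrow> rat list \<Rightarrow> 'a list \<Rightarrow> 'a" where
  "weyl_det s a rs = det (mat (length rs) (length rs)
     (\<lambda>(j, i). half_power (rs ! i) (alpha a j) + s * half_power (rs ! i) (- alpha a j)))"

text \<open>Antiderivatives for the telescoping sums: \<open>antid_F\<close> for the sum over the lower row,
  \<open>antid_G\<close> and \<open>antid_G0\<close> for the sum over the middle row. Below, \<open>border_K\<close> and
  \<open>border_w\<close> are the boundary terms at the odd end; they form the last row of a bordered
  determinant, and the additive constants of \<open>antid_G\<close> and \<open>antid_G0\<close> are such that this row
  is proportional to their values at \<open>t + 1\<close>.\<close>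

definition antid_F :: "'a::field \<Rightarrow> 'a \<Rightarrow> 'a \<Rightarrow> rat \<Rightarrow> 'a" where
  "antid_F s q r t = half_power q t *
     (half_power r t / (q\<^sup>2 * r\<^sup>2 - 1) - s * r\<^sup>2 * half_power r (- t) / (r\<^sup>2 - q\<^sup>2))"

definition antid_G :: "'a::field \<Rightarrow> 'a \<Rightarrow> 'a \<Rightarrow> rat \<Rightarrow> 'a" where
  "antid_G s q r t = half_power q (1 - t) * (r\<^sup>2 / ((q\<^sup>2 * r\<^sup>2 - 1) * (r\<^sup>2 - q\<^sup>2))) *
     (half_power r (t - 1) + s * half_power r (1 - t))"

definition antid_G0 :: "'a::field \<Rightarrow> 'a \<Rightarrow> rat \<Rightarrow> 'a" where
  "antid_G0 s q t = half_power q (1 - t) * (- s / (q ^ 4 - 1)) *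
     (half_power q (t - 1) + s * half_power q (1 - t))"

lemma half_power_shift:
  assumes "r \<noteq> 0" "2 * t \<in> \<int>"
  shows "half_power r (t + 1) = half_power r t * r\<^sup>2"
    "half_power r (t - 1) = half_power r t / r\<^sup>2"
    "half_power r (1 - t) = r\<^sup>2 / half_power r t"
    "half_power r (- t - 1) = 1 / (half_power r t * r\<^sup>2)"
    "half_power r (- t) = 1 / half_power r t"
    "half_power r (- (2 * t)) = 1 / (half_power r t)\<^sup>2"
proof -
  note add = half_power_add[OF assms(1)]
  have m: "2 * (- t) \<in> \<int>" "2 * (- 1) \<in> (\<int> :: rat set)" using assms(2) by auto
  have m1: "half_power r (- 1) = 1 / r\<^sup>2"
    using half_power_minus[of 1 r] by (simp add: half_power_1 inverse_eq_divide)
  show A: "half_power r (t + 1) = half_power r t * r\<^sup>2"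
    using add[of t 1] assms(2) by (simp add: half_power_1)
  show "half_power r (t - 1) = half_power r t / r\<^sup>2"
    using add[OF assms(2) m(2)] by (simp add: m1)
  show B: "half_power r (- t) = 1 / half_power r t"
    using half_power_minus[OF assms(2)] by (simp add: inverse_eq_divide)
  show "half_power r (1 - t) = r\<^sup>2 / half_power r t"
    using add[of 1 "- t"] m by (simp add: half_power_1 B)
  show "half_power r (- t - 1) = 1 / (half_power r t * r\<^sup>2)"
    using add[OF m] by (simp add: m1 B)
  have "half_power r (- t + - t) = half_power r (- t) * half_power r (- t)"
    using add[OF m(1) m(1)] .
  then show "half_power r (- (2 * t)) = 1 / (half_power r t)\<^sup>2"
    by (simp add: B power2_eq_square)
qed

text \<open>Two geometric series, of ratios \<open>q\<^sup>2 * r\<^sup>2\<close> and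
  \<open>q\<^sup>2 / r\<^sup>2\<close>; the two inequations say that neither ratio is 1.\<close>

lemma antid_F_diff:
  assumes "q \<noteq> 0" "r \<noteq> 0" "q\<^sup>2 * r\<^sup>2 \<noteq> 1" "r\<^sup>2 \<noteq> q\<^sup>2" "2 * t \<in> \<int>"
  shows "antid_F s q r (t + 1) - antid_F s q r t =
    half_power q t * (half_power r t + s * half_power r (- t))"
proof -
  define P R A B where "P = half_power q t" and "R = half_power r t"
    and "A = q\<^sup>2 * r\<^sup>2 - 1" and "B = r\<^sup>2 - q\<^sup>2"
  have nz: "P \<noteq> 0" "R \<noteq> 0" "A \<noteq> 0" "B \<noteq> 0"
    using assms by (auto simp: P_def R_def A_def B_def half_power_nonzero)
  have "antid_F s q r (t + 1) = P * q\<^sup>2 * (R * r\<^sup>2 * (1 / A) - s * (1 / R) * (1 / B))"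
    using assms nz unfolding antid_F_def
    by (simp add: half_power_shift P_def R_def A_def B_def)
  moreover have "antid_F s q r t = P * (R * (1 / A) - s * r\<^sup>2 * (1 / R) * (1 / B))"
    using assms unfolding antid_F_def by (simp add: half_power_shift P_def R_def A_def B_def)
  ultimately have "antid_F s q r (t + 1) - antid_F s q r t =
      P * R * ((q\<^sup>2 * r\<^sup>2 - 1) * (1 / A)) + s * P * (1 / R) * ((r\<^sup>2 - q\<^sup>2) * (1 / B))"
    by (simp add: divide_inverse algebra_simps)
  also have "\<dots> = P * (R + s * (1 / R))"
    using nz by (simp add: A_def B_def distrib_left)
  finally show ?thesis
    using assms by (simp add: half_power_shift P_def R_def)
qed

text \<open>Again two geometric series. The gain is the shape of the result: after both summations,
  the value at \<open>t = alpha + 1\<close> is Weyl's entry of exponent \<open>alpha\<close> in the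
  variable \<open>r\<close>, times \<open>half_power q (- alpha)\<close> and a factor free of
  \<open>alpha\<close>. These two factors can be pulled out of rows and columns.\<close>

lemma antid_G_diff:
  assumes "q \<noteq> 0" "r \<noteq> 0" "q\<^sup>2 * r\<^sup>2 \<noteq> 1" "r\<^sup>2 \<noteq> q\<^sup>2" "2 * t \<in> \<int>"
  shows "antid_G s q r (t + 1) - antid_G s q r t = half_power q (- (2 * t)) * antid_F s q r t"
proof -
  define P R A B where "P = half_power q t" and "R = half_power r t"
    and "A = q\<^sup>2 * r\<^sup>2 - 1" and "B = r\<^sup>2 - q\<^sup>2"
  have nz: "P \<noteq> 0" "R \<noteq> 0" "A \<noteq> 0" "B \<noteq> 0"
    using assms by (auto simp: P_def R_def A_def B_def half_power_nonzero)
  have "antid_G s q r (t + 1) = (1 / P) * (r\<^sup>2 / (A * B)) * (R + s * (1 / R))"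
    using assms unfolding antid_G_def by (simp add: half_power_shift P_def R_def A_def B_def)
  also have "\<dots> = (r\<^sup>2 * R + s * r\<^sup>2 / R) / (P * A * B)"
    using nz by (simp add: field_simps)
  finally have G1: "antid_G s q r (t + 1) = (r\<^sup>2 * R + s * r\<^sup>2 / R) / (P * A * B)" .
  have "antid_G s q r t = (q\<^sup>2 / P) * (r\<^sup>2 / (A * B)) * (R / r\<^sup>2 + s * (r\<^sup>2 / R))"
    using assms unfolding antid_G_def by (simp add: half_power_shift P_def R_def A_def B_def)
  also have "\<dots> = (q\<^sup>2 * (r\<^sup>2 * (R / r\<^sup>2)) + s * q\<^sup>2 * r\<^sup>2 * r\<^sup>2 / R) / (P * A * B)"
    by (simp add: distrib_left mult_ac)
  also have "r\<^sup>2 * (R / r\<^sup>2) = R" using assms by simp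
  finally have G2: "antid_G s q r t = (q\<^sup>2 * R + s * q\<^sup>2 * r\<^sup>2 * r\<^sup>2 / R) / (P * A * B)" .
  have "antid_G s q r (t + 1) - antid_G s q r t =
      (R * (r\<^sup>2 - q\<^sup>2) - s * r\<^sup>2 / R * (q\<^sup>2 * r\<^sup>2 - 1)) / (P * A * B)"
    unfolding G1 G2 diff_divide_distrib[symmetric]
    by (simp add: algebra_simps)
  also have "\<dots> = (R * B - s * r\<^sup>2 / R * A) / (P * A * B)"
    by (simp add: A_def B_def)
  also have "\<dots> = 1 / P\<^sup>2 * (P * (R / A - s * r\<^sup>2 * (1 / R) / B))"
    using nz by (simp add: field_simps power2_eq_square)
  finally show ?thesis
    using assms unfolding antid_F_def by (simp add: half_power_shift P_def R_def A_def B_def)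
qed

text \<open>A geometric series of ratio \<open>1 / q ^ 4\<close>. Since
  \<open>s\<^sup>2 = 1\<close>, the constant contained in \<open>antid_G0\<close> is
  \<open>- s / (q ^ 4 - 1)\<close>; it completes the series to a Weyl entry in the variable
  \<open>q\<close> itself.\<close>

lemma antid_G0_diff:
  assumes "q \<noteq> 0" "q ^ 4 \<noteq> 1" "2 * t \<in> \<int>" "s\<^sup>2 = 1"
  shows "antid_G0 s q (t + 1) - antid_G0 s q t = half_power q (- (2 * t))"
proof -
  define P A where "P = half_power q t" and "A = q ^ 4 - 1"
  have nz: "P \<noteq> 0" "A \<noteq> 0" using assms by (auto simp: P_def A_def half_power_nonzero)
  have s: "s * (s * x) = x" for x using assms(4) by (simp add: power2_eq_square flip: mult.assoc)
  have "antid_G0 s q (t + 1) = (1 / P) * (- s / A) * (P + s * (1 / P))"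
    using assms unfolding antid_G0_def by (simp add: half_power_shift P_def A_def)
  also have "\<dots> = (- s - s * (s * (1 / P\<^sup>2))) / A"
    using nz by (simp add: field_simps power2_eq_square)
  finally have G1: "antid_G0 s q (t + 1) = (- s - 1 / P\<^sup>2) / A" unfolding s .
  have "antid_G0 s q t = (q\<^sup>2 / P) * (- s / A) * (P / q\<^sup>2 + s * (q\<^sup>2 / P))"
    using assms unfolding antid_G0_def by (simp add: half_power_shift P_def A_def)
  also have "\<dots> = (- s - s * (s * (q\<^sup>2 * q\<^sup>2 / P\<^sup>2))) / A"
    using nz assms(1) by (simp add: field_simps power2_eq_square)
  finally have G2: "antid_G0 s q t = (- s - q\<^sup>2 * q\<^sup>2 / P\<^sup>2) / A" unfolding s .
  have "q\<^sup>2 * q\<^sup>2 = A + 1" by (simp add: A_def power2_eq_square power4_eq_xxxx)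
  then have "antid_G0 s q (t + 1) - antid_G0 s q t = 1 / P\<^sup>2"
    using nz unfolding G1 G2 diff_divide_distrib[symmetric] by (simp add: field_simps)
  then show ?thesis
    using assms by (simp add: half_power_shift P_def)
qed

definition border_K :: "'a::field \<Rightarrow> 'a \<Rightarrow> 'a \<Rightarrow> rat \<Rightarrow> 'a" where
  "border_K s q r t = antid_F s q r (- t) + s * half_power q (- (2 * t)) * antid_F s q r (t + 1)"

definition border_w :: "'a::field \<Rightarrow> 'a \<Rightarrow> rat \<Rightarrow> 'a" where
  "border_w s q t = 1 + s * half_power q (- (2 * t))"

text \<open>The factor \<open>- s * (q ^ 4 - 1)\<close> is free of \<open>r\<close> and the same as
  in \<open>border_w_eq\<close>, so it comes out of the whole border row.\<close>

lemma border_K_eq: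
  assumes "q \<noteq> 0" "r \<noteq> 0" "q\<^sup>2 * r\<^sup>2 \<noteq> 1" "r\<^sup>2 \<noteq> q\<^sup>2" "2 * t \<in> \<int>" "s\<^sup>2 = 1"
  shows "border_K s q r t = - s * (q ^ 4 - 1) * antid_G s q r (t + 1)"
proof -
  define P R A B where "P = half_power q t" and "R = half_power r t"
    and "A = q\<^sup>2 * r\<^sup>2 - 1" and "B = r\<^sup>2 - q\<^sup>2"
  have nz: "P \<noteq> 0" "R \<noteq> 0" "A \<noteq> 0" "B \<noteq> 0"
    using assms by (auto simp: P_def R_def A_def B_def half_power_nonzero)
  have s: "s * (s * x) = x" for x using assms(6) by (simp add: power2_eq_square flip: mult.assoc)
  have F1: "antid_F s q r (- t) = 1 / P * (1 / R / A - s * r\<^sup>2 * R / B)"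
    using assms unfolding antid_F_def by (simp add: half_power_shift P_def R_def A_def B_def)
  have F2: "antid_F s q r (t + 1) = P * q\<^sup>2 * (R * r\<^sup>2 / A - s * r\<^sup>2 * (1 / (R * r\<^sup>2)) / B)"
    using assms unfolding antid_F_def by (simp add: half_power_shift P_def R_def A_def B_def)
  have G: "antid_G s q r (t + 1) = 1 / P * (r\<^sup>2 / (A * B)) * (R + s * (1 / R))"
    using assms unfolding antid_G_def by (simp add: half_power_shift P_def R_def A_def B_def)
  have "border_K s q r t = 1 / P * (1 / R / A - s * r\<^sup>2 * R / B) +
      s * (1 / P\<^sup>2) * (P * q\<^sup>2 * (R * r\<^sup>2 / A - s * r\<^sup>2 * (1 / (R * r\<^sup>2)) / B))"
    using assms unfolding border_K_def F1 F2 by (simp add: half_power_shift P_def)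
  also have "\<dots> = (1 / P) * ((1 / R) * (1 / A - s * s * q\<^sup>2 / B) + s * R * r\<^sup>2 * (q\<^sup>2 / A - 1 / B))"
    using nz assms(2) by (simp add: field_simps power2_eq_square)
  also have "\<dots> = (1 / P) * ((1 / R) * ((B - q\<^sup>2 * A) / (A * B)) + s * R * r\<^sup>2 * ((q\<^sup>2 * B - A) / (A * B)))"
    using nz s[of 1] by (simp add: field_simps)
  also have "B - q\<^sup>2 * A = - (q ^ 4 - 1) * r\<^sup>2"
    by (simp add: A_def B_def algebra_simps power2_eq_square power4_eq_xxxx)
  also have "q\<^sup>2 * B - A = - (q ^ 4 - 1)"
    by (simp add: A_def B_def algebra_simps power2_eq_square power4_eq_xxxx)
  also have "(1 / P) * ((1 / R) * (- (q ^ 4 - 1) * r\<^sup>2 / (A * B)) +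
      s * R * r\<^sup>2 * (- (q ^ 4 - 1) / (A * B))) =
      - (q ^ 4 - 1) * (1 / P * (r\<^sup>2 / (A * B)) * (s * R + 1 / R))"
    using nz by (simp add: field_simps)
  also have "s * R + 1 / R = s * (R + s * (1 / R))"
    using s[of "1 / R"] by (simp add: distrib_left)
  finally show ?thesis unfolding G by (simp only: mult_minus_left mult_minus_right mult_ac)
qed

lemma border_w_eq:
  assumes "q \<noteq> 0" "q ^ 4 \<noteq> 1" "2 * t \<in> \<int>" "s\<^sup>2 = 1"
  shows "border_w s q t = - s * (q ^ 4 - 1) * antid_G0 s q (t + 1)"
proof -
  define P A where "P = half_power q t" and "A = q ^ 4 - 1"
  have nz: "P \<noteq> 0" "A \<noteq> 0" using assms by (auto simp: P_def A_def half_power_nonzero)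
  have s: "s * (s * x) = x" for x using assms(4) by (simp add: power2_eq_square flip: mult.assoc)
  have "antid_G0 s q (t + 1) = 1 / P * (- s / A) * (P + s * (1 / P))"
    using assms unfolding antid_G0_def by (simp add: half_power_shift P_def A_def)
  moreover have "- s * A * (1 / P * (- s / A) * (P + s * (1 / P))) = (s * s) * (1 + s * (1 / P\<^sup>2))"
    using nz by (simp add: field_simps power2_eq_square)
  ultimately have "- s * A * antid_G0 s q (t + 1) = (s * s) * (1 + s * (1 / P\<^sup>2))"
    by simp
  then show ?thesis
    using assms s[of 1] unfolding border_w_def by (simp add: half_power_shift P_def A_def)
qed

text \<open>The range is cut at \<open>- t\<close>, where the folding sets in. The part below
  \<open>- t\<close> is mirrored to the interval from \<open>t + 1\<close> to \<open>c\<close>, at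
  the cost of a factor \<open>s * half_power q (- (2 * t))\<close>. Both parts then end at
  \<open>c\<close>, which gives the coefficient \<open>border_w\<close>; the two lower ends make up
  \<open>border_K\<close>.\<close>

lemma sum_fold_end:
  fixes q r s :: "'a::field"
  assumes nz: "q \<noteq> 0" "r \<noteq> 0" "q\<^sup>2 * r\<^sup>2 \<noteq> 1" "r\<^sup>2 \<noteq> q\<^sup>2" and s: "s\<^sup>2 = 1"
    and t: "2 * t \<in> \<int>" "c - t \<in> \<int>" "0 \<le> t" "t \<le> c"
  shows "(\<Sum>x\<in>zrange t (- c) c. half_power q (fold_end t x) *
      (half_power r x + s * half_power r (- x))) =
    border_w s q t * antid_F s q r (c + 1) - border_K s q r t"
proof -
  define f where "f x = half_power r x + s * half_power r (- x)" for x
  define F where "F = antid_F s q r"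
  have tc: "- t - t \<in> \<int>" "t + 1 - t \<in> \<int>" "- c - t \<in> \<int>"
    using Ints_uminus_cong[of t t] Ints_uminus_cong[of t c] t by auto
  have diff: "F (x + 1) - F x = half_power q x * f x" if "x - t \<in> \<int>" for x
    unfolding F_def f_def by (rule antid_F_diff[OF nz Ints_double_cong[OF t(1) that]])
  have tele: "(\<Sum>x\<in>zrange t l c. half_power q x * f x) = F (c + 1) - F l"
    if "l - t \<in> \<int>" "l \<le> c + 1" for l
  proof -
    have "(\<Sum>x\<in>zrange t l c. half_power q x * f x) = (\<Sum>x\<in>zrange t l c. F (x + 1) - F x)"
      by (intro sum.cong refl) (simp add: diff zrange_def)
    then show ?thesis using sum_zrange_telescope[OF that(1) t(2) that(2)] by simp
  qed
  \<comment> \<open>As \<open>2 * t\<close> is an integer, \<open>- t\<close> lies in the class of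
    \<open>t\<close>; so a value below \<open>- t\<close> is at most
    \<open>- (t + 1)\<close>.\<close>
  have disj: "zrange t (- c) c = zrange t (- c) (- (t + 1)) \<union> zrange t (- t) c"
  proof -
    have "x \<le> - (t + 1)" if x: "x - t \<in> \<int>" "x < - t" for x
    proof -
      obtain i where "x - - t = of_int i"
        using Ints_minus_cong[OF x(1) tc(1)] by (auto elim: Ints_cases)
      moreover then have "i < 0" using x(2) by (metis diff_less_0_iff_less of_int_less_0_iff)
      then have "i \<le> - 1" by simp
      then have "of_int i \<le> (- 1 :: rat)" by (metis of_int_1 of_int_le_iff of_int_minus)
      ultimately show ?thesis by simp
    qed
    then show ?thesis using t(3,4) by (force simp: zrange_def)
  qed
  have "(\<Sum>x\<in>zrange t (- c) c. half_power q (fold_end t x) * f x) =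
      (\<Sum>x\<in>zrange t (- c) (- (t + 1)). half_power q (fold_end t x) * f x) +
      (\<Sum>x\<in>zrange t (- t) c. half_power q (fold_end t x) * f x)"
    unfolding disj by (rule sum.union_disjoint[OF finite_zrange finite_zrange]) (auto simp: zrange_def)
  also have "(\<Sum>x\<in>zrange t (- t) c. half_power q (fold_end t x) * f x) =
      (\<Sum>x\<in>zrange t (- t) c. half_power q x * f x)"
    by (intro sum.cong refl) (simp add: zrange_def fold_end_def)
  also have "\<dots> = F (c + 1) - F (- t)"
    using t tc by (intro tele) auto
  \<comment> \<open>Under the substitution of \<open>- x\<close> for \<open>x\<close>, the folded
    exponent becomes \<open>x - 2 * t\<close> and Weyl's entry is multiplied by
    \<open>s\<close>.\<close>
  also have "(\<Sum>x\<in>zrange t (- c) (- (t + 1)). half_power q (fold_end t x) * f x) =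
      (\<Sum>x\<in>zrange t (t + 1) c. half_power q (fold_end t (- x)) * f (- x))"
    using sum_zrange_uminus[OF t(1), of "\<lambda>x. half_power q (fold_end t x) * f x" "t + 1" c]
    by simp
  also have "\<dots> = (\<Sum>x\<in>zrange t (t + 1) c. s * half_power q (- (2 * t)) * (half_power q x * f x))"
  proof (intro sum.cong refl)
    fix x assume "x \<in> zrange t (t + 1) c"
    then have x: "x - t \<in> \<int>" "t + 1 \<le> x" by (auto simp: zrange_def)
    have fx: "f (- x) = s * f x"
      using s by (simp add: f_def distrib_left power2_eq_square flip: mult.assoc)
    have "2 * x \<in> \<int>" by (rule Ints_double_cong[OF t(1) x(1)])
    moreover have "2 * (- (2 * t)) \<in> \<int>" using t(1)
      by (metis Ints_add Ints_minus mult_2 mult_minus_right)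
    ultimately have "half_power q (x + - (2 * t)) = half_power q x * half_power q (- (2 * t))"
      by (rule half_power_add[OF nz(1)])
    moreover have "fold_end t (- x) = x + - (2 * t)"
      using x t(3) by (simp add: fold_end_def)
    ultimately show "half_power q (fold_end t (- x)) * f (- x) =
        s * half_power q (- (2 * t)) * (half_power q x * f x)"
      by (simp only: fx mult_ac)
  qed
  also have "\<dots> = s * half_power q (- (2 * t)) * (F (c + 1) - F (t + 1))"
    using t tc by (subst sum_distrib_left[symmetric], subst tele) auto
  finally show ?thesis
    unfolding border_w_def border_K_def f_def F_def by (simp add: algebra_simps)
qed

text \<open>With x = \<open>r\<^sup>2\<close>, the denominator of type D is the product of the
  differences \<open>(x_i + 1 / x_i) - (x_j + 1 / x_j)\<close> over i < j; this is one
  factor.\<close>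

definition kappa :: "'a::field \<Rightarrow> 'a \<Rightarrow> 'a" where
  "kappa q r = (q\<^sup>2 + 1 / q\<^sup>2) - (r\<^sup>2 + 1 / r\<^sup>2)"

lemma kappa_nonzeroD:
  assumes "q \<noteq> 0" "r \<noteq> 0" "kappa q r \<noteq> 0"
  shows "q\<^sup>2 * r\<^sup>2 \<noteq> 1" "r\<^sup>2 \<noteq> q\<^sup>2"
    "r\<^sup>2 / ((q\<^sup>2 * r\<^sup>2 - 1) * (r\<^sup>2 - q\<^sup>2)) = - 1 / (q\<^sup>2 * kappa q r)"
proof -
  have k: "(q\<^sup>2 * r\<^sup>2 - 1) * (r\<^sup>2 - q\<^sup>2) = - (q\<^sup>2 * kappa q r * r\<^sup>2)"
    using assms(1,2) by (simp add: kappa_def field_simps power2_eq_square)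
  then show "q\<^sup>2 * r\<^sup>2 \<noteq> 1" "r\<^sup>2 \<noteq> q\<^sup>2" using assms by auto
  show "r\<^sup>2 / ((q\<^sup>2 * r\<^sup>2 - 1) * (r\<^sup>2 - q\<^sup>2)) = - 1 / (q\<^sup>2 * kappa q r)"
    unfolding k using assms by simp
qed

section \<open>Summation ranges as products of intervals\<close>

lemma so_tuple_nth_mono:
  assumes "so_tuple k a" "i \<le> j" "j < k"
  shows "a ! j \<le> a ! i" "\<bar>a ! j\<bar> \<le> \<bar>a ! i\<bar>"
proof -
  have *: "\<bar>a ! Suc j\<bar> \<le> a ! j" if "Suc j < k" for j
    using assms(1) that by (auto simp: so_tuple_def)
  have "a ! j \<le> a ! i \<and> \<bar>a ! j\<bar> \<le> \<bar>a ! i\<bar>"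
    using assms(2,3)
  proof (induction j rule: dec_induct)
    case (step j)
    then show ?case using *[of j] by auto
  qed simp
  then show "a ! j \<le> a ! i" "\<bar>a ! j\<bar> \<le> \<bar>a ! i\<bar>" by auto
qed

lemma so_tuple_nth_nonneg:
  assumes "so_tuple (Suc k) a" "j < k"
  shows "0 \<le> a ! j"
proof -
  have "\<bar>a ! Suc j\<bar> \<le> a ! j" using assms by (auto simp: so_tuple_def)
  then show ?thesis by linarith
qed

definition above_box :: "nat \<Rightarrow> rat list \<Rightarrow> nat \<Rightarrow> rat set" where
  "above_box k a j = zrange (a ! 0) (a ! Suc j) (a ! j)"

definition below_box :: "nat \<Rightarrow> rat \<Rightarrow> rat list \<Rightarrow> nat \<Rightarrow> rat set" where
  "below_box k h c j = zrange h (if Suc j < k then c ! Suc j else - (c ! j)) (c ! j)"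

lemma mid_rows_iff_boxes:
  assumes a: "so_tuple (Suc k) a" and "0 \<le> last a" "0 < k"
  shows "b \<in> so_tuples_in k (a ! 0) \<and> c \<in> mid_rows a b \<longleftrightarrow>
    c \<in> box k (above_box k a) \<and> b \<in> box k (below_box k (a ! 0) c)"
proof -
  have len: "length a = Suc k" using a by (simp add: so_tuple_def)
  then have "last a = a ! k" by (metis last_conv_nth diff_Suc_1 length_0_conv nat.distinct(1))
  then have pos: "0 \<le> a ! j" if "j \<le> k" for j
    using so_tuple_nth_nonneg[OF a, of j] assms(2) that by (cases "j = k") auto
  show ?thesis
  proof (intro iffI conjI)
    assume "b \<in> so_tuples_in k (a ! 0) \<and> c \<in> mid_rows a b"
    then have b: "so_tuple k b" "\<And>j. j < k \<Longrightarrow> b ! j - a ! 0 \<in> \<int>"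
      and lenb: "length b = k"
      and c: "length c = k" "\<And>j. j < k \<Longrightarrow> c ! j - a ! 0 \<in> \<int> \<and> \<bar>a ! Suc j\<bar> \<le> c ! j \<and>
        c ! j \<le> \<bar>a ! j\<bar> \<and> \<bar>b ! j\<bar> \<le> c ! j"
      "\<And>j. Suc j < k \<Longrightarrow> c ! Suc j \<le> \<bar>b ! j\<bar>"
      by (auto simp: so_tuples_in_def so_tuple_def mid_rows_def)
    show "c \<in> box k (above_box k a)"
      unfolding box_def above_box_def zrange_def
    proof safe
      fix j assume "j < k"
      then show "c ! j - a ! 0 \<in> \<int>" "a ! Suc j \<le> c ! j" "c ! j \<le> a ! j"
        using c(2)[of j] pos[of j] by auto
    qed (rule c)
    show "b \<in> box k (below_box k (a ! 0) c)"
      unfolding box_def below_box_def zrange_def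
    proof safe
      fix j assume j: "j < k"
      then show "b ! j - a ! 0 \<in> \<int>" "b ! j \<le> c ! j"
        using c(2)[of j] b(2)[of j] by auto
      show "(if Suc j < k then c ! Suc j else - c ! j) \<le> b ! j"
      proof (cases "Suc j < k")
        case True
        then have "\<bar>b ! Suc j\<bar> \<le> b ! j" using b(1) by (auto simp: so_tuple_def)
        then show ?thesis using c(3)[OF True] True by auto
      next
        case False
        then show ?thesis using c(2)[OF j] by auto
      qed
    qed (rule lenb)
  next
    assume *: "c \<in> box k (above_box k a) \<and> b \<in> box k (below_box k (a ! 0) c)"
    then have c: "length c = k" "\<And>j. j < k \<Longrightarrow> c ! j - a ! 0 \<in> \<int> \<and> a ! Suc j \<le> c ! j \<and> c ! j \<le> a ! j"
      by (auto simp: box_def above_box_def zrange_def)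
    have b': "length b = k" "\<And>j. j < k \<Longrightarrow> b ! j - a ! 0 \<in> \<int> \<and> b ! j \<le> c ! j \<and>
        (if Suc j < k then c ! Suc j else - (c ! j)) \<le> b ! j"
      using * by (auto simp: box_def below_box_def zrange_def)
    have b: "length b = k" "\<And>j. j < k \<Longrightarrow> b ! j - a ! 0 \<in> \<int> \<and> b ! j \<le> c ! j"
      "\<And>j. Suc j < k \<Longrightarrow> c ! Suc j \<le> b ! j" "\<And>j. j < k \<Longrightarrow> \<not> Suc j < k \<Longrightarrow> - (c ! j) \<le> b ! j"
    proof -
      show "c ! Suc j \<le> b ! j" if "Suc j < k" for j using b'(2)[of j] that by auto
      show "- (c ! j) \<le> b ! j" if "j < k" "\<not> Suc j < k" for j using b'(2)[of j] that by auto
    qed (use b' in auto)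
    have cpos: "0 \<le> c ! j" if "j < k" for j
      using c(2)[OF that] pos[of "Suc j"] that by auto
    have bc: "\<bar>b ! j\<bar> \<le> c ! j" if "j < k" for j
      using b(2,3,4)[of j] cpos[of j] cpos[of "Suc j"] that by (cases "Suc j < k") auto
    have h: "2 * a ! 0 \<in> \<int>" using a by (auto simp: so_tuple_def)
    show "b \<in> so_tuples_in k (a ! 0)"
      unfolding so_tuples_in_def so_tuple_def mem_Collect_eq
    proof (intro conjI allI impI)
      fix j assume j: "j < k"
      show "2 * b ! j \<in> \<int>" using b(2)[OF j] by (intro Ints_double_cong[OF h]) auto
      show "b ! j - b ! 0 \<in> \<int>"
        using b(2)[OF j] b(2)[OF assms(3)] Ints_minus_cong[of "b ! j" "a ! 0" "b ! 0"] by simp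
      show "b ! j - a ! 0 \<in> \<int>" using b(2)[OF j] by auto
      have "a ! j \<le> a ! 0" using so_tuple_nth_mono[OF a, of 0 j] j by auto
      then show "\<bar>b ! j\<bar> \<le> a ! 0" using bc[OF j] c(2)[OF j] by linarith
    next
      fix j assume "Suc j < k"
      then show "\<bar>b ! Suc j\<bar> \<le> b ! j" using bc[of "Suc j"] b(3)[of j] by auto
    qed (rule b)
    show "c \<in> mid_rows a b"
      unfolding mid_rows_def mem_Collect_eq
    proof (intro conjI allI impI)
      show "length c = length b" using b c by simp
      fix j assume "j < length b"
      then have j: "j < k" using b by simp
      then show "c ! j - a ! 0 \<in> \<int>" "\<bar>a ! Suc j\<bar> \<le> c ! j" "c ! j \<le> \<bar>a ! j\<bar>" "\<bar>b ! j\<bar> \<le> c ! j"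
        using c(2)[OF j] bc[OF j] pos[of "Suc j"] by auto
      assume "Suc j < length b"
      then show "c ! Suc j \<le> \<bar>b ! j\<bar>" using b(1) b(3)[of j] by auto
    qed
  qed
qed

lemma sum_below_row:
  fixes q r :: "'a::field"
  assumes nz: "q \<noteq> 0" "r \<noteq> 0" "q\<^sup>2 * r\<^sup>2 \<noteq> 1" "r\<^sup>2 \<noteq> q\<^sup>2"
    and h: "2 * h \<in> \<int>" "l - h \<in> \<int>" "u - h \<in> \<int>" "l \<le> u"
  shows "(\<Sum>x\<in>zrange h l u. half_power q x *
      (half_power r (x + of_nat d) + s * half_power r (- (x + of_nat d)))) =
    half_power q (- of_nat d) *
      (antid_F s q r (u + of_nat (Suc d)) - antid_F s q r (l + of_nat d))"
proof -
  have "half_power q x * (half_power r (x + of_nat d) + s * half_power r (- (x + of_nat d))) =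
      half_power q (- of_nat d) * antid_F s q r (x + 1 + of_nat d) -
      half_power q (- of_nat d) * antid_F s q r (x + of_nat d)" if "x \<in> zrange h l u" for x
  proof -
    have x: "2 * x \<in> \<int>" using that by (intro Ints_double_cong[OF h(1)]) (simp add: zrange_def)
    have d: "2 * of_nat d \<in> (\<int>::rat set)" by (metis Ints_of_nat of_nat_mult of_nat_numeral)
    then have xd: "2 * (x + of_nat d) \<in> \<int>" using x by (simp only: distrib_left) (rule Ints_add)
    have "half_power q (x + of_nat d + - of_nat d) = half_power q (x + of_nat d) * half_power q (- of_nat d)"
      using xd d by (intro half_power_add[OF nz(1)]) auto
    then show ?thesis
      using antid_F_diff[OF nz xd, of s] by (simp add: algebra_simps)
  qed
  then have "(\<Sum>x\<in>zrange h l u. half_power q x *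
      (half_power r (x + of_nat d) + s * half_power r (- (x + of_nat d)))) =
      (\<Sum>x\<in>zrange h l u. half_power q (- of_nat d) * antid_F s q r (x + 1 + of_nat d) -
      half_power q (- of_nat d) * antid_F s q r (x + of_nat d))"
    by (intro sum.cong refl)
  also have "\<dots> = half_power q (- of_nat d) * antid_F s q r (u + 1 + of_nat d) -
      half_power q (- of_nat d) * antid_F s q r (l + of_nat d)"
    using h by (intro sum_zrange_telescope[of l h u "\<lambda>x. half_power q (- of_nat d) * antid_F s q r (x + of_nat d)"]) auto
  finally show ?thesis by (simp add: algebra_simps)
qed

text \<open>The summand \<open>v\<close> and its antiderivative \<open>G\<close> are left abstract
  since the border column needs \<open>antid_G0\<close> and all other columns
  \<open>antid_G\<close>.\<close>

lemma sum_above_row: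
  fixes q :: "'a::field"
  assumes q: "q \<noteq> 0" and G: "\<And>t. 2 * t \<in> \<int> \<Longrightarrow> G (t + 1) - G t = half_power q (- (2 * t)) * v t"
    and h: "2 * h \<in> \<int>" "l - h \<in> \<int>" "u - h \<in> \<int>" "l \<le> u"
  shows "(\<Sum>x\<in>zrange h l u. half_power q (- (2 * x)) * v (x + of_nat d)) =
    half_power q (2 * of_nat d) * (G (u + of_nat d + 1) - G (l + of_nat d))"
proof -
  have "half_power q (- (2 * x)) * v (x + of_nat d) =
      half_power q (2 * of_nat d) * G (x + 1 + of_nat d) -
      half_power q (2 * of_nat d) * G (x + of_nat d)" if "x \<in> zrange h l u" for x
  proof -
    have x: "2 * x \<in> \<int>" using that by (intro Ints_double_cong[OF h(1)]) (simp add: zrange_def)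
    have d: "2 * of_nat d \<in> (\<int>::rat set)" by (metis Ints_of_nat of_nat_mult of_nat_numeral)
    then have xd: "2 * (x + of_nat d) \<in> \<int>" using x by (simp only: distrib_left) (rule Ints_add)
    have "2 * (- (2 * (x + of_nat d))) \<in> \<int>" using xd by (metis Ints_add Ints_minus mult_2 mult_minus_right)
    moreover have "2 * (2 * of_nat d) \<in> (\<int> :: rat set)" using d by (metis Ints_add mult_2)
    ultimately have "half_power q (- (2 * (x + of_nat d)) + 2 * of_nat d) =
        half_power q (- (2 * (x + of_nat d))) * half_power q (2 * of_nat d)"
      by (rule half_power_add[OF q])
    moreover have "- (2 * (x + of_nat d)) + 2 * of_nat d = - (2 * x)" by simp
    ultimately show ?thesis
      using G[OF xd] by (simp add: algebra_simps)
  qed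
  then have "(\<Sum>x\<in>zrange h l u. half_power q (- (2 * x)) * v (x + of_nat d)) =
      (\<Sum>x\<in>zrange h l u. half_power q (2 * of_nat d) * G (x + 1 + of_nat d) -
      half_power q (2 * of_nat d) * G (x + of_nat d))"
    by (intro sum.cong refl)
  also have "\<dots> = half_power q (2 * of_nat d) * G (u + 1 + of_nat d) -
      half_power q (2 * of_nat d) * G (l + of_nat d)"
    using h by (intro sum_zrange_telescope[of l h u "\<lambda>x. half_power q (2 * of_nat d) * G (x + of_nat d)"]) auto
  finally show ?thesis by (simp add: algebra_simps)
qed

text \<open>For a fixed middle row, the folded exponent is a sum over the entries of
  \<open>b\<close> and Weyl's determinant has one row per entry, so the sum is taken row by row.
  Inner rows telescope by \<open>sum_below_row\<close>, the row of the odd end is evaluated by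
  \<open>sum_fold_end\<close>. \<open>E\<close> is the part of the exponent that does not depend on
  \<open>b\<close>.\<close>

lemma weyl_below:
  fixes q s :: "'a::field"
  assumes a: "so_tuple (Suc k) a" "0 \<le> last a" and k: "0 < k" and xs: "length xs = k"
    and c: "c \<in> box k (above_box k a)" and q: "q \<noteq> 0" and s: "s\<^sup>2 = 1"
    and r: "\<And>r. r \<in> set xs \<Longrightarrow> r \<noteq> 0 \<and> kappa q r \<noteq> 0" and E: "2 * E \<in> \<int>"
  defines "F \<equiv> \<lambda>j i. if j < k then antid_F s q (xs ! i) (c ! j + of_nat (k - j))
    else border_K s q (xs ! i) (last a)"
  shows "(\<Sum>b\<in>box k (below_box k (a ! 0) c).
      half_power q (E + (\<Sum>j<length b - 1. b ! j) + fold_end (last a) (last b)) * weyl_det s b xs) =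
    half_power q E * (\<Prod>j<k. half_power q (- of_nat (k - 1 - j))) *
      det (mat k k (\<lambda>(j, i). if Suc j < k then F j i - F (Suc j) i
        else border_w s q (last a) * F j i - F (Suc j) i))"
proof -
  define h where "h = a ! 0"
  define t where "t = last a"
  have len: "length a = Suc k" using a by (simp add: so_tuple_def)
  then have ta: "t = a ! k"
    unfolding t_def by (metis last_conv_nth diff_Suc_1 length_0_conv nat.distinct(1))
  have h: "2 * h \<in> \<int>" "t - h \<in> \<int>" and t2: "2 * t \<in> \<int>"
    using a(1) by (auto simp: so_tuple_def h_def ta)
  have ch: "c ! j - h \<in> \<int>" "a ! Suc j \<le> c ! j" "c ! j \<le> a ! j" if "j < k" for j
    using c that by (auto simp: box_def above_box_def zrange_def h_def)
  \<comment> \<open>Row j absorbs its own share of the power of \<open>q\<close>.\<close>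
  define g where "g j x = half_power q (if Suc j < k then x else fold_end t x)" for j x
  define f where "f j i x = half_power (xs ! i) (x + of_nat (k - 1 - j)) +
    s * half_power (xs ! i) (- (x + of_nat (k - 1 - j)))" for i j x
  have fin: "finite (below_box k h c j)" for j by (simp add: below_box_def)
  have "half_power q (E + (\<Sum>j<length b - 1. b ! j) + fold_end t (last b)) * weyl_det s b xs =
      half_power q E * det (mat k k (\<lambda>(j, i). g j (b ! j) * f j i (b ! j)))"
    if b: "b \<in> box k (below_box k h c)" for b
  proof -
    have lb: "length b = k" using b by (simp add: box_def)
    obtain k' where k': "k = Suc k'" using k by (cases k) auto
    have "last b = b ! k'" using lb k' by (metis last_conv_nth diff_Suc_1 length_0_conv nat.distinct(1))
    then have sum: "(\<Sum>j<length b - 1. b ! j) + fold_end t (last b) =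
        (\<Sum>j<k. if Suc j < k then b ! j else fold_end t (b ! j))"
      by (simp add: lb k')
    have b2: "2 * (if Suc j < k then b ! j else fold_end t (b ! j)) \<in> \<int>" if "j < k" for j
    proof -
      have "2 * b ! j \<in> \<int>" using b that
        by (intro Ints_double_cong[OF h(1)]) (simp add: box_def below_box_def zrange_def)
      moreover have "- (2 * b ! j) - (2 * t + 2 * t) \<in> \<int>"
        by (intro Ints_diff Ints_minus Ints_add t2 calculation)
      ultimately show ?thesis by (simp add: fold_end_def algebra_simps)
    qed
    have "2 * (\<Sum>j<k. if Suc j < k then b ! j else fold_end t (b ! j)) \<in> \<int>"
      unfolding sum_distrib_left using b2 by (intro Ints_sum) auto
    then have "half_power q (E + (\<Sum>j<length b - 1. b ! j) + fold_end t (last b)) =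
        half_power q E * (\<Prod>j<k. g j (b ! j))"
      using b2 half_power_sum[OF q, of "{..<k}" "\<lambda>j. if Suc j < k then b ! j else fold_end t (b ! j)"]
      unfolding add.assoc sum g_def by (simp add: half_power_add[OF q E])
    moreover have "weyl_det s b xs = det (mat k k (\<lambda>(j, i). f j i (b ! j)))"
      by (simp add: weyl_det_def xs lb alpha_def f_def)
    moreover have "(\<Prod>j<k. g j (b ! j)) * det (mat k k (\<lambda>(j, i). f j i (b ! j))) =
        det (mat k k (\<lambda>(j, i). g j (b ! j) * f j i (b ! j)))"
      using det_mat_scale[of k "\<lambda>j. g j (b ! j)" "\<lambda>_. 1" "\<lambda>j i. f j i (b ! j)"] by simp
    ultimately show ?thesis by (simp add: mult.assoc)
  qed
  then have "(\<Sum>b\<in>box k (below_box k h c).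
      half_power q (E + (\<Sum>j<length b - 1. b ! j) + fold_end t (last b)) * weyl_det s b xs) =
      half_power q E * (\<Sum>b\<in>box k (below_box k h c). det (mat k k (\<lambda>(j, i). g j (b ! j) * f j i (b ! j))))"
    by (simp add: sum_distrib_left)
  also have "(\<Sum>b\<in>box k (below_box k h c). det (mat k k (\<lambda>(j, i). g j (b ! j) * f j i (b ! j)))) =
      det (mat k k (\<lambda>(j, i). \<Sum>x\<in>below_box k h c j. g j x * f j i x))"
    by (rule sum_det_box[of k "below_box k h c" "\<lambda>j i x. g j x * f j i x"]) (rule fin)
  also have "mat k k (\<lambda>(j, i). \<Sum>x\<in>below_box k h c j. g j x * f j i x) =
      mat k k (\<lambda>(j, i). half_power q (- of_nat (k - 1 - j)) * 1 *
        (if Suc j < k then F j i - F (Suc j) i else border_w s q t * F j i - F (Suc j) i))"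
  proof (rule cong_mat, goal_cases)
    case (3 j i)
    then have ij: "j < k" "i < k" by auto
    have r0: "xs ! i \<noteq> 0" "kappa q (xs ! i) \<noteq> 0" using r[of "xs ! i"] xs ij by auto
    note nz = q r0(1) kappa_nonzeroD(1,2)[OF q r0]
    show ?case
    proof (cases "Suc j < k")
      case True
      have "c ! Suc j \<le> c ! j" using ch(2)[of j] ch(3)[of "Suc j"] True by auto
      then have "(\<Sum>x\<in>zrange h (c ! Suc j) (c ! j). half_power q x *
          (half_power (xs ! i) (x + of_nat (k - 1 - j)) + s * half_power (xs ! i) (- (x + of_nat (k - 1 - j))))) =
        half_power q (- of_nat (k - 1 - j)) *
        (antid_F s q (xs ! i) (c ! j + of_nat (Suc (k - 1 - j))) -
         antid_F s q (xs ! i) (c ! Suc j + of_nat (k - 1 - j)))"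
        using ch(1)[of j] ch(1)[of "Suc j"] True by (intro sum_below_row[OF nz h(1)]) auto
      \<comment> \<open>With these shifts, the lower boundary term of row j is the upper boundary
        term \<open>F (Suc j) i\<close> of the next row.\<close>
      moreover have "Suc (k - 1 - j) = k - j" "k - 1 - j = k - Suc j" using True by auto
      ultimately show ?thesis
        using True by (simp add: below_box_def g_def f_def F_def del: of_nat_diff of_nat_Suc)
    next
      case False
      then have j: "k = Suc j" using ij by simp
      have "0 \<le> t" using a by (simp add: t_def)
      moreover have "t \<le> c ! j" using ch(2)[of j] j by (simp add: ta)
      moreover have "c ! j - t \<in> \<int>" using ch(1)[of j] h(2) j Ints_minus_cong[of "c ! j" h t] by simp
      ultimately have "(\<Sum>x\<in>zrange t (- (c ! j)) (c ! j). half_power q (fold_end t x) *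
          (half_power (xs ! i) x + s * half_power (xs ! i) (- x))) =
        border_w s q t * antid_F s q (xs ! i) (c ! j + 1) - border_K s q (xs ! i) t"
        using t2 by (intro sum_fold_end[OF nz s])
      moreover have "zrange h (- (c ! j)) (c ! j) = zrange t (- (c ! j)) (c ! j)"
        using Ints_minus[OF h(2)] by (intro zrange_cong) simp
      ultimately show ?thesis
        by (simp add: below_box_def g_def f_def F_def j t_def)
    qed
  qed auto
  also have "det \<dots> = (\<Prod>j<k. half_power q (- of_nat (k - 1 - j))) * (\<Prod>i<k. 1) *
      det (mat k k (\<lambda>(j, i). if Suc j < k then F j i - F (Suc j) i
        else border_w s q t * F j i - F (Suc j) i))"
    by (rule det_mat_scale)
  finally show ?thesis
    unfolding h_def t_def by (simp only: mult.assoc prod.neutral_const mult_1_left)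
qed

text \<open>The formula holds for each \<open>s\<close> separately. The sum over \<open>b\<close>
  leaves a determinant whose row j contains \<open>c ! j\<close> and \<open>c ! Suc j\<close>;
  bordering it makes row j depend on \<open>c ! j\<close> alone, so that the sum over
  \<open>c\<close> is rowwise too. The rows are then differences at consecutive
  \<open>alpha a j + 1\<close>, which telescope to Weyl's entries, and the border column supplies
  the column of \<open>q\<close>.\<close>

lemma weyl_step:
  fixes q s :: "'a::field"
  assumes a: "so_tuple (Suc k) a" "0 \<le> last a" and k: "0 < k" and xs: "length xs = k"
    and q: "q \<noteq> 0" "q ^ 4 \<noteq> 1" and s: "s\<^sup>2 = 1"
    and r: "\<And>r. r \<in> set xs \<Longrightarrow> r \<noteq> 0 \<and> kappa q r \<noteq> 0"
  shows "(\<Sum>b\<in>so_tuples_in k (a ! 0). transfer a b q * weyl_det s b xs) *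
    (\<Prod>i<k. kappa q (xs ! i)) = weyl_det s a (q # xs)"
proof -
  define t where "t = last a"
  have len: "length a = Suc k" using a by (simp add: so_tuple_def)
  then have ta: "t = a ! k"
    unfolding t_def by (metis last_conv_nth diff_Suc_1 length_0_conv nat.distinct(1))
  have h: "2 * a ! 0 \<in> \<int>" and t2: "2 * t \<in> \<int>" and aj: "\<And>j. j \<le> k \<Longrightarrow> 2 * a ! j \<in> \<int> \<and> a ! j - a ! 0 \<in> \<int>"
    using a(1) by (auto simp: so_tuple_def ta)
  have anti: "a ! Suc j \<le> a ! j" if "j < k" for j
    using so_tuple_nth_mono[OF a(1), of j "Suc j"] that by auto
  have pos: "0 \<le> a ! j" if "j \<le> k" for j
    using so_tuple_nth_nonneg[OF a(1), of j] a(2) that ta t_def by (cases "j = k") auto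
  have abs_a: "abs_sum a = (\<Sum>j<Suc k. a ! j)"
    unfolding abs_sum_def len using pos by (intro sum.cong) auto
  have E2: "2 * abs_sum a \<in> \<int>" using aj by (intro double_abs_sum) (simp add: len)
  have r': "xs ! i \<noteq> 0" "kappa q (xs ! i) \<noteq> 0" if "i < k" for i
    using r[of "xs ! i"] xs that by auto
  note nz = kappa_nonzeroD[OF q(1) r']
  define d1 where "d1 = (\<Prod>j<k. half_power q (- of_nat (k - 1 - j)))"
  \<comment> \<open>Column 0 is the border, which ends up as the column of \<open>q\<close>; column
    \<open>i > 0\<close> belongs to \<open>xs ! (i - 1)\<close>. \<open>V\<close> gives the entries
    after the sum over \<open>b\<close>, \<open>W\<close> the border row, \<open>G\<close> the
    antiderivatives for the sum over \<open>c\<close>.\<close>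
  define V where "V i x = (if i = 0 then 1 else antid_F s q (xs ! (i - 1)) x)" for i x
  define W where "W i = (if i = 0 then border_w s q t else border_K s q (xs ! (i - 1)) t)" for i
  define G where "G i = (if i = 0 then antid_G0 s q else antid_G s q (xs ! (i - 1)))" for i
  have G_diff: "G i (x + 1) - G i x = half_power q (- (2 * x)) * V i x"
    if "i \<le> k" "2 * x \<in> \<int>" for i x
    using antid_G_diff[OF q(1) r'(1) nz(1,2) that(2), of "i - 1"] antid_G0_diff[OF q that(2) s] that
    by (simp add: G_def V_def)
  have W_eq: "W i = - s * (q ^ 4 - 1) * G i (t + 1)" if "i \<le> k" for i
    using border_K_eq[OF q(1) r'(1) nz(1,2) t2 s, of "i - 1"] border_w_eq[OF q t2 s] that
    by (simp add: G_def W_def)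
  have fin: "finite (above_box k a j)" "finite (below_box k (a ! 0) c j)" for j c
    by (simp_all add: above_box_def below_box_def)
  have "(\<Sum>b\<in>so_tuples_in k (a ! 0). transfer a b q * weyl_det s b xs) =
      (\<Sum>b\<in>so_tuples_in k (a ! 0). \<Sum>c\<in>mid_rows a b. half_power q
        (abs_sum a - 2 * entry_sum c + (\<Sum>j<length b - 1. b ! j) + fold_end t (last b)) * weyl_det s b xs)"
  proof (intro sum.cong refl)
    fix b assume b: "b \<in> so_tuples_in k (a ! 0)"
    then have "b \<noteq> []" using k by (auto simp: so_tuples_in_def so_tuple_def)
    then show "transfer a b q * weyl_det s b xs = (\<Sum>c\<in>mid_rows a b. half_power q
        (abs_sum a - 2 * entry_sum c + (\<Sum>j<length b - 1. b ! j) + fold_end t (last b)) * weyl_det s b xs)"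
      using transfer_eq_fold_end[OF compatible_so_tuples_in[OF a(1) b] _ a(2), of q]
      by (simp add: t_def sum_distrib_right)
  qed
  also have "\<dots> = (\<Sum>c\<in>box k (above_box k a). \<Sum>b\<in>box k (below_box k (a ! 0) c). half_power q
        (abs_sum a - 2 * entry_sum c + (\<Sum>j<length b - 1. b ! j) + fold_end t (last b)) * weyl_det s b xs)"
    (is "_ = ?R")
  proof -
    define S T where "S = Sigma (so_tuples_in k (a ! 0)) (mid_rows a)"
      and "T = Sigma (box k (above_box k a)) (\<lambda>c. box k (below_box k (a ! 0) c))"
    have ST: "(b, c) \<in> S \<longleftrightarrow> (c, b) \<in> T" for b c
      using mid_rows_iff_boxes[OF a k] by (simp add: S_def T_def)
    define f where "f b c = half_power q (abs_sum a - 2 * entry_sum c + (\<Sum>j<length b - 1. b ! j) +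
        fold_end t (last b)) * weyl_det s b xs" for b c
    have "(\<Sum>(b, c)\<in>S. f b c) = (\<Sum>(c, b)\<in>T. f b c)"
      by (rule sum.reindex_bij_witness[of _ prod.swap prod.swap]) (auto simp: ST)
    then show ?thesis
      unfolding S_def T_def f_def by (simp add: sum.Sigma finite_box fin)
  qed
  \<comment> \<open>The inner sum is \<open>weyl_below\<close>; it is bordered here, and the powers
    of \<open>q\<close> in the entries of \<open>c\<close> are moved into the rows.\<close>
  also have "?R = (\<Sum>c\<in>box k (above_box k a). half_power q (abs_sum a) * d1 * (- 1) ^ k *
     det (mat (Suc k) (Suc k) (\<lambda>(j, i). if j < k
       then half_power q (- (2 * c ! j)) * V i (c ! j + of_nat (k - j)) else W i)))"
  proof (intro sum.cong refl)
    fix c assume c: "c \<in> box k (above_box k a)"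
    then have lc: "length c = k" by (simp add: box_def)
    have c2: "2 * c ! j \<in> \<int>" if "j < k" for j
      using c that by (intro Ints_double_cong[OF h]) (simp add: box_def above_box_def zrange_def)
    have c4: "2 * (- (2 * c ! j)) \<in> \<int>" if "j < k" for j
      using c2[OF that] by (metis Ints_add Ints_minus mult_2 mult_minus_right)
    have m2: "- (2 * entry_sum c) = (\<Sum>j<k. - (2 * c ! j))"
      by (simp add: entry_sum_def lc sum_distrib_left sum_negf)
    have m2i: "2 * (- (2 * entry_sum c)) \<in> \<int>"
      unfolding m2 sum_distrib_left using c4 by (intro Ints_sum) auto
    have "half_power q (- (2 * entry_sum c)) = (\<Prod>j<k. half_power q (- (2 * c ! j)))"
      unfolding m2 using c4 by (intro half_power_sum[OF q(1)]) auto
    then have hp: "half_power q (abs_sum a - 2 * entry_sum c) =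
        half_power q (abs_sum a) * (\<Prod>j<k. half_power q (- (2 * c ! j)))"
      using half_power_add[OF q(1) E2 m2i] by simp
    define F where "F j i = (if j < k then antid_F s q (xs ! i) (c ! j + of_nat (k - j))
        else border_K s q (xs ! i) t)" for j i
    have "(- 1) ^ k * det (mat k k (\<lambda>(j, i). if Suc j < k then F j i - F (Suc j) i
        else border_w s q t * F j i - F (Suc j) i)) =
      det (mat (Suc k) (Suc k) (\<lambda>(j, i). if i = 0 then (if j = k then border_w s q t else 1) else F j (i - 1)))"
      by (rule det_mat_bordered[OF k, symmetric])
    also have "mat (Suc k) (Suc k) (\<lambda>(j, i). if i = 0 then (if j = k then border_w s q t else 1) else F j (i - 1)) =
      mat (Suc k) (Suc k) (\<lambda>(j, i). if j < k then V i (c ! j + of_nat (k - j)) else W i)"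
      by (rule cong_mat) (auto simp: V_def W_def F_def)
    finally have B: "det (mat k k (\<lambda>(j, i). if Suc j < k then F j i - F (Suc j) i
        else border_w s q t * F j i - F (Suc j) i)) =
      (- 1) ^ k * det (mat (Suc k) (Suc k) (\<lambda>(j, i). if j < k then V i (c ! j + of_nat (k - j)) else W i))"
      by (metis (no_types, lifting) mult.assoc mult_1_left power_add power_one_right even_add minus_one_power_iff)
    have "(\<Prod>j<Suc k. if j < k then half_power q (- (2 * c ! j)) else 1) * (\<Prod>i<Suc k. 1) *
        det (mat (Suc k) (Suc k) (\<lambda>(j, i). if j < k then V i (c ! j + of_nat (k - j)) else W i)) =
        det (mat (Suc k) (Suc k) (\<lambda>(j, i). (if j < k then half_power q (- (2 * c ! j)) else 1) * 1 *
          (if j < k then V i (c ! j + of_nat (k - j)) else W i)))"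
      by (rule det_mat_scale[symmetric])
    also have "(\<lambda>(j, i). (if j < k then half_power q (- (2 * c ! j)) else 1) * 1 *
          (if j < k then V i (c ! j + of_nat (k - j)) else W i)) =
        (\<lambda>(j, i). if j < k then half_power q (- (2 * c ! j)) * V i (c ! j + of_nat (k - j)) else W i)"
      by auto
    finally have S: "(\<Prod>j<k. half_power q (- (2 * c ! j))) *
        det (mat (Suc k) (Suc k) (\<lambda>(j, i). if j < k then V i (c ! j + of_nat (k - j)) else W i)) =
        det (mat (Suc k) (Suc k) (\<lambda>(j, i). if j < k
          then half_power q (- (2 * c ! j)) * V i (c ! j + of_nat (k - j)) else W i))"
      by simp
    have "(\<Sum>b\<in>box k (below_box k (a ! 0) c). half_power q
        (abs_sum a - 2 * entry_sum c + (\<Sum>j<length b - 1. b ! j) + fold_end t (last b)) * weyl_det s b xs) =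
      half_power q (abs_sum a - 2 * entry_sum c) * d1 *
        det (mat k k (\<lambda>(j, i). if Suc j < k then F j i - F (Suc j) i
          else border_w s q t * F j i - F (Suc j) i))"
      unfolding d1_def F_def t_def
    proof (rule weyl_below[OF a k xs c q(1) s r])
      have "2 * abs_sum a + 2 * (- (2 * entry_sum c)) \<in> \<int>" by (rule Ints_add[OF E2 m2i])
      then show "2 * (abs_sum a - 2 * entry_sum c) \<in> \<int>" by (simp add: algebra_simps)
    qed
    also have "\<dots> = half_power q (abs_sum a) * d1 * (- 1) ^ k * ((\<Prod>j<k. half_power q (- (2 * c ! j))) *
        det (mat (Suc k) (Suc k) (\<lambda>(j, i). if j < k then V i (c ! j + of_nat (k - j)) else W i)))"
      unfolding B hp by (simp only: mult_ac)
    finally show "(\<Sum>b\<in>box k (below_box k (a ! 0) c). half_power q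
        (abs_sum a - 2 * entry_sum c + (\<Sum>j<length b - 1. b ! j) + fold_end t (last b)) * weyl_det s b xs) =
      half_power q (abs_sum a) * d1 * (- 1) ^ k *
        det (mat (Suc k) (Suc k) (\<lambda>(j, i). if j < k
          then half_power q (- (2 * c ! j)) * V i (c ! j + of_nat (k - j)) else W i))"
      unfolding S .
  qed
  also have "\<dots> = half_power q (abs_sum a) * d1 * (- 1) ^ k *
      det (mat (Suc k) (Suc k) (\<lambda>(j, i). if j < k
       then \<Sum>x\<in>above_box k a j. half_power q (- (2 * x)) * V i (x + of_nat (k - j)) else W i))"
    by (subst sum_distrib_left[symmetric], subst sum_det_box_Suc) (auto simp: fin)
  also have "mat (Suc k) (Suc k) (\<lambda>(j, i). if j < k
       then \<Sum>x\<in>above_box k a j. half_power q (- (2 * x)) * V i (x + of_nat (k - j)) else W i) =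
      mat (Suc k) (Suc k) (\<lambda>(j, i).
        (if j < k then half_power q (2 * of_nat (k - j)) else - s * (q ^ 4 - 1)) * 1 *
        (if Suc j < Suc k then G i (alpha a j + 1) - 1 * G i (alpha a (Suc j) + 1) else G i (alpha a j + 1)))"
  proof (rule cong_mat, goal_cases)
    case (3 j i)
    then have i: "i \<le> k" by simp
    show ?case
    proof (cases "j < k")
      case True
      have "(\<Sum>x\<in>above_box k a j. half_power q (- (2 * x)) * V i (x + of_nat (k - j))) =
          half_power q (2 * of_nat (k - j)) * (G i (a ! j + of_nat (k - j) + 1) - G i (a ! Suc j + of_nat (k - j)))"
        unfolding above_box_def
        using aj[of "Suc j"] aj[of j] anti[of j] True
        by (intro sum_above_row[OF q(1) G_diff[OF i] h]) auto
      \<comment> \<open>The lower end of row j is thus the point belonging to row j + 1, so the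
        differences telescope down to the border row, which is proportional to the value at
        \<open>alpha a k + 1\<close>.\<close>
      moreover have "a ! Suc j + of_nat (k - j) = alpha a (Suc j) + 1"
        using True by (simp add: alpha_def len of_nat_diff)
      ultimately show ?thesis using True by (simp add: alpha_def len)
    next
      case False
      then have "j = k" using 3 by simp
      then show ?thesis using W_eq[OF i] by (simp add: alpha_def len ta)
    qed
  qed auto
  also have "det \<dots> = (\<Prod>j<Suc k. if j < k then half_power q (2 * of_nat (k - j)) else - s * (q ^ 4 - 1)) *
      (\<Prod>i<Suc k. 1) * det (mat (Suc k) (Suc k) (\<lambda>(j, i).
        if Suc j < Suc k then G i (alpha a j + 1) - 1 * G i (alpha a (Suc j) + 1) else G i (alpha a j + 1)))"
    by (rule det_mat_scale)
  also have "det (mat (Suc k) (Suc k) (\<lambda>(j, i).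
        if Suc j < Suc k then G i (alpha a j + 1) - 1 * G i (alpha a (Suc j) + 1) else G i (alpha a j + 1))) =
      det (mat (Suc k) (Suc k) (\<lambda>(j, i). G i (alpha a j + 1)))"
    by (rule det_mat_telescope)
  \<comment> \<open>At \<open>alpha a j + 1\<close> every antiderivative is a Weyl entry up to a row
    factor and a column factor.\<close>
  also have "mat (Suc k) (Suc k) (\<lambda>(j, i). G i (alpha a j + 1)) =
      mat (Suc k) (Suc k) (\<lambda>(j, i). half_power q (- alpha a j) *
        (if i = 0 then - s / (q ^ 4 - 1) else - 1 / (q\<^sup>2 * kappa q (xs ! (i - 1)))) *
        (half_power ((q # xs) ! i) (alpha a j) + s * half_power ((q # xs) ! i) (- alpha a j)))"
  proof (rule cong_mat, goal_cases)
    case (3 j i)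
    then show ?case
      using nz(3)[of "i - 1"]
      by (cases i) (simp_all add: G_def antid_G_def antid_G0_def)
  qed auto
  also have "det \<dots> = (\<Prod>j<Suc k. half_power q (- alpha a j)) *
      (\<Prod>i<Suc k. if i = 0 then - s / (q ^ 4 - 1) else - 1 / (q\<^sup>2 * kappa q (xs ! (i - 1)))) * weyl_det s a (q # xs)"
    unfolding weyl_det_def by (subst det_mat_scale) (simp add: xs)
  also have "(\<Prod>i<Suc k. if i = 0 then - s / (q ^ 4 - 1) else - 1 / (q\<^sup>2 * kappa q (xs ! (i - 1)))) =
      - s / (q ^ 4 - 1) * (\<Prod>i<k. - 1 / (q\<^sup>2 * kappa q (xs ! i)))"
    by (subst prod.lessThan_Suc_shift) simp
  finally have main: "(\<Sum>b\<in>so_tuples_in k (a ! 0). transfer a b q * weyl_det s b xs) =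
      half_power q (abs_sum a) * d1 * (- 1) ^ k *
      ((\<Prod>j<Suc k. if j < k then half_power q (2 * of_nat (k - j)) else - s * (q ^ 4 - 1)) *
       (\<Prod>i<Suc k. 1) * ((\<Prod>j<Suc k. half_power q (- alpha a j)) *
      (- s / (q ^ 4 - 1) * (\<Prod>i<k. - 1 / (q\<^sup>2 * kappa q (xs ! i)))) * weyl_det s a (q # xs)))" .
  have al: "2 * alpha a j \<in> \<int>" if "j \<le> k" for j
  proof -
    have "2 * a ! j + of_int 2 * of_nat (k - j) \<in> \<int>"
      using aj[OF that] by (intro Ints_add[OF _ Ints_mult[OF Ints_of_int Ints_of_nat]]) simp
    then show ?thesis by (simp add: alpha_def len distrib_left del: of_nat_diff)
  qed
  have hp_nat: "half_power q (of_nat n) = q ^ (2 * n)" for n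
    by (simp add: half_power_def power_int_def nat_mult_distrib)
       (metis floor_of_nat nat_int of_nat_mult of_nat_numeral)
  have hp_nat': "half_power q (- of_nat n) = 1 / q ^ (2 * n)" for n
  proof -
    have "2 * of_nat n \<in> (\<int> :: rat set)" by (metis Ints_of_nat of_nat_mult of_nat_numeral)
    then show ?thesis by (simp add: half_power_minus hp_nat inverse_eq_divide)
  qed
  \<comment> \<open>It remains to see that the scalars cancel against the product of the
    \<open>kappa\<close>. Since \<open>alpha a j\<close> is \<open>a ! j + (k - j)\<close>, all
    entries of \<open>a\<close> drop out and only a staircase of exponents stays.\<close>
  have P1: "half_power q (abs_sum a) * (\<Prod>j<Suc k. half_power q (- alpha a j)) =
      (\<Prod>j<k. half_power q (- of_nat (k - j)))"
  proof -
    have "half_power q (- of_nat (k - j)) = half_power q (a ! j) * half_power q (- alpha a j)" if "j \<le> k" for j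
      using half_power_add[OF q(1), of "a ! j" "- alpha a j"] aj[OF that] al[OF that]
      by (simp add: alpha_def len del: of_nat_diff)
    then have "(\<Prod>j<Suc k. half_power q (- of_nat (k - j))) =
        (\<Prod>j<Suc k. half_power q (a ! j)) * (\<Prod>j<Suc k. half_power q (- alpha a j))"
      by (subst prod.distrib[symmetric], intro prod.cong) auto
    then show ?thesis
      using half_power_sum[OF q(1), of "{..<Suc k}" "\<lambda>j. a ! j"] aj by (simp add: abs_a)
  qed
  \<comment> \<open>For \<open>k - j = n + 1\<close> the three exponents are - (n + 1), - n and 2 (n
    + 1), with sum 1, and \<open>half_power q 1\<close> is \<open>q\<^sup>2\<close>.\<close>
  have P2: "(\<Prod>j<k. half_power q (- of_nat (k - j))) * d1 *
      (\<Prod>j<k. half_power q (2 * of_nat (k - j))) = (\<Prod>j<k. q\<^sup>2)"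
    unfolding d1_def prod.distrib[symmetric]
  proof (intro prod.cong refl)
    fix j assume "j \<in> {..<k}"
    then obtain n where n: "k - j = Suc n" "k - 1 - j = n"
      by (metis Suc_diff_Suc diff_Suc_eq_diff_pred lessThan_iff diff_right_commute diff_Suc_1)
    have "half_power q (2 * of_nat (Suc n)) = q ^ (2 * (2 * Suc n))"
      using hp_nat[of "2 * Suc n"] by simp
    then show "half_power q (- of_nat (k - j)) * half_power q (- of_nat (k - 1 - j)) *
        half_power q (2 * of_nat (k - j)) = q\<^sup>2"
      using q(1) unfolding n hp_nat' by (simp add: power_add[symmetric] field_simps power2_eq_square)
  qed
  have P3: "(\<Prod>i<k. q\<^sup>2) * (- 1) ^ k * (\<Prod>i<k. - 1 / (q\<^sup>2 * kappa q (xs ! i))) *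
      (\<Prod>i<k. kappa q (xs ! i)) = 1"
  proof -
    have "(- 1) ^ k = (\<Prod>i<k. - 1 :: 'a)" by simp
    then have "(\<Prod>i<k. q\<^sup>2) * (- 1) ^ k * (\<Prod>i<k. - 1 / (q\<^sup>2 * kappa q (xs ! i))) *
        (\<Prod>i<k. kappa q (xs ! i)) =
        (\<Prod>i<k. q\<^sup>2 * - 1 * (- 1 / (q\<^sup>2 * kappa q (xs ! i))) * kappa q (xs ! i))"
      by (simp only: prod.distrib)
    also have "\<dots> = 1"
      using q(1) r' by (intro prod.neutral) auto
    finally show ?thesis .
  qed
  have ss: "- s * (q ^ 4 - 1) * (- s / (q ^ 4 - 1)) = 1"
    using q(2) s by (simp add: power2_eq_square)
  have "(\<Sum>b\<in>so_tuples_in k (a ! 0). transfer a b q * weyl_det s b xs) * (\<Prod>i<k. kappa q (xs ! i)) =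
      (half_power q (abs_sum a) * (\<Prod>j<Suc k. half_power q (- alpha a j))) * d1 *
      (\<Prod>j<k. half_power q (2 * of_nat (k - j))) * (- 1) ^ k *
      (\<Prod>i<k. - 1 / (q\<^sup>2 * kappa q (xs ! i))) * (\<Prod>i<k. kappa q (xs ! i)) *
      (- s * (q ^ 4 - 1) * (- s / (q ^ 4 - 1))) * weyl_det s a (q # xs)"
  proof -
    have "(\<Prod>j<Suc k. if j < k then half_power q (2 * of_nat (k - j)) else - s * (q ^ 4 - 1)) =
        (\<Prod>j<k. half_power q (2 * of_nat (k - j))) * (- s * (q ^ 4 - 1))" by simp
    then show ?thesis unfolding main by (simp only: prod.neutral_const mult_1_left mult_1_right mult_ac)
  qed
  also have "\<dots> = weyl_det s a (q # xs)"
    unfolding P1 P2 P3 ss by simp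
  finally show ?thesis .
qed

section \<open>The Weyl character formula and symmetry\<close>

text \<open>Multiplying out the binomials, a term with e inverted exponents carries
  \<open>s ^ e\<close>. Adding the cases \<open>s = 1\<close> and \<open>s = - 1\<close> leaves
  twice the terms with even e, which is twice the alternating sum over the Weyl group of type
  D.\<close>

definition weyl_num :: "rat list \<Rightarrow> 'a::field list \<Rightarrow> 'a" where
  "weyl_num a rs = weyl_det 1 a rs + weyl_det (- 1) a rs"

text \<open>The last exponent \<open>alpha a k\<close> carries no shift, so the sign change swaps
  the two terms in the last row, which multiplies that row by \<open>s\<close>.\<close>

lemma weyl_det_signed:
  assumes a: "so_tuple (Suc k) a" and xs: "length xs = k" and s: "s\<^sup>2 = 1"
  shows "weyl_det s (signed (- 1) a) (q # xs) = s * weyl_det s a (q # xs)"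
proof -
  have len: "length a = Suc k" "a \<noteq> []" using a by (auto simp: so_tuple_def)
  have ss: "s * s = 1" using s by (simp add: power2_eq_square)
  have "weyl_det s (signed (- 1) a) (q # xs) =
    det (mat (Suc k) (Suc k) (\<lambda>(j, i). (if j = k then s else 1) * 1 *
     (half_power ((q # xs) ! i) (alpha a j) + s * half_power ((q # xs) ! i) (- alpha a j))))"
    unfolding weyl_det_def
    using ss by (intro arg_cong[of _ _ det] cong_mat)
      (auto simp: xs alpha_def len length_signed nth_signed distrib_left mult.assoc[symmetric])
  also have "\<dots> = (\<Prod>j<Suc k. if j = k then s else 1) * (\<Prod>i<Suc k. 1) * weyl_det s a (q # xs)"
    unfolding weyl_det_def by (subst det_mat_scale) (simp add: xs)
  finally show ?thesis by simp
qed

text \<open>Inverting \<open>q\<close> swaps the two terms in column 0.\<close>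

lemma weyl_det_inverse:
  assumes a: "so_tuple (Suc k) a" and xs: "length xs = k" and s: "s\<^sup>2 = 1"
  shows "weyl_det s a (inverse q # xs) = s * weyl_det s a (q # xs)"
proof -
  have ss: "s * s = 1" using s by (simp add: power2_eq_square)
  have al: "2 * alpha a j \<in> \<int>" if "j \<le> k" for j
  proof -
    have "2 * a ! j + of_int 2 * of_nat (length a - 1 - j) \<in> \<int>"
      using a that by (intro Ints_add[OF _ Ints_mult[OF Ints_of_int Ints_of_nat]]) (simp add: so_tuple_def)
    then show ?thesis by (simp add: alpha_def distrib_left del: of_nat_diff)
  qed
  have "weyl_det s a (inverse q # xs) =
    det (mat (Suc k) (Suc k) (\<lambda>(j, i). 1 * (if i = 0 then s else 1) *
     (half_power ((q # xs) ! i) (alpha a j) + s * half_power ((q # xs) ! i) (- alpha a j))))"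
    unfolding weyl_det_def
  proof (intro arg_cong[of _ _ det] cong_mat, goal_cases)
    case (3 j i)
    then have "2 * alpha a j \<in> \<int>" "2 * (- alpha a j) \<in> \<int>" using al[of j] xs by auto
    from this[THEN half_power_inverse, of q] show ?case
      using ss by (cases i) (simp_all add: distrib_left mult.assoc[symmetric])
  qed (auto simp: xs)
  also have "\<dots> = (\<Prod>j<Suc k. 1) * (\<Prod>i<Suc k. if i = 0 then s else 1) * weyl_det s a (q # xs)"
    unfolding weyl_det_def by (subst det_mat_scale) (simp add: xs)
  also have "(\<Prod>i<Suc k. if i = 0 then s else 1) = s"
    by (subst prod.lessThan_Suc_shift) simp
  finally show ?thesis by simp
qed

lemma signed_signed: "a \<noteq> [] \<Longrightarrow> signed (- 1) (signed (- 1) a) = a"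
  by (simp add: signed_def)

lemma kappa_inverse: "kappa (inverse q) r = kappa q r"
  by (simp add: kappa_def power_divide inverse_eq_divide)

text \<open>A negative last entry is removed by inverting \<open>q\<close>. On the determinants
  these two operations each contribute a factor \<open>s\<close>, on the kernels they agree by
  \<open>transfer_signed\<close>, and \<open>kappa\<close> does not see the inversion.\<close>

lemma weyl_num_step:
  fixes q :: "'a::field"
  assumes a: "so_tuple (Suc k) a" and k: "0 < k" and xs: "length xs = k"
    and q: "q \<noteq> 0" "q ^ 4 \<noteq> 1"
    and r: "\<And>r. r \<in> set xs \<Longrightarrow> r \<noteq> 0 \<and> kappa q r \<noteq> 0"
  shows "(\<Sum>b\<in>so_tuples_in k (a ! 0). transfer a b q * weyl_num b xs) *
    (\<Prod>i<k. kappa q (xs ! i)) = weyl_num a (q # xs)"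
proof -
  have *: "(\<Sum>b\<in>so_tuples_in k (a ! 0). transfer a b q * weyl_num b xs) *
    (\<Prod>i<k. kappa q (xs ! i)) = weyl_num a (q # xs)"
    if "so_tuple (Suc k) a" "0 \<le> last a" "q \<noteq> 0" "q ^ 4 \<noteq> 1"
      "\<And>r. r \<in> set xs \<Longrightarrow> r \<noteq> 0 \<and> kappa q r \<noteq> 0" for a q
    using weyl_step[OF that(1,2) k xs that(3,4) _ that(5), of 1]
      weyl_step[OF that(1,2) k xs that(3,4) _ that(5), of "- 1"]
    by (simp add: weyl_num_def distrib_left distrib_right sum.distrib)
  show ?thesis
  proof (cases "0 \<le> last a")
    case True
    then show ?thesis using * a q r by blast
  next
    case False
    define a' where "a' = signed (- 1) a"
    have ne: "a \<noteq> []" "length a = Suc k" using a by (auto simp: so_tuple_def)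
    have a': "so_tuple (Suc k) a'" "0 \<le> last a'" "a = signed (- 1) a'" "a' ! 0 = a ! 0"
      using so_tuple_signed[OF a ne(1)] False k
      by (simp_all add: a'_def signed_signed[OF ne(1)] nth_signed ne)
    have "(\<Sum>b\<in>so_tuples_in k (a ! 0). transfer a b q * weyl_num b xs) =
        (\<Sum>b\<in>so_tuples_in k (a' ! 0). transfer a' b (inverse q) * weyl_num b xs)"
      using transfer_signed[OF compatible_so_tuples_in[OF a'(1)], of _ q]
      by (intro sum.cong) (simp_all add: a'(4) flip: a'(3))
    moreover have "(\<Sum>b\<in>so_tuples_in k (a' ! 0). transfer a' b (inverse q) * weyl_num b xs) *
        (\<Prod>i<k. kappa (inverse q) (xs ! i)) = weyl_num a' (inverse q # xs)"
      using q r by (intro * a'(1,2)) (auto simp: kappa_inverse power_inverse)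
    moreover have "weyl_num a' (inverse q # xs) = weyl_num a (q # xs)"
      using weyl_det_signed[OF a'(1) xs, of 1 q] weyl_det_signed[OF a'(1) xs, of "- 1" q]
        weyl_det_inverse[OF a'(1) xs, of 1 q] weyl_det_inverse[OF a'(1) xs, of "- 1" q]
      by (simp add: weyl_num_def flip: a'(3))
    ultimately show ?thesis by (simp add: kappa_inverse)
  qed
qed

text \<open>These conditions keep \<open>q ^ 4 - 1\<close> and all the \<open>kappa\<close> from
  vanishing throughout the induction.\<close>

definition generic :: "'a::field list \<Rightarrow> bool" where
  "generic rs \<longleftrightarrow> (\<forall>r\<in>set rs. r \<noteq> 0 \<and> r ^ 4 \<noteq> 1) \<and> distinct (map (\<lambda>r. r\<^sup>2 + 1 / r\<^sup>2) rs)"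

fun weyl_denom :: "'a::field list \<Rightarrow> 'a" where
  "weyl_denom [] = 1"
| "weyl_denom (q # rs) = weyl_denom rs * (\<Prod>i<length rs. kappa q (rs ! i))"

lemma generic_Cons:
  assumes "generic (q # rs)"
  shows "generic rs" "q \<noteq> 0" "q ^ 4 \<noteq> 1" "\<And>r. r \<in> set rs \<Longrightarrow> r \<noteq> 0 \<and> kappa q r \<noteq> 0"
  using assms by (auto simp: generic_def kappa_def)

lemma weyl_denom_nonzero: "generic rs \<Longrightarrow> weyl_denom rs \<noteq> 0"
proof (induction rs)
  case (Cons q rs)
  then show ?case using generic_Cons[OF Cons.prems] by simp
qed simp

theorem weyl_character_formula:
  assumes "generic rs" "so_tuple (length rs) a"
  shows "2 * so_rec a rs * weyl_denom rs = weyl_num a rs"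
  using assms
proof (induction rs arbitrary: a)
  case Nil
  have "det (mat 0 0 f) = 1" for f :: "nat \<times> nat \<Rightarrow> 'a" by (rule det_dim_zero) simp
  then show ?case by (simp add: weyl_num_def weyl_det_def)
next
  case (Cons q rs)
  note g = generic_Cons[OF Cons.prems(1)]
  define k where "k = length rs"
  have a: "so_tuple (Suc k) a" using Cons.prems by (simp add: k_def)
  then have len: "length a = Suc k" by (simp add: so_tuple_def)
  show ?case
  \<comment> \<open>The step lemma needs a nonempty lower row. For one variable the two determinants
    simply add up to \<open>2 * half_power q x\<close>.\<close>
  proof (cases "k = 0")
    case True
    then have "rs = []" by (simp add: k_def)
    obtain x where x: "a = [x]" using len True by (auto simp: length_Suc_conv)
    have "det (mat (Suc 0) (Suc 0) f) = f (0, 0)" for f :: "nat \<times> nat \<Rightarrow> 'a"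
      by (subst det_single) auto
    then have "weyl_num a [q] = 2 * half_power q x"
      by (simp add: weyl_num_def weyl_det_def x alpha_def)
    moreover have "transfer a [] q = half_power q x"
      by (simp add: transfer_def x abs_sum_def entry_sum_def end_sign_def Defs.sign_def)
    ultimately show ?thesis using \<open>rs = []\<close> x by simp
  next
    case False
    have "2 * so_rec a (q # rs) * weyl_denom (q # rs) =
        (\<Sum>b\<in>so_tuples_in k (a ! 0). transfer a b q * (2 * so_rec b rs * weyl_denom rs)) *
        (\<Prod>i<k. kappa q (rs ! i))"
      by (simp add: len k_def sum_distrib_left sum_distrib_right mult_ac)
    also have "\<dots> = (\<Sum>b\<in>so_tuples_in k (a ! 0). transfer a b q * weyl_num b rs) *
        (\<Prod>i<k. kappa q (rs ! i))"
      using Cons.IH[OF g(1)] by (simp add: so_tuples_in_def k_def)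
    also have "\<dots> = weyl_num a (q # rs)"
      using False g by (intro weyl_num_step[OF a]) (auto simp: k_def)
    finally show ?thesis .
  qed
qed

text \<open>The trivial character. Inserted into Weyl's formula, it identifies
  \<open>2 * weyl_denom rs\<close> with the numerator of the zero weight.\<close>

lemma so_rec_replicate_0: "so_rec (replicate (length rs) 0) rs = 1"
proof (induction rs)
  case (Cons q rs)
  define k where "k = length rs"
  define zs where "zs = (\<lambda>n. replicate n (0 :: rat))"
  have zs: "length (zs n) = n" "\<And>j. j < n \<Longrightarrow> zs n ! j = 0" for n by (simp_all add: zs_def)
  have "b = zs k" if "b \<in> so_tuples_in k 0" for b
    using that by (intro nth_equalityI) (auto simp: so_tuples_in_def so_tuple_def zs)
  moreover have "zs k \<in> so_tuples_in k 0"
    by (auto simp: so_tuples_in_def so_tuple_def zs)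
  ultimately have B: "so_tuples_in k 0 = {zs k}" by blast
  have "c = zs k" if "c \<in> mid_rows (zs (Suc k)) (zs k)" for c
  proof (rule nth_equalityI)
    show len: "length c = length (zs k)" using that by (simp add: mid_rows_def)
    fix j assume "j < length c"
    then have "j < k" using len zs by simp
    moreover have "\<bar>zs (Suc k) ! Suc j\<bar> \<le> c ! j \<and> c ! j \<le> \<bar>zs (Suc k) ! j\<bar>"
      using that \<open>j < k\<close> by (simp add: mid_rows_def zs)
    ultimately show "c ! j = zs k ! j" by (simp add: zs)
  qed
  moreover have "zs k \<in> mid_rows (zs (Suc k)) (zs k)" by (simp add: mid_rows_def zs)
  ultimately have C: "mid_rows (zs (Suc k)) (zs k) = {zs k}" by blast
  have z: "abs_sum (zs n) = 0" "entry_sum (zs n) = 0" for n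
    by (simp_all add: abs_sum_def entry_sum_def zs)
  have IH: "so_rec (zs k) rs = 1" using Cons.IH by (simp add: zs_def k_def)
  have "so_rec (zs (Suc k)) (q # rs) = 1"
    using IH by (simp add: zs B C z transfer_def)
  then show ?case by (simp only: zs_def k_def length_Cons)
qed simp

section \<open>Symmetry in the variables\<close>

lemma weyl_det_permute:
  assumes p: "p permutes {..<length rs}"
  shows "weyl_det s a (permute_list p rs) = signof p * weyl_det s a rs"
proof -
  define k where "k = length rs"
  define f where "f j i = half_power (rs ! i) (alpha a j) + s * half_power (rs ! i) (- alpha a j)" for j i
  have p': "p permutes {0..<k}" using p by (simp add: k_def lessThan_atLeast0)
  have t: "det (mat k k (\<lambda>(j, i). F j i)) = det (mat k k (\<lambda>(i, j). F j i))" for F :: "nat \<Rightarrow> nat \<Rightarrow> 'a"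
  proof -
    have "(mat k k (\<lambda>(j, i). F j i))\<^sup>T = mat k k (\<lambda>(i, j). F j i)" by (rule eq_matI) auto
    then show ?thesis using det_transpose[of "mat k k (\<lambda>(j, i). F j i)" k] by simp
  qed
  have pk: "p i < k" if "i < k" for i using permutes_in_image[OF p', of i] that by simp
  have "weyl_det s a (permute_list p rs) = det (mat k k (\<lambda>(j, i). f j (p i)))"
    unfolding weyl_det_def f_def
    by (intro arg_cong[of _ _ det] cong_mat) (auto simp: k_def permute_list_nth[OF p])
  also have "\<dots> = det (mat k k (\<lambda>(i, j). f j (p i)))"
    by (rule t)
  also have "\<dots> = det (mat k k (\<lambda>(i, j). mat k k (\<lambda>(i, j). f j i) $$ (p i, j)))"
    by (intro arg_cong[of _ _ det] cong_mat) (auto simp: pk)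
  also have "\<dots> = signof p * det (mat k k (\<lambda>(i, j). f j i))"
    by (rule det_permute_rows[OF _ p']) simp
  also have "det (mat k k (\<lambda>(i, j). f j i)) = det (mat k k (\<lambda>(j, i). f j i))"
    by (rule t[symmetric])
  also have "\<dots> = weyl_det s a rs"
    unfolding weyl_det_def f_def k_def ..
  finally show ?thesis .
qed

text \<open>Every numerator changes by the sign of the permutation. The denominator does so as well,
  being half the numerator of the zero weight, and the signs cancel. Characteristic 0 allows
  division by 2.\<close>

lemma so_rec_permute_generic:
  fixes xs ys :: "'a::field_char_0 list"
  assumes "generic xs" "mset xs = mset ys" "so_tuple (length xs) a"
  shows "so_rec a xs = so_rec a ys"
proof -
  obtain p where p: "p permutes {..<length ys}" "permute_list p ys = xs"
    using mset_eq_permutation[OF assms(2)] by auto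
  have len: "length xs = length ys" using mset_eq_length[OF assms(2)] .
  have "mset (map (\<lambda>r. r\<^sup>2 + 1 / r\<^sup>2) xs) = mset (map (\<lambda>r. r\<^sup>2 + 1 / r\<^sup>2) ys)"
    using assms(2) by simp
  then have g: "generic ys"
    using assms(1) mset_eq_setD[OF assms(2)] mset_eq_imp_distinct_iff unfolding generic_def by blast
  define \<sigma> :: 'a where "\<sigma> = signof p"
  have num: "weyl_num b xs = \<sigma> * weyl_num b ys" for b
    using weyl_det_permute[OF p(1), of _ b] by (simp add: weyl_num_def p(2) \<sigma>_def distrib_left)
  define z where "z = replicate (length xs) (0 :: rat)"
  have "z ! j = 0" if "j < length xs" for j using that by (simp add: z_def)
  moreover from this[of 0] have "z ! 0 = 0" if "j < length xs" for j using that by (cases xs) auto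
  ultimately have "so_tuple (length xs) z" by (auto simp: so_tuple_def z_def)
  then have "2 * weyl_denom xs = weyl_num z xs" "2 * weyl_denom ys = weyl_num z ys"
    using weyl_character_formula[OF assms(1), of z] weyl_character_formula[OF g, of z]
      so_rec_replicate_0[of xs] so_rec_replicate_0[of ys] by (simp_all add: len z_def)
  then have "2 * weyl_denom xs = 2 * (\<sigma> * weyl_denom ys)"
    by (simp only: num mult.left_commute)
  then have d: "weyl_denom xs = \<sigma> * weyl_denom ys" by simp
  have "2 * so_rec a xs * weyl_denom xs = \<sigma> * (2 * so_rec a ys * weyl_denom ys)"
    using weyl_character_formula[OF assms(1,3)] weyl_character_formula[OF g, of a] num assms(3)
    by (simp add: len)
  then have "so_rec a xs * weyl_denom xs = so_rec a ys * weyl_denom xs"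
    by (simp add: d mult_ac)
  then show ?thesis using weyl_denom_nonzero[OF assms(1)] by simp
qed

text \<open>A rational function without pole at 0, as a function on the field. Agreement is asked
  only off the zeros of \<open>q\<close>, since a function built with \<open>inverse 0 = 0\<close>
  need not follow the quotient there.\<close>

definition regular_at_0 :: "('a::field \<Rightarrow> 'a) \<Rightarrow> bool" where
  "regular_at_0 f \<longleftrightarrow> (\<exists>p q. poly q 0 \<noteq> 0 \<and> (\<forall>t. poly q t \<noteq> 0 \<longrightarrow> f t = poly p t / poly q t))"

lemma regular_at_0I:
  "poly q 0 \<noteq> 0 \<Longrightarrow> (\<And>t. poly q t \<noteq> 0 \<Longrightarrow> f t = poly p t / poly q t) \<Longrightarrow> regular_at_0 f"
  unfolding regular_at_0_def by blast

lemma regular_at_0_poly: "regular_at_0 (poly p)"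
  by (rule regular_at_0I[of 1 _ p]) auto

lemma regular_at_0_const: "regular_at_0 (\<lambda>_. c)"
  by (rule regular_at_0I[of 1 _ "[:c:]"]) auto

lemma regular_at_0_add:
  assumes "regular_at_0 f" "regular_at_0 g"
  shows "regular_at_0 (\<lambda>t. f t + g t)"
proof -
  obtain p q where f: "poly q 0 \<noteq> 0" "\<And>t. poly q t \<noteq> 0 \<Longrightarrow> f t = poly p t / poly q t"
    using assms(1) unfolding regular_at_0_def by blast
  obtain p' q' where g: "poly q' 0 \<noteq> 0" "\<And>t. poly q' t \<noteq> 0 \<Longrightarrow> g t = poly p' t / poly q' t"
    using assms(2) unfolding regular_at_0_def by blast
  show ?thesis
    by (rule regular_at_0I[of "q * q'" _ "p * q' + p' * q"]) (auto simp: f g field_simps)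
qed

lemma regular_at_0_mult:
  assumes "regular_at_0 f" "regular_at_0 g"
  shows "regular_at_0 (\<lambda>t. f t * g t)"
proof -
  obtain p q where f: "poly q 0 \<noteq> 0" "\<And>t. poly q t \<noteq> 0 \<Longrightarrow> f t = poly p t / poly q t"
    using assms(1) unfolding regular_at_0_def by blast
  obtain p' q' where g: "poly q' 0 \<noteq> 0" "\<And>t. poly q' t \<noteq> 0 \<Longrightarrow> g t = poly p' t / poly q' t"
    using assms(2) unfolding regular_at_0_def by blast
  show ?thesis
    by (rule regular_at_0I[of "q * q'" _ "p * p'"]) (auto simp: f g)
qed

lemma regular_at_0_inverse:
  assumes "regular_at_0 f" "f 0 \<noteq> 0"
  shows "regular_at_0 (\<lambda>t. inverse (f t))"
proof -
  obtain p q where f: "poly q 0 \<noteq> 0" "\<And>t. poly q t \<noteq> 0 \<Longrightarrow> f t = poly p t / poly q t"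
    using assms(1) unfolding regular_at_0_def by blast
  have "poly p 0 \<noteq> 0" using f(1) f(2)[OF f(1)] assms(2) by auto
  \<comment> \<open>The quotient \<open>q / p\<close> is expanded by \<open>q\<close>, so that a
    nonzero new denominator also guarantees \<open>poly q t \<noteq> 0\<close>, where the
    representation of \<open>f\<close> is valid.\<close>
  then show ?thesis
    by (intro regular_at_0I[of "p * q" _ "q * q"]) (auto simp: f)
qed

lemma regular_at_0_sum:
  "(\<And>x. x \<in> A \<Longrightarrow> regular_at_0 (f x)) \<Longrightarrow> regular_at_0 (\<lambda>t. \<Sum>x\<in>A. f x t)"
  by (induction A rule: infinite_finite_induct) (auto intro: regular_at_0_const regular_at_0_add)

lemma regular_at_0_power: "regular_at_0 f \<Longrightarrow> regular_at_0 (\<lambda>t. f t ^ n)"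
  by (induction n) (auto intro: regular_at_0_const regular_at_0_mult)

lemma regular_at_0_half_power:
  "regular_at_0 f \<Longrightarrow> f 0 \<noteq> 0 \<Longrightarrow> regular_at_0 (\<lambda>t. half_power (f t) e)"
  unfolding half_power_def power_int_def
  by (cases "0 \<le> \<lfloor>2 * e\<rfloor>") (auto intro: regular_at_0_power regular_at_0_inverse)

text \<open>Off finitely many points the numerator vanishes; a polynomial with infinitely many zeros
  is 0, and then so is the value at 0.\<close>

lemma regular_at_0_eq_0:
  fixes f :: "'a::field_char_0 \<Rightarrow> 'a"
  assumes "regular_at_0 f" "finite {t. f t \<noteq> 0}"
  shows "f 0 = 0"
proof -
  obtain p q where f: "poly q 0 \<noteq> 0" "\<And>t. poly q t \<noteq> 0 \<Longrightarrow> f t = poly p t / poly q t"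
    using assms(1) unfolding regular_at_0_def by blast
  have "p = 0"
  proof (rule ccontr)
    assume "p \<noteq> 0"
    have "q \<noteq> 0" using f(1) by auto
    have "UNIV \<subseteq> {t. f t \<noteq> 0} \<union> {t. poly p t = 0} \<union> {t. poly q t = 0}"
      using f(2) by auto
    moreover have "finite \<dots>"
      using assms(2) poly_roots_finite[OF \<open>p \<noteq> 0\<close>] poly_roots_finite[OF \<open>q \<noteq> 0\<close>] by simp
    ultimately show False using infinite_UNIV_char_0 finite_subset by blast
  qed
  then show ?thesis using f by simp
qed

lemma regular_at_0_so_rec:
  "(\<And>f. f \<in> set fs \<Longrightarrow> regular_at_0 f \<and> f 0 \<noteq> 0) \<Longrightarrow>
    regular_at_0 (\<lambda>t. so_rec a (map (\<lambda>f. f t) fs))"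
proof (induction fs arbitrary: a)
  case (Cons f fs)
  then show ?case
    by (auto simp: transfer_def intro!: regular_at_0_sum regular_at_0_mult regular_at_0_half_power)
qed (simp add: regular_at_0_const)

text \<open>The variables are moved along a line starting at \<open>xs\<close>. The difference of
  the two sides is rational in the parameter, regular at 0 because no variable is 0, and vanishes at
  the generic points, which are all but finitely many.\<close>

theorem so_rec_permute:
  fixes xs ys :: "'a::field_char_0 list"
  assumes "0 \<notin> set xs" "mset xs = mset ys" "so_tuple (length xs) a"
  shows "so_rec a xs = so_rec a ys"
proof -
  define n where "n = length xs"
  obtain p where p: "p permutes {..<length xs}" "permute_list p xs = ys"
    using mset_eq_permutation[OF assms(2)[symmetric]] by auto
  \<comment> \<open>In characteristic 0 the slopes \<open>Suc i\<close> are nonzero and pairwise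
    distinct even up to sign. This makes all polynomials that define the exceptional set
    \<open>B\<close> nonzero.\<close>
  define P where "P i = [:xs ! i, of_nat (Suc i):]" for i
  define fs where "fs = map (\<lambda>i. poly (P i)) [0..<n]"
  define gs where "gs = permute_list p fs"
  have fs0: "map (\<lambda>f. f 0) fs = xs"
    by (intro nth_equalityI) (auto simp: fs_def n_def P_def)
  have pn: "p permutes {..<length fs}" using p by (simp add: fs_def n_def)
  have gs: "map (\<lambda>f. f t) gs = permute_list p (map (\<lambda>f. f t) fs)" for t
    unfolding gs_def by (rule permute_list_map[OF pn, symmetric])
  have gs0: "map (\<lambda>f. f 0) gs = ys" by (simp add: gs fs0 p(2))
  have ms: "mset (map (\<lambda>f. f t) fs) = mset (map (\<lambda>f. f t) gs)" for t
    unfolding gs using mset_permute_list[of p "map (\<lambda>f. f t) fs"] pn by simp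
  have reg: "regular_at_0 f \<and> f 0 \<noteq> 0" if "f \<in> set fs" for f
  proof -
    have "f 0 \<in> set xs" using that by (subst fs0[symmetric]) auto
    then show ?thesis using that assms(1) by (auto simp: fs_def intro: regular_at_0_poly)
  qed
  have "set gs = set fs" unfolding gs_def by (rule set_permute_list[OF pn])
  then have "regular_at_0 (\<lambda>t. so_rec a (map (\<lambda>f. f t) fs) + (- 1) * so_rec a (map (\<lambda>f. f t) gs))"
    using reg by (intro regular_at_0_add regular_at_0_mult regular_at_0_const regular_at_0_so_rec) auto
  moreover have "finite {t. so_rec a (map (\<lambda>f. f t) fs) + (- 1) * so_rec a (map (\<lambda>f. f t) gs) \<noteq> 0}"
  proof (rule finite_subset)
    \<comment> \<open>For nonzero x and y, the equation x + 1/x = y + 1/y means (x - y) (x y - 1) =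
      0; the last two kinds of roots rule this out.\<close>
    define B where "B = (\<Union>i<n. {t. poly (P i) t = 0} \<union> {t. poly (P i ^ 4 - 1) t = 0}) \<union>
      (\<Union>i<n. \<Union>j\<in>{..<n} - {i}. {t. poly ((P i)\<^sup>2 - (P j)\<^sup>2) t = 0} \<union>
         {t. poly ((P i)\<^sup>2 * (P j)\<^sup>2 - 1) t = 0})"
    have deg: "degree (P i) = 1" and P0: "P i \<noteq> 0" for i
      by (simp_all add: P_def del: of_nat_Suc)
    have "P i ^ 4 - 1 \<noteq> 0" for i
    proof
      assume "P i ^ 4 - 1 = 0"
      then have "degree (P i ^ 4) = 0" by simp
      then show False using deg[of i] P0[of i] by (simp add: degree_power_eq)
    qed
    moreover have "(P i)\<^sup>2 * (P j)\<^sup>2 - 1 \<noteq> 0" for i j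
    proof
      assume "(P i)\<^sup>2 * (P j)\<^sup>2 - 1 = 0"
      then have "degree ((P i)\<^sup>2 * (P j)\<^sup>2) = 0" by simp
      then show False using deg P0 by (simp add: degree_mult_eq degree_power_eq)
    qed
    moreover have "(P i)\<^sup>2 - (P j)\<^sup>2 \<noteq> 0" if "i \<noteq> j" for i j
    proof
      assume "(P i)\<^sup>2 - (P j)\<^sup>2 = 0"
      then have "P i = P j \<or> P i = - P j" by (simp add: power2_eq_iff)
      then have "coeff (P i) 1 = coeff (P j) 1 \<or> coeff (P i) 1 = - coeff (P j) 1" by auto
      then have "(of_nat (Suc i) :: 'a) = of_nat (Suc j) \<or> (of_nat (Suc i) :: 'a) = - of_nat (Suc j)"
        by (simp add: P_def del: of_nat_Suc)
      then have "(of_nat (Suc i) :: 'a) = of_nat (Suc j) \<or> (of_nat (Suc i + Suc j) :: 'a) = 0"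
        unfolding of_nat_add eq_neg_iff_add_eq_0 .
      then show False using that by (simp only: of_nat_eq_iff of_nat_eq_0_iff) simp
    qed
    ultimately show "finite B"
      unfolding B_def using P0 by (intro finite_UnI finite_UN_I poly_roots_finite) auto
    show "{t. so_rec a (map (\<lambda>f. f t) fs) + (- 1) * so_rec a (map (\<lambda>f. f t) gs) \<noteq> 0} \<subseteq> B"
    proof (rule subsetI, rule ccontr)
      fix t assume t: "t \<in> {t. so_rec a (map (\<lambda>f. f t) fs) + (- 1) * so_rec a (map (\<lambda>f. f t) gs) \<noteq> 0}"
        and "t \<notin> B"
      then have nz: "poly (P i) t \<noteq> 0" "poly (P i) t ^ 4 \<noteq> 1" if "i < n" for i
        using that by (auto simp: B_def)
      have nz2: "(poly (P i) t)\<^sup>2 \<noteq> (poly (P j) t)\<^sup>2" "(poly (P i) t)\<^sup>2 * (poly (P j) t)\<^sup>2 \<noteq> 1"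
        if "i < n" "j < n" "i \<noteq> j" for i j
        using that \<open>t \<notin> B\<close> by (auto simp: B_def)
      have "generic (map (\<lambda>f. f t) fs)"
        unfolding generic_def
      proof
        show "\<forall>r\<in>set (map (\<lambda>f. f t) fs). r \<noteq> 0 \<and> r ^ 4 \<noteq> 1" using nz by (auto simp: fs_def)
        have "False" if ij: "i < n" "j < n" "i \<noteq> j"
          and eq: "(poly (P i) t)\<^sup>2 + 1 / (poly (P i) t)\<^sup>2 = (poly (P j) t)\<^sup>2 + 1 / (poly (P j) t)\<^sup>2" for i j
        proof -
          define x y where "x = (poly (P i) t)\<^sup>2" and "y = (poly (P j) t)\<^sup>2"
          have xy: "x \<noteq> 0" "y \<noteq> 0" "x \<noteq> y" "x * y \<noteq> 1"
            using nz nz2 ij by (auto simp: x_def y_def)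
          have "x + 1 / x = y + 1 / y" using eq by (simp add: x_def y_def)
          then have "(x - y) * (x * y - 1) = 0" using xy(1,2) by (simp add: field_simps)
          then show False using xy by simp
        qed
        then show "distinct (map (\<lambda>r. r\<^sup>2 + 1 / r\<^sup>2) (map (\<lambda>f. f t) fs))"
          by (auto simp: distinct_conv_nth fs_def)
      qed
      moreover have "so_tuple (length (map (\<lambda>f. f t) fs)) a" using assms(3) by (simp add: fs_def n_def)
      ultimately show False
        using so_rec_permute_generic[OF _ ms] t by fastforce
    qed
  qed
  ultimately have "so_rec a (map (\<lambda>f. f 0) fs) + (- 1) * so_rec a (map (\<lambda>f. f 0) gs) = 0"
    by (rule regular_at_0_eq_0)
  then show ?thesis by (simp add: fs0 gs0)
qed

section \<open>Orthogonal patterns as chains of rows\<close>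

definition patterns :: "nat \<Rightarrow> rat list \<Rightarrow> (nat \<Rightarrow> nat \<Rightarrow> rat) set" where
  "patterns M \<nu> = {z. orthogonal_pattern M z \<and> pattern_shape M z = \<nu>}"

text \<open>The conditions that a row of a pattern satisfies by itself. Lists count from 0, so
  position j is column j + 1, and the odd end of row \<open>M\<close> is the position with
  \<open>M = 2 * j + 1\<close>.\<close>

definition valid_row :: "nat \<Rightarrow> rat list \<Rightarrow> bool" where
  "valid_row M \<nu> \<longleftrightarrow> length \<nu> = row_length M \<and>
     ((\<forall>j<row_length M. \<nu> ! j \<in> \<int>) \<or> (\<forall>j<row_length M. \<nu> ! j \<in> half_integers)) \<and>
     (\<forall>j<row_length M. M \<noteq> 2 * j + 1 \<longrightarrow> 0 \<le> \<nu> ! j)"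

definition rows_under :: "nat \<Rightarrow> rat list \<Rightarrow> rat list set" where
  "rows_under M \<nu> = {\<mu>. length \<mu> = row_length M \<and> (\<forall>j<row_length M. \<mu> ! j - \<nu> ! 0 \<in> \<int> \<and>
     (M \<noteq> 2 * j + 1 \<longrightarrow> 0 \<le> \<mu> ! j) \<and> \<bar>\<mu> ! j\<bar> \<le> \<bar>\<nu> ! j\<bar> \<and>
     (Suc j < row_length (Suc M) \<longrightarrow> \<bar>\<nu> ! Suc j\<bar> \<le> \<bar>\<mu> ! j\<bar>))}"

definition add_row :: "nat \<Rightarrow> rat list \<Rightarrow> (nat \<Rightarrow> nat \<Rightarrow> rat) \<Rightarrow> nat \<Rightarrow> nat \<Rightarrow> rat" where
  "add_row M \<nu> z = (\<lambda>i j. if i = Suc M then (if 1 \<le> j \<and> j \<le> length \<nu> then \<nu> ! (j - 1) else 0) else z i j)"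

lemma row_length_Suc: "row_length M \<le> row_length (Suc M)" "row_length (Suc M) \<le> Suc (row_length M)"
  by (auto simp: row_length_def)

lemma row_length_pos: "0 < M \<Longrightarrow> 0 < row_length M"
  by (auto simp: row_length_def)

lemma Ints_half_integers_cong:
  assumes "a - b \<in> \<int>"
  shows "a \<in> \<int> \<longleftrightarrow> b \<in> \<int>" "a \<in> half_integers \<longleftrightarrow> b \<in> half_integers"
proof -
  have s: "x \<in> \<int> \<longleftrightarrow> y \<in> \<int>" if "x - y \<in> \<int>" for x y :: rat
    using Ints_add[of "x - y" y] Ints_diff[of x "x - y"] that by auto
  show "a \<in> \<int> \<longleftrightarrow> b \<in> \<int>" using assms by (rule s)
  show "a \<in> half_integers \<longleftrightarrow> b \<in> half_integers"
    unfolding half_integers_def mem_Collect_eq using assms by (intro s) simp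
qed

lemma half_not_Int: "(1 / 2 :: rat) \<notin> \<int>"
proof
  assume "(1 / 2 :: rat) \<in> \<int>"
  then obtain i where "(1 / 2 :: rat) = of_int i" by (auto elim: Ints_cases)
  then have "of_int (2 * i) = (of_int 1 :: rat)" by simp
  then have "2 * i = 1" by (simp only: of_int_eq_iff)
  then show False by presburger
qed

lemma Ints_half_integers_disjoint: "a \<in> \<int> \<Longrightarrow> a \<notin> half_integers"
  unfolding half_integers_def using Ints_diff[of a "a - 1 / 2"] half_not_Int by auto

lemma half_integers_diff: "a \<in> half_integers \<Longrightarrow> b \<in> half_integers \<Longrightarrow> a - b \<in> \<int>"
  unfolding half_integers_def using Ints_diff[of "a - 1 / 2" "b - 1 / 2"] by simp

lemma double_Ints_cases:
  assumes "2 * a \<in> (\<int> :: rat set)"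
  shows "a \<in> \<int> \<or> a \<in> half_integers"
proof -
  obtain i where i: "2 * a = of_int i" using assms by (auto elim: Ints_cases)
  show ?thesis
  proof (cases "even i")
    case True
    then obtain j where "i = 2 * j" by auto
    then have "a = of_int j" using i by simp
    then show ?thesis by simp
  next
    case False
    then obtain j where "i = 2 * j + 1" by (auto elim: oddE)
    then have "a - 1 / 2 = of_int j" using i by (simp add: field_simps)
    then show ?thesis by (simp add: half_integers_def)
  qed
qed

lemma double_half_integers: "a \<in> half_integers \<Longrightarrow> 2 * a \<in> \<int>"
proof -
  assume "a \<in> half_integers"
  then have "of_int 2 * (a - 1 / 2) + 1 \<in> \<int>"
    unfolding half_integers_def by (intro Ints_add Ints_mult Ints_of_int Ints_1) simp
  then show ?thesis by (simp add: algebra_simps)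
qed

lemma pattern_shape_nth: "j < row_length M \<Longrightarrow> pattern_shape M z ! j = z M (Suc j)"
  by (simp add: pattern_shape_def del: upt_Suc)

lemma length_pattern_shape: "length (pattern_shape M z) = row_length M"
  by (simp add: pattern_shape_def)

lemma pattern_index_iff:
  "(i, j) \<in> pattern_index M \<longleftrightarrow> 1 \<le> i \<and> i \<le> M \<and> 1 \<le> j \<and> j \<le> row_length i"
  by (simp add: pattern_index_def)

lemma patternsD:
  assumes "z \<in> patterns M \<mu>"
  shows "\<And>i j. (i, j) \<notin> pattern_index M \<Longrightarrow> z i j = 0"
    "(\<forall>i j. (i, j) \<in> pattern_index M \<longrightarrow> z i j \<in> \<int>) \<or> (\<forall>i j. (i, j) \<in> pattern_index M \<longrightarrow> z i j \<in> half_integers)"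
    "\<And>i j. (i, j) \<in> pattern_index M \<Longrightarrow> i \<noteq> 2 * j - 1 \<Longrightarrow> 0 \<le> z i j"
    "\<And>i j. (i, j) \<in> pattern_index M \<Longrightarrow> (i + 1, j + 1) \<in> pattern_index M \<Longrightarrow> \<bar>z (i + 1) (j + 1)\<bar> \<le> \<bar>z i j\<bar>"
    "\<And>i j. (i, j) \<in> pattern_index M \<Longrightarrow> (i + 1, j) \<in> pattern_index M \<Longrightarrow> \<bar>z i j\<bar> \<le> \<bar>z (i + 1) j\<bar>"
    "length \<mu> = row_length M" "\<And>j. j < row_length M \<Longrightarrow> z M (Suc j) = \<mu> ! j"
proof -
  have o: "orthogonal_pattern M z" and sh: "pattern_shape M z = \<mu>"
    using assms by (auto simp: patterns_def)
  note o = o[unfolded orthogonal_pattern_def]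
  show "z i j = 0" if "(i, j) \<notin> pattern_index M" for i j using o that by blast
  show "(\<forall>i j. (i, j) \<in> pattern_index M \<longrightarrow> z i j \<in> \<int>) \<or>
      (\<forall>i j. (i, j) \<in> pattern_index M \<longrightarrow> z i j \<in> half_integers)"
    using o by blast
  show "0 \<le> z i j" if "(i, j) \<in> pattern_index M" "i \<noteq> 2 * j - 1" for i j using o that by blast
  show "\<bar>z (i + 1) (j + 1)\<bar> \<le> \<bar>z i j\<bar>"
    if "(i, j) \<in> pattern_index M" "(i + 1, j + 1) \<in> pattern_index M" for i j
    using o that by blast
  show "\<bar>z i j\<bar> \<le> \<bar>z (i + 1) j\<bar>"
    if "(i, j) \<in> pattern_index M" "(i + 1, j) \<in> pattern_index M" for i j
    using o that by blast
  show "length \<mu> = row_length M" using sh length_pattern_shape by blast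
  show "z M (Suc j) = \<mu> ! j" if "j < row_length M" for j
    using that by (simp add: sh[symmetric] pattern_shape_nth)
qed

lemma patternsI:
  assumes "\<And>i j. (i, j) \<notin> pattern_index M \<Longrightarrow> z i j = 0"
    "(\<forall>i j. (i, j) \<in> pattern_index M \<longrightarrow> z i j \<in> \<int>) \<or> (\<forall>i j. (i, j) \<in> pattern_index M \<longrightarrow> z i j \<in> half_integers)"
    "\<And>i j. (i, j) \<in> pattern_index M \<Longrightarrow> i \<noteq> 2 * j - 1 \<Longrightarrow> 0 \<le> z i j"
    "\<And>i j. (i, j) \<in> pattern_index M \<Longrightarrow> (i + 1, j + 1) \<in> pattern_index M \<Longrightarrow> \<bar>z (i + 1) (j + 1)\<bar> \<le> \<bar>z i j\<bar>"
    "\<And>i j. (i, j) \<in> pattern_index M \<Longrightarrow> (i + 1, j) \<in> pattern_index M \<Longrightarrow> \<bar>z i j\<bar> \<le> \<bar>z (i + 1) j\<bar>"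
    "length \<mu> = row_length M" "\<And>j. j < row_length M \<Longrightarrow> z M (Suc j) = \<mu> ! j"
  shows "z \<in> patterns M \<mu>"
proof -
  have "pattern_shape M z = \<mu>"
    using assms(6,7) by (intro nth_equalityI) (simp_all add: pattern_shape_nth length_pattern_shape)
  moreover have "orthogonal_pattern M z"
    unfolding orthogonal_pattern_def using assms(1-5) by (auto simp: split_beta)
  ultimately show ?thesis by (simp add: patterns_def)
qed

lemma add_row_in_patterns:
  assumes \<nu>: "valid_row (Suc M) \<nu>" and \<mu>: "\<mu> \<in> rows_under M \<nu>" and z: "z \<in> patterns M \<mu>"
  shows "add_row M \<nu> z \<in> patterns (Suc M) \<nu>"
proof (rule patternsI)
  note D = patternsD[OF z]
  have len: "length \<nu> = row_length (Suc M)" using \<nu> by (simp add: valid_row_def)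
  have top: "add_row M \<nu> z (Suc M) j = \<nu> ! (j - 1)" if "1 \<le> j" "j \<le> row_length (Suc M)" for j
    using that by (simp add: add_row_def len)
  have low: "add_row M \<nu> z i j = z i j" if "i \<le> M" for i j
    using that by (simp add: add_row_def)
  have zM: "z M j = \<mu> ! (j - 1)" if "1 \<le> j" "j \<le> row_length M" for j
    using D(7)[of "j - 1"] that by simp
  have U: "\<mu> ! j - \<nu> ! 0 \<in> \<int>" "M \<noteq> 2 * j + 1 \<Longrightarrow> 0 \<le> \<mu> ! j" "\<bar>\<mu> ! j\<bar> \<le> \<bar>\<nu> ! j\<bar>"
    "Suc j < row_length (Suc M) \<Longrightarrow> \<bar>\<nu> ! Suc j\<bar> \<le> \<bar>\<mu> ! j\<bar>" if "j < row_length M" for j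
    using \<mu> that by (auto simp: rows_under_def)
  show "length \<nu> = row_length (Suc M)" by (rule len)
  show "add_row M \<nu> z (Suc M) (Suc j) = \<nu> ! j" if "j < row_length (Suc M)" for j
    using that by (simp add: top)
  show "add_row M \<nu> z i j = 0" if "(i, j) \<notin> pattern_index (Suc M)" for i j
    using that D(1)[of i j] by (auto simp: add_row_def len pattern_index_iff)
  have split: "(i, j) \<in> pattern_index (Suc M) \<longleftrightarrow> (i, j) \<in> pattern_index M \<or>
      i = Suc M \<and> 1 \<le> j \<and> j \<le> row_length (Suc M)" for i j
    by (auto simp: pattern_index_iff le_Suc_eq)
  have idx: "(i, j) \<in> pattern_index M \<Longrightarrow> i \<le> M" for i j by (simp add: pattern_index_iff)
  have nu0: "0 < row_length (Suc M)" by (rule row_length_pos) simp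
  show "(\<forall>i j. (i, j) \<in> pattern_index (Suc M) \<longrightarrow> add_row M \<nu> z i j \<in> \<int>) \<or>
      (\<forall>i j. (i, j) \<in> pattern_index (Suc M) \<longrightarrow> add_row M \<nu> z i j \<in> half_integers)"
  proof -
    \<comment> \<open>The entry \<open>z M 1\<close> passes the class of the new row on to the old
      ones; it exists unless \<open>M = 0\<close>, where there is nothing to show.\<close>
    have "\<nu> ! 0 \<in> \<int> \<longrightarrow> (\<forall>i j. (i, j) \<in> pattern_index M \<longrightarrow> z i j \<in> \<int>)"
      "\<nu> ! 0 \<in> half_integers \<longrightarrow> (\<forall>i j. (i, j) \<in> pattern_index M \<longrightarrow> z i j \<in> half_integers)"
    proof (atomize (full), cases "M = 0")
      case False
      then have M: "(M, 1) \<in> pattern_index M" "0 < row_length M"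
        using row_length_pos[of M] by (auto simp: pattern_index_iff)
      then have "z M 1 - \<nu> ! 0 \<in> \<int>" using U(1)[of 0] zM[of 1] by simp
      note c = Ints_half_integers_cong[OF this]
      show "(\<nu> ! 0 \<in> \<int> \<longrightarrow> (\<forall>i j. (i, j) \<in> pattern_index M \<longrightarrow> z i j \<in> \<int>)) \<and>
        (\<nu> ! 0 \<in> half_integers \<longrightarrow> (\<forall>i j. (i, j) \<in> pattern_index M \<longrightarrow> z i j \<in> half_integers))"
        using D(2) c M(1) Ints_half_integers_disjoint by metis
    qed (simp add: pattern_index_def)
    moreover have "(\<forall>j. 1 \<le> j \<and> j \<le> row_length (Suc M) \<longrightarrow> \<nu> ! (j - 1) \<in> \<int>) \<and> \<nu> ! 0 \<in> \<int> \<or>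
       (\<forall>j. 1 \<le> j \<and> j \<le> row_length (Suc M) \<longrightarrow> \<nu> ! (j - 1) \<in> half_integers) \<and> \<nu> ! 0 \<in> half_integers"
      using \<nu> nu0 unfolding valid_row_def by (auto simp: less_eq_Suc_le)
    ultimately show ?thesis
    proof (elim disjE, goal_cases)
      case 1
      then have "add_row M \<nu> z i j \<in> \<int>" if "(i, j) \<in> pattern_index (Suc M)" for i j
        using that low[OF idx, of i j] top[of j] unfolding split by auto
      then show ?thesis by blast
    next
      case 2
      then have "add_row M \<nu> z i j \<in> half_integers" if "(i, j) \<in> pattern_index (Suc M)" for i j
        using that low[OF idx, of i j] top[of j] unfolding split by auto
      then show ?thesis by blast
    qed
  qed
  show "0 \<le> add_row M \<nu> z i j" if "(i, j) \<in> pattern_index (Suc M)" "i \<noteq> 2 * j - 1" for i j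
  proof (cases "(i, j) \<in> pattern_index M")
    case True
    then show ?thesis using D(3)[OF True that(2)] low[OF idx[OF True]] by simp
  next
    case False
    then have i: "i = Suc M" "1 \<le> j" "j \<le> row_length (Suc M)" using that split by auto
    then have "Suc M \<noteq> 2 * (j - 1) + 1" using that by auto
    moreover have "j - 1 < row_length (Suc M)" using i by auto
    ultimately show ?thesis using \<nu> i unfolding valid_row_def by (simp add: top)
  qed
  show "\<bar>add_row M \<nu> z (i + 1) (j + 1)\<bar> \<le> \<bar>add_row M \<nu> z i j\<bar>"
    if "(i, j) \<in> pattern_index (Suc M)" "(i + 1, j + 1) \<in> pattern_index (Suc M)" for i j
  proof (cases "i < M")
    case True
    then have "(i, j) \<in> pattern_index M" "(i + 1, j + 1) \<in> pattern_index M"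
      using that by (auto simp: pattern_index_iff)
    from D(4)[OF this] show ?thesis using True by (simp add: low)
  next
    case False
    then have i: "i = M" "1 \<le> j" "j \<le> row_length M" "j + 1 \<le> row_length (Suc M)"
      using that by (auto simp: pattern_index_iff)
    then have "\<bar>\<nu> ! Suc (j - 1)\<bar> \<le> \<bar>\<mu> ! (j - 1)\<bar>" by (intro U(4)) auto
    then show ?thesis using i zM[of j] top[of "j + 1"] by (simp add: low)
  qed
  show "\<bar>add_row M \<nu> z i j\<bar> \<le> \<bar>add_row M \<nu> z (i + 1) j\<bar>"
    if "(i, j) \<in> pattern_index (Suc M)" "(i + 1, j) \<in> pattern_index (Suc M)" for i j
  proof (cases "i < M")
    case True
    then have "(i, j) \<in> pattern_index M" "(i + 1, j) \<in> pattern_index M"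
      using that by (auto simp: pattern_index_iff)
    from D(5)[OF this] show ?thesis using True by (simp add: low)
  next
    case False
    then have i: "i = M" "1 \<le> j" "j \<le> row_length M" "j \<le> row_length (Suc M)"
      using that by (auto simp: pattern_index_iff)
    then have "\<bar>\<mu> ! (j - 1)\<bar> \<le> \<bar>\<nu> ! (j - 1)\<bar>" by (intro U(3)) auto
    then show ?thesis using i zM[of j] top[of j] by (simp add: low)
  qed
qed

definition del_row :: "nat \<Rightarrow> (nat \<Rightarrow> nat \<Rightarrow> rat) \<Rightarrow> nat \<Rightarrow> nat \<Rightarrow> rat" where
  "del_row M z = (\<lambda>i j. if i \<le> M then z i j else 0)"

lemma del_row_in_patterns:
  assumes z: "z \<in> patterns (Suc M) \<nu>"
  shows "del_row M z \<in> patterns M (pattern_shape M z)" "pattern_shape M z \<in> rows_under M \<nu>"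
    "add_row M \<nu> (del_row M z) = z"
proof -
  note D = patternsD[OF z]
  have idx: "(i, j) \<in> pattern_index M \<Longrightarrow> (i, j) \<in> pattern_index (Suc M) \<and> i \<le> M" for i j
    by (simp add: pattern_index_iff)
  have low: "del_row M z i j = z i j" if "i \<le> M" for i j using that by (simp add: del_row_def)
  show "del_row M z \<in> patterns M (pattern_shape M z)"
  proof (rule patternsI)
    show "del_row M z i j = 0" if "(i, j) \<notin> pattern_index M" for i j
      using that D(1)[of i j] by (auto simp: del_row_def pattern_index_iff)
    show "(\<forall>i j. (i, j) \<in> pattern_index M \<longrightarrow> del_row M z i j \<in> \<int>) \<or>
        (\<forall>i j. (i, j) \<in> pattern_index M \<longrightarrow> del_row M z i j \<in> half_integers)"
      using D(2) idx low by metis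
    show "0 \<le> del_row M z i j" if "(i, j) \<in> pattern_index M" "i \<noteq> 2 * j - 1" for i j
      using D(3)[OF _ that(2)] idx[OF that(1)] by (simp add: low)
    show "\<bar>del_row M z (i + 1) (j + 1)\<bar> \<le> \<bar>del_row M z i j\<bar>"
      if "(i, j) \<in> pattern_index M" "(i + 1, j + 1) \<in> pattern_index M" for i j
      using D(4)[of i j] idx[OF that(1)] idx[OF that(2)] by (simp add: low)
    show "\<bar>del_row M z i j\<bar> \<le> \<bar>del_row M z (i + 1) j\<bar>"
      if "(i, j) \<in> pattern_index M" "(i + 1, j) \<in> pattern_index M" for i j
      using D(5)[of i j] idx[OF that(1)] idx[OF that(2)] by (simp add: low)
  qed (simp_all add: length_pattern_shape pattern_shape_nth low)
  show "add_row M \<nu> (del_row M z) = z"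
  proof (intro ext)
    fix i j
    show "add_row M \<nu> (del_row M z) i j = z i j"
    proof (cases "i = Suc M \<and> 1 \<le> j \<and> j \<le> length \<nu>")
      case True
      then show ?thesis using D(6) D(7)[of "j - 1"] by (cases j) (simp_all add: add_row_def)
    next
      case False
      then show ?thesis using D(1)[of i j] D(6)
        by (auto simp: add_row_def del_row_def pattern_index_iff)
    qed
  qed
  show "pattern_shape M z \<in> rows_under M \<nu>"
    unfolding rows_under_def mem_Collect_eq length_pattern_shape
  proof (intro conjI allI impI)
    fix j assume j: "j < row_length M"
    then have "M \<noteq> 0" by (auto simp: row_length_def)
    then have in0: "(M, Suc j) \<in> pattern_index (Suc M)" "(Suc M, Suc j) \<in> pattern_index (Suc M)"
      "(Suc M, Suc 0) \<in> pattern_index (Suc M)"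
      using j row_length_Suc[of M] by (auto simp: pattern_index_iff)
    have nu: "z (Suc M) (Suc i) = \<nu> ! i" if "i < row_length (Suc M)" for i using D(7) that by simp
    have j': "j < row_length (Suc M)" using j row_length_Suc[of M] by linarith
    then have 0: "0 < row_length (Suc M)" by linarith
    have "z M (Suc j) - z (Suc M) (Suc 0) \<in> \<int>"
      using D(2) in0 half_integers_diff Ints_diff by blast
    then show "pattern_shape M z ! j - \<nu> ! 0 \<in> \<int>" using j nu[OF 0] by (simp add: pattern_shape_nth)
    show "0 \<le> pattern_shape M z ! j" if "M \<noteq> 2 * j + 1"
      using D(3)[OF in0(1)] that j by (simp add: pattern_shape_nth)
    show "\<bar>pattern_shape M z ! j\<bar> \<le> \<bar>\<nu> ! j\<bar>"
      using D(5)[OF in0(1)] in0(2) j nu[OF j'] by (simp add: pattern_shape_nth)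
    show "\<bar>\<nu> ! Suc j\<bar> \<le> \<bar>pattern_shape M z ! j\<bar>" if "Suc j < row_length (Suc M)"
    proof -
      have "(M + 1, Suc j + 1) \<in> pattern_index (Suc M)" using that by (simp add: pattern_index_iff)
      from D(4)[OF in0(1) this] show ?thesis using j nu[OF that] by (simp add: pattern_shape_nth)
    qed
  qed simp
qed

lemma finite_rows_under: "finite (rows_under M \<nu>)"
proof (rule finite_subset)
  show "rows_under M \<nu> \<subseteq> box (row_length M) (\<lambda>j. zrange (\<nu> ! 0) (- \<bar>\<nu> ! j\<bar>) \<bar>\<nu> ! j\<bar>)"
    unfolding rows_under_def box_def zrange_def by (auto simp: abs_le_iff minus_le_iff)
qed (simp add: finite_box)

text \<open>A pattern of the given shape amounts to its second row from the top together with the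
  pattern that remains when the top row is removed; \<open>add_row\<close> and
  \<open>del_row\<close> are inverse to each other.\<close>

lemma sum_patterns_Suc:
  assumes "valid_row (Suc M) \<nu>"
  shows "(\<Sum>z\<in>patterns (Suc M) \<nu>. f z) =
    (\<Sum>\<mu>\<in>rows_under M \<nu>. \<Sum>z\<in>patterns M \<mu>. f (add_row M \<nu> z))"
proof -
  have fin: "\<forall>\<mu>\<in>rows_under M \<nu>. finite (patterns M \<mu>)"
    by (simp add: patterns_def finite_patterns)
  have del_add: "del_row M (add_row M \<nu> z) = z" and shape: "pattern_shape M (add_row M \<nu> z) = \<mu>"
    if "z \<in> patterns M \<mu>" for z \<mu>
  proof -
    note D = patternsD[OF that]
    show "del_row M (add_row M \<nu> z) = z"
      using D(1) by (auto simp: fun_eq_iff del_row_def add_row_def pattern_index_iff)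
    show "pattern_shape M (add_row M \<nu> z) = \<mu>"
      using D(6,7) by (intro nth_equalityI) (simp_all add: length_pattern_shape pattern_shape_nth add_row_def)
  qed
  have "(\<Sum>z\<in>patterns (Suc M) \<nu>. f z) =
      (\<Sum>p\<in>Sigma (rows_under M \<nu>) (patterns M). f (add_row M \<nu> (snd p)))"
    by (rule sum.reindex_bij_witness[of _ "\<lambda>p. add_row M \<nu> (snd p)" "\<lambda>z. (pattern_shape M z, del_row M z)"])
       (auto simp: del_row_in_patterns del_add shape intro: add_row_in_patterns[OF assms])
  also have "\<dots> = (\<Sum>\<mu>\<in>rows_under M \<nu>. \<Sum>z\<in>patterns M \<mu>. f (add_row M \<nu> z))"
    using sum.Sigma[OF finite_rows_under fin, of "\<lambda>_ z. f (add_row M \<nu> z)"] by (simp add: split_beta)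
  finally show ?thesis .
qed

section \<open>The branching rule\<close>

lemma row_length_double: "row_length (2 * k) = k" "row_length (Suc (2 * k)) = Suc k"
  by (simp_all add: row_length_def)

lemma so_char_eq: "so_char N \<nu> r = (\<Sum>z\<in>patterns (N - 1) \<nu>. weight (N div 2) z r)"
  by (simp add: so_char_def patterns_def)

lemma so_tuple_class:
  assumes "so_tuple k a"
  shows "(\<forall>j<k. a ! j \<in> \<int>) \<or> (\<forall>j<k. a ! j \<in> half_integers)"
proof (cases "k = 0")
  case False
  then have "a ! 0 \<in> \<int> \<or> a ! 0 \<in> half_integers"
    using assms by (intro double_Ints_cases) (auto simp: so_tuple_def)
  moreover have "a ! j - a ! 0 \<in> \<int>" if "j < k" for j
    using assms that by (auto simp: so_tuple_def)
  ultimately show ?thesis using Ints_half_integers_cong by blast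
qed simp

lemma valid_row_so_tuple:
  assumes "so_tuple (Suc k) a"
  shows "valid_row (Suc (2 * k)) a"
  using so_tuple_class[OF assms] so_tuple_nth_nonneg[OF assms] assms
  unfolding valid_row_def row_length_double so_tuple_def less_Suc_eq by auto

lemma valid_row_under:
  assumes c: "c \<in> rows_under M a" and a: "valid_row (Suc M) a"
  shows "valid_row M c"
proof -
  have "c ! j \<in> \<int> \<longleftrightarrow> a ! 0 \<in> \<int>" "c ! j \<in> half_integers \<longleftrightarrow> a ! 0 \<in> half_integers" if "j < row_length M" for j
    using c that by (auto simp: rows_under_def intro!: Ints_half_integers_cong)
  moreover have "a ! 0 \<in> \<int> \<or> a ! 0 \<in> half_integers"
    using a row_length_pos[of "Suc M"] by (auto simp: valid_row_def)
  ultimately show ?thesis using c by (auto simp: valid_row_def rows_under_def)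
qed

text \<open>Removing two rows visits \<open>c\<close> before \<open>b\<close>, whereas the kernel
  takes \<open>b\<close> as the outer variable. Its range is independent of \<open>c\<close> because
  \<open>\<bar>b ! j\<bar> \<le> c ! j \<le> \<bar>a ! j\<bar> \<le> a ! 0\<close>.\<close>

lemma rows_under_under_iff:
  assumes a: "so_tuple (Suc k) a" and k: "k = Suc k'"
  shows "c \<in> rows_under (2 * k) a \<and> b \<in> rows_under (Suc (2 * k')) c \<longleftrightarrow>
    b \<in> so_tuples_in k (a ! 0) \<and> c \<in> mid_rows a b"
proof -
  have k2: "2 * k = Suc (Suc (2 * k'))" using k by simp
  have h: "2 * a ! 0 \<in> \<int>" using a by (simp add: so_tuple_def)
  have par: "2 * k \<noteq> 2 * j + 1" for j by presburger
  have rl: "row_length (Suc (Suc (2 * k'))) = k" "row_length (Suc (2 * k')) = k"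
    using row_length_double[of k] row_length_double[of k'] unfolding k2 by (simp_all add: k)
  show ?thesis
  proof (intro iffI conjI)
    assume *: "c \<in> rows_under (2 * k) a \<and> b \<in> rows_under (Suc (2 * k')) c"
    have c: "length c = k" "\<And>j. j < k \<Longrightarrow> c ! j - a ! 0 \<in> \<int> \<and> 0 \<le> c ! j \<and> c ! j \<le> \<bar>a ! j\<bar> \<and> \<bar>a ! Suc j\<bar> \<le> c ! j"
      using * par unfolding rows_under_def row_length_double by force+
    have b: "length b = k" "\<And>j. j < k \<Longrightarrow> b ! j - c ! 0 \<in> \<int> \<and> (j \<noteq> k' \<longrightarrow> 0 \<le> b ! j) \<and> \<bar>b ! j\<bar> \<le> c ! j \<and>
        (Suc j < k \<longrightarrow> c ! Suc j \<le> \<bar>b ! j\<bar>)"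
    proof -
      show "length b = k" using * by (simp add: rows_under_def rl)
      fix j assume j: "j < k"
      have "b ! j - c ! 0 \<in> \<int> \<and> (Suc (2 * k') \<noteq> 2 * j + 1 \<longrightarrow> 0 \<le> b ! j) \<and> \<bar>b ! j\<bar> \<le> \<bar>c ! j\<bar> \<and>
        (Suc j < k \<longrightarrow> \<bar>c ! Suc j\<bar> \<le> \<bar>b ! j\<bar>)"
        using * j unfolding rows_under_def rl by blast
      then show "b ! j - c ! 0 \<in> \<int> \<and> (j \<noteq> k' \<longrightarrow> 0 \<le> b ! j) \<and> \<bar>b ! j\<bar> \<le> c ! j \<and>
        (Suc j < k \<longrightarrow> c ! Suc j \<le> \<bar>b ! j\<bar>)" using c(2)[OF j] by auto
    qed
    have bh: "b ! j - a ! 0 \<in> \<int>" if "j < k" for j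
      using Ints_add[of "b ! j - c ! 0" "c ! 0 - a ! 0"] b(2)[OF that] c(2)[of 0] k by simp
    show "b \<in> so_tuples_in k (a ! 0)"
      unfolding so_tuples_in_def so_tuple_def mem_Collect_eq
    proof (intro conjI allI impI)
      fix j assume j: "j < k"
      show "b ! j - a ! 0 \<in> \<int>" by (rule bh[OF j])
      show "2 * b ! j \<in> \<int>" by (rule Ints_double_cong[OF h bh[OF j]])
      show "b ! j - b ! 0 \<in> \<int>" using k by (intro Ints_minus_cong[OF bh[OF j] bh]) simp
      have "\<bar>a ! j\<bar> \<le> \<bar>a ! 0\<bar>" using so_tuple_nth_mono(2)[OF a, of 0 j] j by simp
      then have "\<bar>b ! j\<bar> \<le> \<bar>a ! 0\<bar>" using b(2)[OF j] c(2)[OF j] by linarith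
      then show "\<bar>b ! j\<bar> \<le> a ! 0" using so_tuple_nth_nonneg[OF a, of 0] k by simp
    next
      fix j assume j: "Suc j < k"
      then show "\<bar>b ! Suc j\<bar> \<le> b ! j" using b(2)[of j] b(2)[of "Suc j"] k by auto
    qed (rule b)
    show "c \<in> mid_rows a b"
      using b c unfolding mid_rows_def by auto
  next
    assume *: "b \<in> so_tuples_in k (a ! 0) \<and> c \<in> mid_rows a b"
    have b: "length b = k" "\<And>j. j < k \<Longrightarrow> b ! j - a ! 0 \<in> \<int>" "\<And>j. Suc j < k \<Longrightarrow> \<bar>b ! Suc j\<bar> \<le> b ! j"
      using * by (auto simp: so_tuples_in_def so_tuple_def)
    have c: "length c = k" "\<And>j. j < k \<Longrightarrow> c ! j - a ! 0 \<in> \<int> \<and> \<bar>a ! Suc j\<bar> \<le> c ! j \<and> c ! j \<le> \<bar>a ! j\<bar> \<and>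
      \<bar>b ! j\<bar> \<le> c ! j \<and> (Suc j < k \<longrightarrow> c ! Suc j \<le> \<bar>b ! j\<bar>)"
      using * b(1) by (auto simp: mid_rows_def)
    have cpos: "0 \<le> c ! j" if "j < k" for j using c(2)[OF that] by linarith
    show "c \<in> rows_under (2 * k) a"
      unfolding rows_under_def row_length_double mem_Collect_eq
    proof (intro conjI allI impI)
      fix j assume j: "j < k"
      show "c ! j - a ! 0 \<in> \<int>" "\<bar>c ! j\<bar> \<le> \<bar>a ! j\<bar>" "\<bar>a ! Suc j\<bar> \<le> \<bar>c ! j\<bar>" "0 \<le> c ! j"
        using c(2)[OF j] cpos[OF j] by linarith+
    qed (rule c)
    show "b \<in> rows_under (Suc (2 * k')) c"
      unfolding rows_under_def rl mem_Collect_eq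
    proof (intro conjI allI impI)
      fix j assume j: "j < k"
      show "b ! j - c ! 0 \<in> \<int>"
      proof (rule Ints_minus_cong[OF b(2)[OF j]])
        have "0 < k" using k by simp
        then show "c ! 0 - a ! 0 \<in> \<int>" using c(2) by blast
      qed
      show "0 \<le> b ! j" if "Suc (2 * k') \<noteq> 2 * j + 1"
      proof -
        have "Suc j < k" using that j k by auto
        then show ?thesis using b(3)[of j] by linarith
      qed
      show "\<bar>b ! j\<bar> \<le> \<bar>c ! j\<bar>" using c(2)[OF j] by auto
      show "\<bar>c ! Suc j\<bar> \<le> \<bar>b ! j\<bar>" if "Suc j < k" using c(2)[OF j] cpos[OF that] that by auto
    qed (rule b)
  qed
qed

lemma pattern_type_cong:
  "(\<And>j. z i j = z' i j) \<Longrightarrow> (\<And>j. z (i - 1) j = z' (i - 1) j) \<Longrightarrow> pattern_type z i = pattern_type z' i"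
  by (simp add: pattern_type_def)

lemma weight_cong:
  assumes "\<And>i j. i \<le> 2 * n - 1 \<Longrightarrow> z i j = z' i j" "\<And>i. i < n \<Longrightarrow> r ! i = r' ! i" "1 \<le> n"
  shows "weight n z r = weight n z' r'"
proof -
  have "half_power (r ! (i - 1)) (Defs.sign (z (2*i - 3) (i - 1)) * Defs.sign (z (2*i - 1) i) *
           (pattern_type z (2*i - 1) - pattern_type z (2*i - 2))) =
    half_power (r' ! (i - 1)) (Defs.sign (z' (2*i - 3) (i - 1)) * Defs.sign (z' (2*i - 1) i) *
           (pattern_type z' (2*i - 1) - pattern_type z' (2*i - 2)))" if "i \<in> {2..n}" for i
  proof -
    have i: "2 \<le> i" "i \<le> n" using that by auto
    have "z (2*i - 3) = z' (2*i - 3)" "z (2*i - 1) = z' (2*i - 1)"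
      using i by (auto intro!: ext assms(1))
    moreover have "pattern_type z (2*i - 1) = pattern_type z' (2*i - 1)"
      "pattern_type z (2*i - 2) = pattern_type z' (2*i - 2)"
      using i by (auto intro!: pattern_type_cong assms(1))
    moreover have "r ! (i - 1) = r' ! (i - 1)" using i by (intro assms(2)) auto
    ultimately show ?thesis by simp
  qed
  moreover have "half_power (r ! 0) (z 1 1) = half_power (r' ! 0) (z' 1 1)"
    using assms(1)[of 1 1] assms(2)[of 0] assms(3) by simp
  ultimately show ?thesis
    unfolding weight_def by (simp only: cong: prod.cong)
qed

text \<open>Only the factor \<open>i = Suc k\<close> of the weight involves the two new rows, and it
  is a summand of \<open>transfer a b q\<close>.\<close>

lemma weight_add_rows:
  assumes k: "k = Suc k'" and z: "z \<in> patterns (Suc (2 * k')) b" and "length c = k" "length a = Suc k" "length r = k"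
    and c: "\<And>j. j < k \<Longrightarrow> 0 \<le> c ! j"
  shows "weight (Suc k) (add_row (2 * k) a (add_row (Suc (2 * k')) c z)) (r @ [q]) =
    weight k z r * half_power q (end_sign a * end_sign b * (abs_sum a - 2 * entry_sum c + abs_sum b))"
proof -
  define Z where "Z = add_row (2 * k) a (add_row (Suc (2 * k')) c z)"
  note D = patternsD[OF z]
  have rl: "row_length (2 * k) = k" "row_length (Suc (2 * k)) = Suc k" "row_length (Suc (2 * k')) = k"
    by (simp_all only: row_length_double k)
  have lenb: "length b = k" using D(6) by (simp add: rl)
  have Za: "Z (Suc (2 * k)) (Suc j) = a ! j" if "j < Suc k" for j
    using that assms(4) by (simp add: Z_def add_row_def)
  have Zc: "Z (2 * k) (Suc j) = c ! j" if "j < k" for j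
    using that assms(3) by (simp add: Z_def add_row_def k)
  have Zz: "Z i j = z i j" if "i \<le> Suc (2 * k')" for i j
    using that by (simp add: Z_def add_row_def k)
  have Zb: "Z (Suc (2 * k')) (Suc j) = b ! j" if "j < k" for j
    using that D(7)[of j] by (simp add: Zz rl)
  have W: "weight k Z (r @ [q]) = weight k z r"
    using assms(5) k by (intro weight_cong) (auto simp: Zz nth_append)
  have shift: "(\<Sum>j = 1..n. f j) = (\<Sum>j<n. f (Suc j))" for f :: "nat \<Rightarrow> rat" and n
    by (simp add: sum.atLeast1_atMost_eq)
  have sa: "(\<Sum>j = 1..Suc k. \<bar>Z (Suc (2 * k)) j\<bar>) = abs_sum a"
    unfolding shift abs_sum_def assms(4) by (intro sum.cong) (auto simp: Za)
  have sc: "(\<Sum>j = 1..k. \<bar>Z (2 * k) j\<bar>) = entry_sum c"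
    unfolding shift entry_sum_def assms(3) using c by (intro sum.cong) (auto simp: Zc)
  have sb: "(\<Sum>j = 1..k. \<bar>Z (Suc (2 * k')) j\<bar>) = abs_sum b"
    unfolding shift abs_sum_def lenb by (intro sum.cong) (auto simp: Zb)
  have i: "2 * Suc k - 1 = Suc (2 * k)" "2 * Suc k - 2 = 2 * k" "2 * Suc k - 3 = Suc (2 * k')"
    "2 * k - 1 = Suc (2 * k')" by (simp_all add: k)
  have "pattern_type Z (Suc (2 * k)) - pattern_type Z (2 * k) = abs_sum a - 2 * entry_sum c + abs_sum b"
    unfolding pattern_type_def i diff_Suc_1 rl sa sc sb by simp
  moreover have "Z (Suc (2 * k')) k = last b"
    using Zb[of k'] lenb k by (metis last_conv_nth diff_Suc_1 length_0_conv lessI nat.distinct(1))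
  moreover have "Z (Suc (2 * k)) (Suc k) = last a"
    using Za[of k] assms(4) by (metis last_conv_nth diff_Suc_1 length_0_conv lessI nat.distinct(1))
  moreover have "a \<noteq> []" "b \<noteq> []" using assms(4) lenb k by auto
  ultimately have last: "half_power ((r @ [q]) ! (Suc k - 1)) (Defs.sign (Z (2 * Suc k - 3) (Suc k - 1)) *
      Defs.sign (Z (2 * Suc k - 1) (Suc k)) * (pattern_type Z (2 * Suc k - 1) - pattern_type Z (2 * Suc k - 2))) =
      half_power q (end_sign a * end_sign b * (abs_sum a - 2 * entry_sum c + abs_sum b))"
    unfolding i using assms(5) by (simp add: end_sign_def nth_append mult_ac)
  define f where "f i = half_power ((r @ [q]) ! (i - 1)) (Defs.sign (Z (2 * i - 3) (i - 1)) *
      Defs.sign (Z (2 * i - 1) i) * (pattern_type Z (2 * i - 1) - pattern_type Z (2 * i - 2)))" for i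
  have "prod f {2..Suc k} = prod f {2..k} * f (Suc k)"
    by (subst prod.nat_ivl_Suc') (simp_all add: k mult.commute)
  then have "weight (Suc k) Z (r @ [q]) = weight k Z (r @ [q]) * f (Suc k)"
    unfolding weight_def f_def[symmetric] by (simp only: mult.assoc)
  then show ?thesis unfolding f_def last W unfolding Z_def .
qed

text \<open>Branching from SO(2k + 2) to SO(2k); the middle row is the intermediate weight of SO(2k
  + 1).\<close>

lemma so_char_step:
  assumes a: "so_tuple (Suc k) a" and k: "k = Suc k'" and r: "length r = k"
  shows "so_char (2 * Suc k) a (r @ [q]) =
    (\<Sum>b\<in>so_tuples_in k (a ! 0). transfer a b q * so_char (2 * k) b r)"
proof -
  define f where "f b c z = weight k z r * half_power q
    (end_sign a * end_sign b * (abs_sum a - 2 * entry_sum c + abs_sum b))" for b c and z :: "nat \<Rightarrow> nat \<Rightarrow> rat"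
  have la: "length a = Suc k" using a by (simp add: so_tuple_def)
  note va = valid_row_so_tuple[OF a]
  have k2: "2 * k = Suc (Suc (2 * k'))" using k by simp
  have fin: "finite (patterns M \<mu>)" for M \<mu> by (simp add: patterns_def finite_patterns)
  have "so_char (2 * Suc k) a (r @ [q]) = (\<Sum>z\<in>patterns (Suc (2 * k)) a. weight (Suc k) z (r @ [q]))"
    by (simp add: so_char_eq)
  also have "\<dots> = (\<Sum>c\<in>rows_under (2 * k) a. \<Sum>z\<in>patterns (2 * k) c.
      weight (Suc k) (add_row (2 * k) a z) (r @ [q]))"
    by (rule sum_patterns_Suc[OF va])
  also have "\<dots> = (\<Sum>c\<in>rows_under (2 * k) a. \<Sum>b\<in>rows_under (Suc (2 * k')) c.
      \<Sum>z\<in>patterns (Suc (2 * k')) b. f b c z)"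
  proof (intro sum.cong refl)
    fix c assume c: "c \<in> rows_under (2 * k) a"
    have vc: "valid_row (Suc (Suc (2 * k'))) c"
      using valid_row_under[OF c va] by (simp add: k2)
    have odd: "2 * k \<noteq> 2 * j + 1" for j by presburger
    have lc: "length c = k" using vc row_length_double(1)[of k] unfolding valid_row_def k2[symmetric] by simp
    have cpos: "0 \<le> c ! j" if "j < k" for j
      using vc row_length_double(1)[of k] odd that unfolding valid_row_def k2[symmetric] by simp
    show "(\<Sum>z\<in>patterns (2 * k) c. weight (Suc k) (add_row (2 * k) a z) (r @ [q])) =
        (\<Sum>b\<in>rows_under (Suc (2 * k')) c. \<Sum>z\<in>patterns (Suc (2 * k')) b. f b c z)"
      unfolding k2 sum_patterns_Suc[OF vc]
      by (intro sum.cong refl) (simp add: f_def flip: k2 weight_add_rows[OF k _ lc la r cpos])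
  qed
  also have "\<dots> = (\<Sum>b\<in>so_tuples_in k (a ! 0). \<Sum>c\<in>mid_rows a b. \<Sum>z\<in>patterns (Suc (2 * k')) b. f b c z)"
  proof -
    define S T where "S = Sigma (rows_under (2 * k) a) (rows_under (Suc (2 * k')))"
      and "T = Sigma (so_tuples_in k (a ! 0)) (mid_rows a)"
    define g where "g b c = (\<Sum>z\<in>patterns (Suc (2 * k')) b. f b c z)" for b c
    have ST: "(c, b) \<in> S \<longleftrightarrow> (b, c) \<in> T" for b c
      using rows_under_under_iff[OF a k] by (simp add: S_def T_def)
    have "(\<Sum>(c, b)\<in>S. g b c) = (\<Sum>(b, c)\<in>T. g b c)"
      by (rule sum.reindex_bij_witness[of _ prod.swap prod.swap]) (auto simp: ST)
    then show ?thesis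
      unfolding S_def T_def g_def by (simp add: sum.Sigma finite_rows_under)
  qed
  also have "\<dots> = (\<Sum>b\<in>so_tuples_in k (a ! 0). transfer a b q * so_char (2 * k) b r)"
  proof (intro sum.cong refl)
    fix b
    have "(\<Sum>c\<in>mid_rows a b. \<Sum>z\<in>patterns (Suc (2 * k')) b. f b c z) =
        (\<Sum>z\<in>patterns (Suc (2 * k')) b. weight k z r) * transfer a b q"
      unfolding f_def transfer_def sum_product by (rule sum.swap)
    moreover have "2 * k - 1 = Suc (2 * k')" by (simp add: k)
    ultimately show "(\<Sum>c\<in>mid_rows a b. \<Sum>z\<in>patterns (Suc (2 * k')) b. f b c z) =
        transfer a b q * so_char (2 * k) b r"
      by (simp add: so_char_eq mult.commute)
  qed
  finally show ?thesis .
qed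

theorem so_char_eq_so_rec:
  assumes "so_tuple (Suc k) a" "length r = Suc k"
  shows "so_char (2 * Suc k) a r = so_rec a (rev r)"
  using assms
proof (induction k arbitrary: a r)
  case 0
  obtain x where x: "a = [x]" using 0 by (auto simp: so_tuple_def length_Suc_conv)
  obtain q where q: "r = [q]" using 0 by (auto simp: length_Suc_conv)
  \<comment> \<open>In height 0 there is only the empty array, encoded as the zero function.\<close>
  have "patterns 0 [] = {\<lambda>_ _. 0}"
    by (auto simp: patterns_def orthogonal_pattern_def pattern_index_def pattern_shape_def row_length_def)
  moreover have "rows_under 0 [x] = {[]}" by (auto simp: rows_under_def row_length_def)
  moreover have "valid_row (Suc 0) [x]" using valid_row_so_tuple[of 0 a] 0 x by simp
  ultimately have "so_char 2 [x] [q] = weight 1 (add_row 0 [x] (\<lambda>_ _. 0)) [q]"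
    using sum_patterns_Suc[of 0 "[x]" "\<lambda>z. weight 1 z [q]"] by (simp add: so_char_eq)
  also have "\<dots> = half_power q x" by (simp add: weight_def add_row_def)
  also have "\<dots> = so_rec [x] [q]"
    by (simp add: transfer_def abs_sum_def entry_sum_def end_sign_def Defs.sign_def)
  finally show ?case by (simp add: x q numeral_2_eq_2)
next
  case (Suc k)
  obtain r' q where r: "r = r' @ [q]" "length r' = Suc k"
    using Suc.prems(2) by (cases r rule: rev_cases) auto
  have "length a = Suc (Suc k)" using Suc.prems by (simp add: so_tuple_def)
  moreover have "so_char (2 * Suc k) b r' = so_rec b (rev r')" if "b \<in> so_tuples_in (Suc k) (a ! 0)" for b
    using that by (intro Suc.IH) (auto simp: so_tuples_in_def r)
  ultimately show ?case
    using so_char_step[OF Suc.prems(1) refl r(2), of q] by (simp add: r(1))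
qed

section \<open>Splitting rectangular patterns\<close>

lemma abs_sum_eq_sum_list: "abs_sum a = sum_list (map abs a)"
  by (simp add: abs_sum_def sum_list_sum_nth atLeast0LessThan)

lemma entry_sum_eq_sum_list: "entry_sum a = sum_list a"
  by (simp add: entry_sum_def sum_list_sum_nth atLeast0LessThan)

lemma nth_replicate_append:
  "(replicate p u @ b) ! j = (if j < p then u else b ! (j - p))"
  by (simp add: nth_append)

lemma replicate_append_in_so_tuples_in:
  assumes "b \<in> so_tuples_in l u" "0 \<le> u" "2 * u \<in> \<int>"
  shows "replicate p u @ b \<in> so_tuples_in (p + l) u"
proof -
  have b: "length b = l" "\<And>j. j < l \<Longrightarrow> b ! j - u \<in> \<int> \<and> \<bar>b ! j\<bar> \<le> u" "\<And>j. Suc j < l \<Longrightarrow> \<bar>b ! Suc j\<bar> \<le> b ! j"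
    using assms(1) by (auto simp: so_tuples_in_def so_tuple_def)
  have e: "(replicate p u @ b) ! j - u \<in> \<int> \<and> \<bar>(replicate p u @ b) ! j\<bar> \<le> u" if "j < p + l" for j
    using b(2)[of "j - p"] that assms(2) by (simp add: nth_replicate_append)
  show ?thesis
    unfolding so_tuples_in_def so_tuple_def mem_Collect_eq
  proof (intro conjI allI impI)
    show "length (replicate p u @ b) = p + l" using b(1) by simp
    fix j assume j: "j < p + l"
    show "(replicate p u @ b) ! j - u \<in> \<int>" "\<bar>(replicate p u @ b) ! j\<bar> \<le> u" using e[OF j] by auto
    show "2 * (replicate p u @ b) ! j \<in> \<int>"
      by (rule Ints_double_cong[OF assms(3) conjunct1[OF e[OF j]]])
    show "(replicate p u @ b) ! j - (replicate p u @ b) ! 0 \<in> \<int>"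
    proof (rule Ints_minus_cong[OF conjunct1[OF e[OF j]]])
      have "0 < p + l" using j by linarith
      then show "(replicate p u @ b) ! 0 - u \<in> \<int>" using e by blast
    qed
  next
    fix j assume j: "Suc j < p + l"
    show "\<bar>(replicate p u @ b) ! Suc j\<bar> \<le> (replicate p u @ b) ! j"
    proof (cases "j < p")
      case True
      then show ?thesis using e[OF j] by (simp add: nth_replicate_append)
    next
      case False
      then show ?thesis using b(3)[of "j - p"] j by (simp add: nth_replicate_append Suc_diff_le)
    qed
  qed
qed

lemma mid_rows_replicate_nth:
  assumes "c \<in> mid_rows (replicate (Suc (Suc p)) u @ x) b" "0 \<le> u" "j \<le> p" "length b = p + Suc l"
  shows "c ! j = u"
proof -
  have "\<bar>(replicate (Suc (Suc p)) u @ x) ! Suc j\<bar> \<le> c ! j \<and> c ! j \<le> \<bar>(replicate (Suc (Suc p)) u @ x) ! j\<bar>"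
    using assms(1,3,4) unfolding mid_rows_def by auto
  then show ?thesis using assms(2,3) by (simp add: nth_replicate_append del: replicate.simps)
qed

text \<open>Between two rows that start with many entries \<open>u\<close>, the remaining entries interlace as in a
  pattern that is read upside down.\<close>

lemma mid_rows_replicate:
  assumes x: "x \<in> so_tuples_in l u" and y: "y \<in> so_tuples_in (Suc l) u" and u: "0 \<le> u"
  shows "c \<in> mid_rows (replicate (Suc (Suc p)) u @ x) (replicate p u @ y) \<longleftrightarrow>
    (\<exists>d. c = replicate (Suc p) u @ d \<and> d \<in> mid_rows y x)"
proof
  define a b where "a = replicate (Suc (Suc p)) u @ x" and "b = replicate p u @ y"
  have lx: "length x = l" and xu: "\<And>j. j < l \<Longrightarrow> x ! j - u \<in> \<int> \<and> \<bar>x ! j\<bar> \<le> u"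
    and ly: "length y = Suc l" and yu: "\<And>j. j < Suc l \<Longrightarrow> y ! j - u \<in> \<int> \<and> \<bar>y ! j\<bar> \<le> u"
    using x y by (auto simp: so_tuples_in_def so_tuple_def)
  have lb: "length b = p + Suc l" by (simp add: b_def ly)
  have a1: "a ! j = u" if "j \<le> Suc p" for j using that by (simp add: a_def nth_replicate_append del: replicate.simps)
  have a2: "a ! Suc (Suc (p + j)) = x ! j" for j by (simp add: a_def nth_replicate_append del: replicate.simps)
  have b1: "b ! j = u" if "j < p" for j using that by (simp add: b_def nth_replicate_append)
  have b2: "b ! (p + j) = y ! j" for j by (simp add: b_def nth_replicate_append)
  have y0: "y ! 0 - u \<in> \<int>" using yu by simp
  {
    assume "c \<in> mid_rows (replicate (Suc (Suc p)) u @ x) (replicate p u @ y)"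
    then have c: "c \<in> mid_rows a b" by (simp only: a_def b_def)
    then have lc: "length c = p + Suc l" and cj: "\<And>j. j < p + Suc l \<Longrightarrow> c ! j - u \<in> \<int> \<and>
        \<bar>a ! Suc j\<bar> \<le> c ! j \<and> c ! j \<le> \<bar>a ! j\<bar> \<and> \<bar>b ! j\<bar> \<le> c ! j \<and> (Suc j < p + Suc l \<longrightarrow> c ! Suc j \<le> \<bar>b ! j\<bar>)"
      unfolding mid_rows_def lb using a1[of 0] by auto
    have cu: "c ! j = u" if "j \<le> p" for j
      by (rule mid_rows_replicate_nth[OF c[unfolded a_def] u that lb])
    define d where "d = drop (Suc p) c"
    have ld: "length d = l" by (simp add: d_def lc)
    have dj: "d ! j = c ! Suc (p + j)" for j by (simp add: d_def lc)
    have "take (Suc p) c = replicate (Suc p) u"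
      using cu lc by (intro nth_equalityI) (auto simp del: replicate.simps take_Suc)
    then have "c = replicate (Suc p) u @ d" unfolding d_def by (metis append_take_drop_id)
    moreover have "d \<in> mid_rows y x"
      unfolding mid_rows_def mem_Collect_eq lx
    proof (intro conjI allI impI)
      show "length d = l" by (rule ld)
      fix j assume j: "j < l"
      have j': "Suc (p + j) < p + Suc l" "p + j < p + Suc l" using j by auto
      note C = cj[OF j'(1)] and C' = cj[OF j'(2)]
      show "d ! j - y ! 0 \<in> \<int>" unfolding dj by (rule Ints_minus_cong[OF conjunct1[OF C] y0])
      show "\<bar>y ! Suc j\<bar> \<le> d ! j" unfolding dj using C b2[of "Suc j"] by simp
      show "d ! j \<le> \<bar>y ! j\<bar>" unfolding dj using C' b2[of j] j'(1) by simp
      show "\<bar>x ! j\<bar> \<le> d ! j" unfolding dj using C a2[of j] by simp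
      show "d ! Suc j \<le> \<bar>x ! j\<bar>" if "Suc j < l"
        unfolding dj using cj[of "Suc (Suc (p + j))"] a2[of j] that by simp
    qed
    ultimately show "\<exists>d. c = replicate (Suc p) u @ d \<and> d \<in> mid_rows y x" by blast
  }
  assume "\<exists>d. c = replicate (Suc p) u @ d \<and> d \<in> mid_rows y x"
  then obtain d where c: "c = replicate (Suc p) u @ d" and ld: "length d = l"
    and d: "\<And>j. j < l \<Longrightarrow> d ! j - y ! 0 \<in> \<int> \<and> \<bar>y ! Suc j\<bar> \<le> d ! j \<and> d ! j \<le> \<bar>y ! j\<bar> \<and> \<bar>x ! j\<bar> \<le> d ! j \<and>
      (Suc j < l \<longrightarrow> d ! Suc j \<le> \<bar>x ! j\<bar>)"
    using lx by (auto simp: mid_rows_def)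
  have c1: "c ! j = u" if "j \<le> p" for j using that by (simp add: c nth_replicate_append del: replicate.simps)
  have c2: "c ! Suc (p + j) = d ! j" for j by (simp add: c nth_replicate_append del: replicate.simps)
  have du: "d ! j - u \<in> \<int> \<and> d ! j \<le> u" if "j < l" for j
    using d[OF that] yu[of j] that Ints_add[of "d ! j - y ! 0" "y ! 0 - u"] y0 by auto
  have "c \<in> mid_rows a b"
    unfolding mid_rows_def mem_Collect_eq lb
  proof (intro conjI allI impI)
    show "length c = p + Suc l" by (simp add: c ld)
    have a0: "a ! 0 = u" by (simp add: a1)
    fix j assume j: "j < p + Suc l"
    have "c ! j - a ! 0 \<in> \<int> \<and> \<bar>a ! Suc j\<bar> \<le> c ! j \<and> c ! j \<le> \<bar>a ! j\<bar> \<and> \<bar>b ! j\<bar> \<le> c ! j"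
    proof (cases "j \<le> p")
      case True
      have "\<bar>b ! j\<bar> \<le> u" using b1[of j] b2[of 0] True yu[of 0] u by (cases "j = p") auto
      then show "c ! j - a ! 0 \<in> \<int> \<and> \<bar>a ! Suc j\<bar> \<le> c ! j \<and> c ! j \<le> \<bar>a ! j\<bar> \<and> \<bar>b ! j\<bar> \<le> c ! j"
        using True u by (simp add: c1 a1)
    next
      case False
      then obtain i where i: "j = Suc (p + i)" by (metis less_imp_Suc_add not_le)
      then have il: "i < l" using j by simp
      have "d ! i \<le> \<bar>a ! Suc (p + i)\<bar>"
      proof (cases i)
        case 0
        then show ?thesis using a1[of "Suc p"] du[OF il] u by simp
      next
        case (Suc i')
        then show ?thesis using a2[of i'] d[of i'] il by simp
      qed
      then show "c ! j - a ! 0 \<in> \<int> \<and> \<bar>a ! Suc j\<bar> \<le> c ! j \<and> c ! j \<le> \<bar>a ! j\<bar> \<and> \<bar>b ! j\<bar> \<le> c ! j"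
        using d[OF il] du[OF il] a2[of i] b2[of "Suc i"] by (simp add: i c2 a0)
    qed
    then show "c ! j - a ! 0 \<in> \<int>" "\<bar>a ! Suc j\<bar> \<le> c ! j" "c ! j \<le> \<bar>a ! j\<bar>" "\<bar>b ! j\<bar> \<le> c ! j"
      by blast+
    show "c ! Suc j \<le> \<bar>b ! j\<bar>" if "Suc j < p + Suc l"
    proof (cases "j < p")
      case True
      then show ?thesis using c1[of "Suc j"] b1[of j] by simp
    next
      case False
      then obtain i where i: "j = p + i" by (metis le_add_diff_inverse not_less)
      then show ?thesis using c2[of i] d[of i] b2[of i] that by simp
    qed
  qed
  then show "c \<in> mid_rows (replicate (Suc (Suc p)) u @ x) (replicate p u @ y)"
    by (simp only: a_def b_def)
qed

text \<open>The exponent is symmetric in the two odd rows, which accounts for the exchange of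
  \<open>x\<close> and \<open>y\<close>. The entries \<open>u\<close> cancel: the three rows contain
  p + 2, p + 1 and p of them, and (p + 2) - 2 (p + 1) + p = 0.\<close>

lemma transfer_replicate:
  assumes x: "x \<in> so_tuples_in l u" and y: "y \<in> so_tuples_in (Suc l) u" and u: "0 \<le> u"
  shows "transfer (replicate (Suc (Suc p)) u @ x) (replicate p u @ y) q = transfer y x q"
proof -
  define a b where "a = replicate (Suc (Suc p)) u @ x" and "b = replicate p u @ y"
  have M: "mid_rows a b = (\<lambda>d. replicate (Suc p) u @ d) ` mid_rows y x"
    unfolding a_def b_def using mid_rows_replicate[OF x y u] by blast
  have "y \<noteq> []" using y by (auto simp: so_tuples_in_def so_tuple_def)
  then have es: "end_sign a = end_sign x" "end_sign b = end_sign y"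
    using u by (auto simp: end_sign_def a_def b_def Defs.sign_def)
  have "abs_sum a - 2 * entry_sum (replicate (Suc p) u @ d) + abs_sum b =
      abs_sum y - 2 * entry_sum d + abs_sum x" for d
    using u by (simp add: abs_sum_eq_sum_list entry_sum_eq_sum_list a_def b_def sum_list_replicate algebra_simps)
  then have "transfer a b q = transfer y x q"
    unfolding transfer_def M es
    by (subst sum.reindex) (auto simp: inj_on_def mult_ac simp del: replicate.simps)
  then show ?thesis by (simp only: a_def b_def)
qed

text \<open>A middle row has \<open>c ! Suc j = u\<close> for \<open>j < p\<close>, and this is at
  most \<open>\<bar>b ! j\<bar> \<le> u\<close>. So a row \<open>b\<close> with a nonzero kernel
  must begin with p entries \<open>u\<close>.\<close>

lemma transfer_replicate_eq_0:
  assumes "0 \<le> u" "b \<in> so_tuples_in (p + Suc l) u" "b \<notin> (@) (replicate p u) ` so_tuples_in (Suc l) u"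
  shows "transfer (replicate (Suc (Suc p)) u @ x) b q = 0"
proof -
  have b: "length b = p + Suc l" "\<And>j. j < p + Suc l \<Longrightarrow> 2 * b ! j \<in> \<int> \<and> b ! j - u \<in> \<int> \<and> \<bar>b ! j\<bar> \<le> u"
      "\<And>j. Suc j < p + Suc l \<Longrightarrow> \<bar>b ! Suc j\<bar> \<le> b ! j"
    using assms(2) by (auto simp: so_tuples_in_def so_tuple_def)
  have "mid_rows (replicate (Suc (Suc p)) u @ x) b = {}"
  proof (rule ccontr)
    assume "mid_rows (replicate (Suc (Suc p)) u @ x) b \<noteq> {}"
    then obtain c where c: "c \<in> mid_rows (replicate (Suc (Suc p)) u @ x) b" by blast
    have bu: "b ! j = u" if "j < p" for j
    proof -
      have "c ! Suc j \<le> \<bar>b ! j\<bar>" using c that b(1) by (simp add: mid_rows_def)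
      moreover have "c ! Suc j = u" using that by (intro mid_rows_replicate_nth[OF c assms(1) _ b(1)]) simp
      moreover have "\<bar>b ! j\<bar> \<le> u" "0 \<le> b ! j" using b(2)[of j] b(3)[of j] that by auto
      ultimately show ?thesis by simp
    qed
    define y where "y = drop p b"
    have "take p b = replicate p u" using bu b(1) by (intro nth_equalityI) auto
    then have b_eq: "b = replicate p u @ y" unfolding y_def by (metis append_take_drop_id)
    have yj: "y ! j = b ! (p + j)" for j using b(1) by (simp add: y_def)
    have "y \<in> so_tuples_in (Suc l) u"
      unfolding so_tuples_in_def so_tuple_def mem_Collect_eq yj
    proof (intro conjI allI impI)
      fix j assume j: "j < Suc l"
      show "2 * b ! (p + j) \<in> \<int>" "b ! (p + j) - u \<in> \<int>" "\<bar>b ! (p + j)\<bar> \<le> u" using b(2)[of "p + j"] j by auto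
      show "b ! (p + j) - b ! (p + 0) \<in> \<int>"
        using b(2)[of "p + j"] b(2)[of p] j Ints_minus_cong[of "b ! (p + j)" u "b ! p"] by simp
    next
      fix j assume "Suc j < Suc l"
      then show "\<bar>b ! (p + Suc j)\<bar> \<le> b ! (p + j)" using b(3)[of "p + j"] by simp
    qed (simp add: y_def b(1))
    then show False using assms(3) b_eq by blast
  qed
  then show ?thesis by (simp add: transfer_def)
qed

text \<open>Interlacing alone bounds \<open>x\<close> by \<open>y ! 0\<close>. The range of
  \<open>x\<close> can therefore be enlarged to one that does not depend on \<open>y\<close>, which
  permits exchanging the two sums.\<close>

lemma transfer_eq_0:
  assumes y: "y \<in> so_tuples_in (Suc l) u" and "x \<in> so_tuples_in l u" "x \<notin> so_tuples_in l (y ! 0)"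
  shows "transfer y x q = 0"
proof -
  have ly: "length y = Suc l" "so_tuple (Suc l) y" "y ! 0 - u \<in> \<int>" using y by (auto simp: so_tuples_in_def so_tuple_def)
  have x: "so_tuple l x" "length x = l" "\<And>j. j < l \<Longrightarrow> x ! j - u \<in> \<int>"
    using assms(2) by (auto simp: so_tuples_in_def so_tuple_def)
  have "mid_rows y x = {}"
  proof (rule ccontr)
    assume "mid_rows y x \<noteq> {}"
    then obtain c where c: "c \<in> mid_rows y x" by blast
    have "x ! j - y ! 0 \<in> \<int> \<and> \<bar>x ! j\<bar> \<le> y ! 0" if j: "j < l" for j
    proof
      show "x ! j - y ! 0 \<in> \<int>" by (rule Ints_minus_cong[OF x(3)[OF j] ly(3)])
      have "\<bar>x ! j\<bar> \<le> \<bar>y ! j\<bar>" using c j x(2) by (force simp: mid_rows_def)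
      also have "\<dots> \<le> \<bar>y ! 0\<bar>" using so_tuple_nth_mono(2)[OF ly(2), of 0 j] j by simp
      also have "\<dots> = y ! 0" using so_tuple_nth_nonneg[OF ly(2), of 0] j by simp
      finally show "\<bar>x ! j\<bar> \<le> y ! 0" .
    qed
    then show False using assms(3) x(1) by (auto simp: so_tuples_in_def)
  qed
  then show ?thesis by (simp add: transfer_def)
qed

lemma so_tuples_in_mono:
  assumes "y \<in> so_tuples_in (Suc l) u"
  shows "so_tuples_in l (y ! 0) \<subseteq> so_tuples_in l u"
proof
  fix x assume x: "x \<in> so_tuples_in l (y ! 0)"
  have y: "y ! 0 - u \<in> \<int>" "\<bar>y ! 0\<bar> \<le> u" using assms by (auto simp: so_tuples_in_def)
  have "x ! j - u \<in> \<int> \<and> \<bar>x ! j\<bar> \<le> u" if "j < l" for j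
    using x y that Ints_add[of "x ! j - y ! 0" "y ! 0 - u"] by (force simp: so_tuples_in_def)
  then show "x \<in> so_tuples_in l u" using x by (auto simp: so_tuples_in_def)
qed

text \<open>The induction lowers the cutting row by one variable. Each step down shortens the row by
  one entry while its free part grows by one, so two entries \<open>u\<close> are lost; this
  explains \<open>p + 2 * length ys\<close>. The kernel of the variable \<open>q\<close> that is
  passed is \<open>transfer y x q\<close>, the top step of the inverted pattern, hence the reversal
  of \<open>ys\<close>.\<close>

theorem so_rec_rectangle_split:
  assumes "0 \<le> u" "length xs = p + length ys"
  shows "so_rec (replicate (p + 2 * length ys) u) (ys @ xs) =
    (\<Sum>x\<in>so_tuples_in (length ys) u. so_rec (replicate p u @ x) xs * so_rec x (rev ys))"
  using assms(2)
proof (induction ys arbitrary: p xs rule: rev_induct)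
  case Nil
  then show ?case by simp
next
  case (snoc q ys)
  define l where "l = length ys"
  have len: "length (replicate (Suc (Suc p)) u @ x) - 1 = p + Suc l" if "x \<in> so_tuples_in l u" for x
    using that by (simp add: so_tuples_in_def so_tuple_def)
  have inner: "so_rec (replicate (Suc (Suc p)) u @ x) (q # xs) =
      (\<Sum>y\<in>so_tuples_in (Suc l) u. transfer y x q * so_rec (replicate p u @ y) xs)"
    if x: "x \<in> so_tuples_in l u" for x
  proof -
    have "so_rec (replicate (Suc (Suc p)) u @ x) (q # xs) =
        (\<Sum>b\<in>so_tuples_in (p + Suc l) u. transfer (replicate (Suc (Suc p)) u @ x) b q * so_rec b xs)"
      unfolding so_rec.simps len[OF x] by simp
    also have "\<dots> = (\<Sum>b\<in>(@) (replicate p u) ` (so_tuples_in (Suc l) u).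
        transfer (replicate (Suc (Suc p)) u @ x) b q * so_rec b xs)"
    proof (rule sum.mono_neutral_right)
      show "(@) (replicate p u) ` so_tuples_in (Suc l) u \<subseteq> so_tuples_in (p + Suc l) u"
      proof safe
        fix y assume y: "y \<in> so_tuples_in (Suc l) u"
        \<comment> \<open>That \<open>2 * u\<close> is an integer comes from the entries of
          \<open>y\<close>, which lie in the class of \<open>u\<close>.\<close>
        then have "2 * y ! 0 \<in> \<int>" "u - y ! 0 \<in> \<int>"
          using Ints_minus[of "y ! 0 - u"] by (auto simp: so_tuples_in_def so_tuple_def)
        then have "2 * u \<in> \<int>" by (rule Ints_double_cong)
        then show "replicate p u @ y \<in> so_tuples_in (p + Suc l) u"
          by (rule replicate_append_in_so_tuples_in[OF y assms(1)])
      qed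
    qed (auto simp: transfer_replicate_eq_0[OF assms(1)] simp del: replicate.simps)
    also have "\<dots> = (\<Sum>y\<in>so_tuples_in (Suc l) u.
        transfer (replicate (Suc (Suc p)) u @ x) (replicate p u @ y) q * so_rec (replicate p u @ y) xs)"
      by (subst sum.reindex) (auto simp: inj_on_def)
    also have "\<dots> = (\<Sum>y\<in>so_tuples_in (Suc l) u. transfer y x q * so_rec (replicate p u @ y) xs)"
      by (intro sum.cong refl) (simp only: transfer_replicate[OF x _ assms(1)])
    finally show ?thesis .
  qed
  \<comment> \<open>The recursion for \<open>y\<close> sums only up to \<open>y ! 0\<close>; the
    additional \<open>x\<close> have kernel 0.\<close>
  have outer: "(\<Sum>x\<in>so_tuples_in l u. transfer y x q * so_rec x (rev ys)) = so_rec y (q # rev ys)"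
    if y: "y \<in> so_tuples_in (Suc l) u" for y
  proof -
    have "length y - 1 = l" using y by (simp add: so_tuples_in_def so_tuple_def)
    then show ?thesis
      unfolding so_rec.simps using transfer_eq_0[OF y]
      by (intro sum.mono_neutral_right) (auto simp: so_tuples_in_mono[OF y])
  qed
  have "so_rec (replicate (p + 2 * length (ys @ [q])) u) ((ys @ [q]) @ xs) =
      so_rec (replicate (Suc (Suc p) + 2 * length ys) u) (ys @ (q # xs))"
    by simp
  also have "\<dots> = (\<Sum>x\<in>so_tuples_in l u. so_rec (replicate (Suc (Suc p)) u @ x) (q # xs) * so_rec x (rev ys))"
    unfolding l_def using snoc.prems by (intro snoc.IH) simp
  also have "\<dots> = (\<Sum>x\<in>so_tuples_in l u. \<Sum>y\<in>so_tuples_in (Suc l) u.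
      so_rec (replicate p u @ y) xs * (transfer y x q * so_rec x (rev ys)))"
    by (intro sum.cong refl) (simp only: inner sum_distrib_right sum_distrib_left mult_ac)
  also have "\<dots> = (\<Sum>y\<in>so_tuples_in (Suc l) u. \<Sum>x\<in>so_tuples_in l u.
      so_rec (replicate p u @ y) xs * (transfer y x q * so_rec x (rev ys)))"
    by (rule sum.swap)
  also have "\<dots> = (\<Sum>y\<in>so_tuples_in (Suc l) u. so_rec (replicate p u @ y) xs * so_rec y (q # rev ys))"
    by (intro sum.cong refl) (simp only: outer flip: sum_distrib_left)
  finally show ?case by (simp add: l_def)
qed

text \<open>The sign can be read off from the last entry because \<open>last \<mu> = 0\<close>
  admits only \<open>\<delta> = 1\<close>. Since \<delta> is its own inverse, applying it again
  recovers \<open>\<mu>\<close>.\<close>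

lemma signed_in_so_tuples_in:
  assumes "(\<mu>, \<delta>) \<in> signed_tuples_in m u" "1 \<le> m"
  shows "signed \<delta> \<mu> \<in> so_tuples_in m u"
    "signed (if last (signed \<delta> \<mu>) < 0 then - 1 else 1) (signed \<delta> \<mu>) = \<mu>"
    "(if last (signed \<delta> \<mu>) < 0 then - 1 else 1) = \<delta>"
proof -
  have len: "length \<mu> = m" and sorted: "sorted_wrt (\<ge>) \<mu>" and pos: "\<And>a. a \<in> set \<mu> \<Longrightarrow> 0 \<le> a \<and> a \<le> u"
    and cl: "(u \<in> \<int> \<and> (\<forall>a\<in>set \<mu>. a \<in> \<int>)) \<or> (u \<in> half_integers \<and> (\<forall>a\<in>set \<mu>. a \<in> half_integers))"
    and \<delta>: "\<delta> = 1 \<or> \<delta> = - 1" "last \<mu> = 0 \<Longrightarrow> \<delta> = 1"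
    using assms(1) by (auto simp: signed_tuples_in_def partition_tuple_def half_partition_tuple_def)
  have ne: "\<mu> \<noteq> []" using len assms(2) by auto
  have el: "2 * \<mu> ! j \<in> \<int> \<and> \<mu> ! j - u \<in> \<int> \<and> 0 \<le> \<mu> ! j \<and> \<mu> ! j \<le> u" if "j < m" for j
  proof -
    have "\<mu> ! j \<in> set \<mu>" using that len by simp
    moreover have "2 * \<mu> ! j \<in> \<int>" if "\<mu> ! j \<in> \<int>"
      using Ints_add[OF that that] by (simp only: mult_2)
    ultimately show ?thesis using pos cl by (auto intro: double_half_integers half_integers_diff)
  qed
  have u2: "2 * u \<in> \<int>" using cl Ints_add[of u u] double_half_integers[of u] by (auto simp only: mult_2)
  have sg: "signed \<delta> \<mu> ! j = \<mu> ! j \<or> signed \<delta> \<mu> ! j = - \<mu> ! j" if "j < m" for j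
    using that \<delta>(1) by (auto simp: nth_signed len)
  have sl: "signed \<delta> \<mu> ! j = \<mu> ! j" if "Suc j < m" for j
    using that by (simp add: nth_signed len)
  have sc: "signed \<delta> \<mu> ! j - u \<in> \<int>" if "j < m" for j
    using sg[OF that] el[OF that] Ints_uminus_cong[OF u2, of "\<mu> ! j"] by auto
  show "signed \<delta> \<mu> \<in> so_tuples_in m u"
    unfolding so_tuples_in_def so_tuple_def mem_Collect_eq
  proof (intro conjI allI impI)
    show "length (signed \<delta> \<mu>) = m" by (simp add: length_signed ne len)
    fix j assume j: "j < m"
    show "2 * signed \<delta> \<mu> ! j \<in> \<int>" by (rule Ints_double_cong[OF u2 sc[OF j]])
    show "signed \<delta> \<mu> ! j - signed \<delta> \<mu> ! 0 \<in> \<int>"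
      using sc[of 0] assms(2) by (intro Ints_minus_cong[OF sc[OF j]]) simp
    show "signed \<delta> \<mu> ! j - u \<in> \<int>" by (rule sc[OF j])
    show "\<bar>signed \<delta> \<mu> ! j\<bar> \<le> u" using sg[OF j] el[OF j] by auto
  next
    fix j assume j: "Suc j < m"
    have "\<mu> ! Suc j \<le> \<mu> ! j" using sorted j len by (simp add: sorted_wrt_iff_nth_less)
    then show "\<bar>signed \<delta> \<mu> ! Suc j\<bar> \<le> signed \<delta> \<mu> ! j"
      using sg[of "Suc j"] sl[of j] el[of "Suc j"] j by auto
  qed
  have "0 \<le> last \<mu>" using pos ne by simp
  then show d: "(if last (signed \<delta> \<mu>) < 0 then - 1 else 1) = \<delta>"
    using \<delta> by auto
  show "signed (if last (signed \<delta> \<mu>) < 0 then - 1 else 1) (signed \<delta> \<mu>) = \<mu>"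
    unfolding d using \<delta>(1) ne by (auto simp: signed_signed signed_one)
qed

lemma unsigned_in_signed_tuples_in:
  assumes x: "x \<in> so_tuples_in m u" and "1 \<le> m" and u: "2 * u \<in> \<int>"
  defines "\<delta> \<equiv> if last x < 0 then - 1 else 1"
  shows "(signed \<delta> x, \<delta>) \<in> signed_tuples_in m u" "signed \<delta> (signed \<delta> x) = x"
proof -
  have len: "length x = m" and el: "\<And>j. j < m \<Longrightarrow> x ! j - u \<in> \<int> \<and> \<bar>x ! j\<bar> \<le> u" and st: "so_tuple m x"
    using x by (auto simp: so_tuples_in_def so_tuple_def)
  have ne: "x \<noteq> []" using len assms(2) by auto
  have last: "last x = x ! (m - 1)" using ne len by (simp add: last_conv_nth)
  obtain m' where m: "m = Suc m'" using assms(2) by (cases m) auto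
  have sx: "signed \<delta> x ! j = \<bar>x ! j\<bar>" if "j < m" for j
    using that last so_tuple_nth_nonneg[of m' x j] st
    by (auto simp: nth_signed len \<delta>_def m)
  show "signed \<delta> (signed \<delta> x) = x"
    by (auto simp: \<delta>_def signed_signed[OF ne] signed_one[OF ne])
  have ls: "length (signed \<delta> x) = m" by (simp add: length_signed ne len)
  have "sorted_wrt (\<ge>) (signed \<delta> x)"
    unfolding sorted_wrt_iff_nth_less
    using so_tuple_nth_mono(2)[OF st] by (auto simp: ls sx)
  moreover have "signed \<delta> x = map (\<lambda>j. \<bar>x ! j\<bar>) [0..<m]"
    by (intro nth_equalityI) (simp_all add: ls sx)
  then have S: "set (signed \<delta> x) = (\<lambda>j. \<bar>x ! j\<bar>) ` {..<m}"
    by (simp add: atLeast0LessThan)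
  moreover have "\<bar>x ! j\<bar> - u \<in> \<int>" if "j < m" for j
    using el[OF that] by (intro Ints_abs_cong[OF u]) auto
  note cl = Ints_half_integers_cong[OF this]
  have "u \<in> \<int> \<or> u \<in> half_integers" by (rule double_Ints_cases[OF u])
  ultimately have "u \<in> \<int> \<and> partition_tuple m (signed \<delta> x) \<or> u \<in> half_integers \<and> half_partition_tuple m (signed \<delta> x)"
    unfolding partition_tuple_def half_partition_tuple_def S using ls cl by auto
  moreover have "\<forall>a\<in>set (signed \<delta> x). a \<le> u" unfolding S using el by auto
  moreover have "last (signed \<delta> x) = 0 \<longrightarrow> \<delta> = 1" by (auto simp: \<delta>_def)
  ultimately show "(signed \<delta> x, \<delta>) \<in> signed_tuples_in m u"
    by (auto simp: signed_tuples_in_def \<delta>_def)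
qed

lemma sum_signed_tuples_in:
  assumes "1 \<le> m" "2 * u \<in> \<int>"
  shows "(\<Sum>(\<mu>, \<delta>)\<in>signed_tuples_in m u. f (signed \<delta> \<mu>)) = (\<Sum>x\<in>so_tuples_in m u. f x)"
proof -
  define d where "d x = (if last x < 0 then - 1 else 1 :: rat)" for x :: "rat list"
  have 1: "signed \<delta> \<mu> \<in> so_tuples_in m u" "signed (d (signed \<delta> \<mu>)) (signed \<delta> \<mu>) = \<mu>" "d (signed \<delta> \<mu>) = \<delta>"
    if "(\<mu>, \<delta>) \<in> signed_tuples_in m u" for \<mu> \<delta>
    using signed_in_so_tuples_in[OF that assms(1)] unfolding d_def by blast+
  have invol: "signed \<delta> (signed \<delta> \<mu>) = \<mu>" if "(\<mu>, \<delta>) \<in> signed_tuples_in m u" for \<mu> \<delta>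
    using 1(2,3)[OF that] by simp
  have 2: "(signed (d x) x, d x) \<in> signed_tuples_in m u" "signed (d x) (signed (d x) x) = x"
    if "x \<in> so_tuples_in m u" for x
    using unsigned_in_signed_tuples_in[OF that assms] unfolding d_def by blast+
  show ?thesis
    by (rule sum.reindex_bij_witness[of _ "\<lambda>x. (signed (d x) x, d x)" "\<lambda>(\<mu>, \<delta>). signed \<delta> \<mu>"])
       (auto simp: 1 2 invol)
qed

section \<open>The two identities for characters\<close>

lemma replicate_in_so_tuples_in:
  assumes "0 \<le> u" "2 * u \<in> \<int>"
  shows "replicate k u \<in> so_tuples_in k u"
  using replicate_append_in_so_tuples_in[of "[]" 0 u k] assms by simp

lemma so_tuples_inD: "x \<in> so_tuples_in k u \<Longrightarrow> so_tuple k x"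
  by (simp add: so_tuples_in_def)

lemma so_char_eq_so_rec':
  assumes "so_tuple k a" "length r = k" "1 \<le> k"
  shows "so_char (2 * k) a r = so_rec a (rev r)"
proof -
  obtain k' where "k = Suc k'" using assms(3) by (cases k) auto
  then show ?thesis using so_char_eq_so_rec[of k' a r] assms by simp
qed

lemma so_char_permute:
  fixes r r' :: "'a::field_char_0 list"
  assumes "so_tuple k a" "length r = k" "1 \<le> k" "0 \<notin> set r" "mset r = mset r'"
  shows "so_char (2 * k) a r = so_char (2 * k) a r'"
proof -
  have "so_rec a (rev r) = so_rec a (rev r')"
    using assms by (intro so_rec_permute) auto
  then show ?thesis
    using assms mset_eq_length[OF assms(5)] by (simp add: so_char_eq_so_rec')
qed

lemma so_char_signed:
  assumes "so_tuple k a" "length r = k" "r = r' @ [q]"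
  shows "so_char (2 * k) (signed (- 1) a) r = so_char (2 * k) a (r' @ [inverse q])"
proof -
  have k: "k = Suc (length r')" using assms by simp
  have "length a = k" using assms(1) by (simp add: so_tuple_def)
  then have ne: "a \<noteq> []" using k by auto
  have "so_char (2 * k) (signed (- 1) a) r = so_rec (signed (- 1) a) (q # rev r')"
    using so_char_eq_so_rec'[OF so_tuple_signed[OF assms(1) ne] assms(2)] by (simp add: assms(3) k)
  also have "\<dots> = so_rec a (inverse q # rev r')"
    using assms(1) by (intro so_rec_signed) (simp_all add: k)
  also have "\<dots> = so_char (2 * k) a (r' @ [inverse q])"
    using so_char_eq_so_rec'[OF assms(1), of "r' @ [inverse q]"] by (simp add: k)
  finally show ?thesis .
qed

lemma so_char_rectangle_split:
  fixes r s :: "'a::field_char_0 list"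
  assumes "1 \<le> m" "m \<le> n" "length r = n" "length s = m" "0 \<notin> set s" "0 \<le> u" "2 * u \<in> \<int>"
  shows "so_char (2 * n + 2 * m) (replicate (n + m) u) (r @ s) =
    (\<Sum>x\<in>so_tuples_in m u. so_char (2 * n) (replicate (n - m) u @ x) r * so_char (2 * m) x s)"
proof -
  have "so_char (2 * n + 2 * m) (replicate (n + m) u) (r @ s) = so_rec (replicate (n + m) u) (rev s @ rev r)"
    using so_char_eq_so_rec'[of "n + m" "replicate (n + m) u" "r @ s"] assms
      so_tuples_inD[OF replicate_in_so_tuples_in] by (simp add: distrib_left)
  also have "\<dots> = (\<Sum>x\<in>so_tuples_in m u. so_rec (replicate (n - m) u @ x) (rev r) * so_rec x s)"
    using so_rec_rectangle_split[of u "rev r" "n - m" "rev s"] assms by (simp add: add.commute)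
  also have "\<dots> = (\<Sum>x\<in>so_tuples_in m u. so_char (2 * n) (replicate (n - m) u @ x) r * so_char (2 * m) x s)"
  proof (intro sum.cong refl)
    fix x assume x: "x \<in> so_tuples_in m u"
    have "replicate (n - m) u @ x \<in> so_tuples_in n u"
      using replicate_append_in_so_tuples_in[OF x assms(6,7), of "n - m"] assms(2) by simp
    then have "so_char (2 * n) (replicate (n - m) u @ x) r = so_rec (replicate (n - m) u @ x) (rev r)"
      using assms by (intro so_char_eq_so_rec' so_tuples_inD) auto
    \<comment> \<open>The splitting yields \<open>so_rec x s\<close>, the character at the reversed
      list; symmetry removes the reversal.\<close>
    moreover have "so_char (2 * m) x s = so_rec x s"
      using so_char_eq_so_rec'[OF so_tuples_inD[OF x], of s] so_rec_permute[of s "rev s" x]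
        so_tuples_inD[OF x] assms by simp
    ultimately show "so_rec (replicate (n - m) u @ x) (rev r) * so_rec x s =
        so_char (2 * n) (replicate (n - m) u @ x) r * so_char (2 * m) x s" by simp
  qed
  finally show ?thesis .
qed

text \<open>The even row below k + 1 equal entries \<open>u\<close> is squeezed to k entries
  \<open>u\<close>, and the value 1 of the last variable hides the remaining factor of the
  weight.\<close>

lemma so_char_odd_rectangle:
  assumes "0 \<le> u" "2 * u \<in> \<int>" "length r = k" "1 \<le> k"
  shows "so_char (2 * k + 1) (replicate k u) r = so_char (2 * Suc k) (replicate (Suc k) u) (r @ [1])"
proof -
  define a where "a = replicate (Suc k) u"
  have a: "a ! j = u" if "j < Suc k" for j using that unfolding a_def by (rule nth_replicate)
  have va: "valid_row (Suc (2 * k)) a"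
    unfolding a_def by (intro valid_row_so_tuple so_tuples_inD[OF replicate_in_so_tuples_in] assms)
  have par: "2 * k \<noteq> 2 * j + 1" for j by presburger
  have "c \<in> rows_under (2 * k) a \<longleftrightarrow> c = replicate k u" for c
  proof
    assume c: "c \<in> rows_under (2 * k) a"
    then have len: "length c = k" by (simp add: rows_under_def row_length_double)
    have "c ! j = u" if "j < k" for j
    proof -
      have "0 \<le> c ! j" "\<bar>c ! j\<bar> \<le> \<bar>a ! j\<bar>" "\<bar>a ! Suc j\<bar> \<le> \<bar>c ! j\<bar>"
        using c that par unfolding rows_under_def row_length_double by auto
      then show ?thesis using a[of j] a[of "Suc j"] that assms(1) by simp
    qed
    then show "c = replicate k u" using len by (intro nth_equalityI) auto
  next
    assume "c = replicate k u"
    then show "c \<in> rows_under (2 * k) a"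
      using assms(1) a by (simp add: rows_under_def row_length_double)
  qed
  then have R: "rows_under (2 * k) a = {replicate k u}" by blast
  have W: "weight (Suc k) (add_row (2 * k) a z) (r @ [1]) = weight k z r" for z :: "nat \<Rightarrow> nat \<Rightarrow> rat"
  proof -
    define Z where "Z = add_row (2 * k) a z"
    have "weight k Z (r @ [1]) = weight k z r"
      using assms by (intro weight_cong) (auto simp: Z_def add_row_def nth_append)
    moreover have "weight (Suc k) Z (r @ [1]) = weight k Z (r @ [1])"
      using assms unfolding weight_def by (subst prod.nat_ivl_Suc') (simp_all add: nth_append)
    ultimately show ?thesis by (simp add: Z_def)
  qed
  have "so_char (2 * Suc k) a (r @ [1]) = (\<Sum>z\<in>patterns (Suc (2 * k)) a. weight (Suc k) z (r @ [1]))"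
    by (simp add: so_char_eq)
  also have "\<dots> = (\<Sum>z\<in>patterns (2 * k) (replicate k u). weight k z r)"
    by (subst sum_patterns_Suc[OF va]) (simp add: R W)
  also have "\<dots> = so_char (2 * k + 1) (replicate k u) r"
    by (simp add: so_char_eq)
  finally show ?thesis by (simp add: a_def)
qed

theorem theorem4p8:
  fixes n m :: nat and r s :: "'a::field_char_0 list" and u \<epsilon> :: rat
  assumes "1 \<le> n" and "1 \<le> m"
    and "length r = n" and "length s = m"
    and "0 \<notin> set r" and "0 \<notin> set s"
    and "0 \<le> u" and "2 * u \<in> \<int>"
    and "\<epsilon> \<in> {1, -1}"
  shows "(m \<le> n \<longrightarrow>
           so_char (2*n + 2*m) (signed \<epsilon> (replicate (n + m) u)) (r @ s) =
             (\<Sum>(\<mu>, \<delta>)\<in>signed_tuples_in m u.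
                so_char (2*n) (replicate (n - m) u @ signed \<delta> \<mu>) r *
                so_char (2*m) (signed (\<delta> * \<epsilon>) \<mu>) s)) \<and>
         (m \<le> n + 1 \<longrightarrow>
           so_char (2*n + 2*m + 1) (replicate (n + m) u) (r @ s) =
             (\<Sum>(\<mu>, \<delta>)\<in>signed_tuples_in m u.
                so_char (2*n + 2) (replicate (n + 1 - m) u @ signed \<delta> \<mu>) (r @ [1]) *
                so_char (2*m) (signed \<delta> \<mu>) s))"
proof (intro conjI impI)
  note st = so_tuples_inD[OF replicate_in_so_tuples_in[OF assms(7,8)]]
  have s_ne: "s \<noteq> []" using assms by auto
  have ne: "replicate (n + m) u \<noteq> []" using assms(1) by simp
  {
    assume mn: "m \<le> n"
    have "signed (\<delta> * \<epsilon>) \<mu> = signed \<epsilon> (signed \<delta> \<mu>)" for \<delta> \<mu>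
      by (simp add: signed_def mult_ac)
    then have rhs: "(\<Sum>(\<mu>, \<delta>)\<in>signed_tuples_in m u. so_char (2*n) (replicate (n - m) u @ signed \<delta> \<mu>) r *
          so_char (2*m) (signed (\<delta> * \<epsilon>) \<mu>) s) =
        (\<Sum>x\<in>so_tuples_in m u. so_char (2*n) (replicate (n - m) u @ x) r * so_char (2*m) (signed \<epsilon> x) s)"
      using sum_signed_tuples_in[OF assms(2,8), of "\<lambda>x. so_char (2*n) (replicate (n - m) u @ x) r *
          so_char (2*m) (signed \<epsilon> x) s"] by simp
    have xne: "x \<noteq> []" if "x \<in> so_tuples_in m u" for x
      using that assms(2) by (auto simp: so_tuples_in_def so_tuple_def)
    have "so_char (2*n + 2*m) (signed \<epsilon> (replicate (n + m) u)) (r @ s) =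
        (\<Sum>x\<in>so_tuples_in m u. so_char (2*n) (replicate (n - m) u @ x) r * so_char (2*m) (signed \<epsilon> x) s)"
    proof (cases "\<epsilon> = 1")
      case True
      then show ?thesis
        using so_char_rectangle_split[OF assms(2) mn assms(3,4,6,7,8)] ne
        by (simp add: signed_one xne)
    next
      case False
      then have e: "\<epsilon> = - 1" using assms(9) by simp
      \<comment> \<open>The last variable of the large character is also the last one of the second
        factor, so inverting it accounts for \<epsilon> on both sides.\<close>
      define s' q where "s' = butlast s" and "q = last s"
      have s: "s = s' @ [q]" using s_ne by (simp add: s'_def q_def)
      define si where "si = s' @ [inverse q]"
      have si: "length si = m" "0 \<notin> set si" using assms(4,6) by (auto simp: si_def s)
      have "so_char (2*n + 2*m) (signed (- 1) (replicate (n + m) u)) (r @ s) =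
          so_char (2*n + 2*m) (replicate (n + m) u) (r @ si)"
        using so_char_signed[OF st[of "n + m"], of "r @ s" "r @ s'" q] assms
        by (simp add: si_def s distrib_left)
      also have "\<dots> = (\<Sum>x\<in>so_tuples_in m u. so_char (2*n) (replicate (n - m) u @ x) r * so_char (2*m) x si)"
        by (rule so_char_rectangle_split[OF assms(2) mn assms(3) si assms(7,8)])
      also have "\<dots> = (\<Sum>x\<in>so_tuples_in m u. so_char (2*n) (replicate (n - m) u @ x) r *
          so_char (2*m) (signed (- 1) x) s)"
        using so_char_signed[OF so_tuples_inD assms(4) s] by (simp add: si_def)
      finally show ?thesis by (simp only: e)
    qed
    then show "so_char (2*n + 2*m) (signed \<epsilon> (replicate (n + m) u)) (r @ s) =
             (\<Sum>(\<mu>, \<delta>)\<in>signed_tuples_in m u.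
                so_char (2*n) (replicate (n - m) u @ signed \<delta> \<mu>) r *
                so_char (2*m) (signed (\<delta> * \<epsilon>) \<mu>) s)"
      unfolding rhs .
  }
  assume mn: "m \<le> n + 1"
  have "so_char (2*n + 2*m + 1) (replicate (n + m) u) (r @ s) =
      so_char (2 * Suc (n + m)) (replicate (Suc (n + m)) u) ((r @ s) @ [1])"
    using so_char_odd_rectangle[OF assms(7,8), of "r @ s" "n + m"] assms by (simp add: distrib_left)
  also have "\<dots> = so_char (2 * Suc (n + m)) (replicate (Suc (n + m)) u) ((r @ [1]) @ s)"
    using assms by (intro so_char_permute[OF st]) auto
  also have "\<dots> = so_char (2 * (n + 1) + 2 * m) (replicate (n + 1 + m) u) ((r @ [1]) @ s)"
    by simp
  also have "\<dots> = (\<Sum>x\<in>so_tuples_in m u. so_char (2 * (n + 1)) (replicate (n + 1 - m) u @ x) (r @ [1]) *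
      so_char (2 * m) x s)"
    using assms by (intro so_char_rectangle_split mn) auto
  also have "\<dots> = (\<Sum>(\<mu>, \<delta>)\<in>signed_tuples_in m u. so_char (2 * (n + 1)) (replicate (n + 1 - m) u @ signed \<delta> \<mu>) (r @ [1]) *
      so_char (2 * m) (signed \<delta> \<mu>) s)"
    by (rule sum_signed_tuples_in[OF assms(2,8), symmetric])
  finally show "so_char (2*n + 2*m + 1) (replicate (n + m) u) (r @ s) =
             (\<Sum>(\<mu>, \<delta>)\<in>signed_tuples_in m u.
                so_char (2*n + 2) (replicate (n + 1 - m) u @ signed \<delta> \<mu>) (r @ [1]) *
                so_char (2*m) (signed \<delta> \<mu>) s)"
    by (simp add: add.commute)
qed

end
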